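(* Let $\delta>0$ be a small constant independent of $n$. There is a constant $C>0$, independent of $n$, $\omega$ and $\xi$, such that for every irrational rotation symbol $\omega$ satisfying $0<\omega<n^{-\frac a2-\delta}$ and every $\xi\in\left[\frac12-\frac1{n^a},\frac12+\frac1{n^a}\right]$, $$|P_\omega^{h_n}(\xi)-P_{0^+}^{h_n}(\xi)|\le C\exp(-n^{\delta}).$$
   Context: The family $h_n$. Fix a constant $a>0$ and a positive integer $k$, both independent of $n$. For $n\in\mathbb{N}$, $n\geq 1$, let $h_0(x,x')=\frac12(x-x')^2$, $u_n(x)=\frac1{n^a}(1-\cos(2\pi x))$, and let $v_n:\mathbb{R}\to\mathbb{R}$ be a non-negative $C^k$ function such that $v_n(x+1)=v_n(x)$; $\operatorname{supp}v_n\cap[0,1]\subset[\frac12-\frac1{n^a},\frac12+\frac1{n^a}]$; $\max v_n=n^{-s}$; $\|v_n\|_{C^k}=O(n^{-s'})$ as $n\to\infty$, where $s,s'>0$ are constants independent of $n$ with $s'>a$ (for this it is enough to take $s=(k+2)a$). Set $h_n(x,x')=h_0(x,x')+u_n(x')+v_n(x')$. Minimal configurations. Let $h$ be a generating function of an exact area-preserving monotone twist map. A configuration $\mathbf{x}=(x_i)_{i\in\mathbb{Z}}\in\mathbb{R}^{\mathbb{Z}}$ is minimal (for $h$) if for all $i<j$ the segment $(x_i,\dots,x_j)$ minimizes $\sum_{i\le l<j}h(z_l,z_{l+1})$ among all $(z_i,\dots,z_j)$ with $z_i=x_i$, $z_j=x_j$. Every minimal configuration has a rotation number $\rho(\mathbf{x})=\lim_{m\to\infty}(x_{i+m}-x_i)/m$.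 If $\rho(\mathbf x)=\omega$ is irrational, its rotation symbol is $\omega$. If $\rho(\mathbf{x})=0$, its rotation symbol is $0+$, $0$, or $0-$ according to whether $x_{i+1}>x_i$ for all $i$, $x_{i+1}=x_i$ for all $i$, or $x_{i+1}<x_i$ for all $i$. For irrational $\omega$ let $M_\omega^h$ be the set of minimal configurations with rotation number $\omega$; let $M_{0^+}^h$ be the set of minimal configurations with rotation symbol $0$ or $0+$. These sets are totally ordered (distinct elements do not cross). Put $\mathcal{A}_\omega^h=\{x_0:\mathbf{x}\in M_\omega^h\}$ for $\omega$ irrational or $\omega=0^+$; it is a closed subset of $\mathbb{R}$. Peierls's barrier. Let $\omega$ be irrational or $\omega=0^+$. If $\xi\in\mathcal{A}_\omega^h$, set $P_\omega^h(\xi)=0$. Otherwise let $(\xi^-,\xi^+)$ be the complementary interval of $\mathcal{A}_\omega^h$ in $\mathbb{R}$ containing $\xi$, and let $\mathbf{x}^\pm=(x_i^\pm)_{i\in\mathbb{Z}}\in M_\omega^h$ with $x_0^\pm=\xi^\pm$. Then $$P_\omega^h(\xi)=\min\Bigl\{\sum_{i\in\mathbb{Z}}\bigl(h(x_i,x_{i+1})-h(x_i^-,x_{i+1}^-)\bigr)\ :\ x_i^-\le x_i\le x_i^+\ \text{for all } i\in\mathbb{Z},\ x_0=\xi\Bigr\}.$$ *)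

theory Defs
  imports "HOL-Analysis.Analysis" "HOL-Library.Landau_Symbols"
begin

section \<open>Functions of class $C^k$ and the family $h_n$\<close>

text \<open>
  \<open>(deriv ^^ j) f\<close> is the genuine j-th derivative of \<open>f\<close> only where the differentiability
  required in \<open>of_class_C\<close> holds.
\<close>

definition of_class_C :: "nat \<Rightarrow> (real \<Rightarrow> real) \<Rightarrow> bool" where
  "of_class_C k f \<longleftrightarrow>
     (\<forall>j<k. \<forall>x. (deriv ^^ j) f differentiable (at x)) \<and> continuous_on UNIV ((deriv ^^ k) f)"

text \<open>
  The supremum is meaningful only when the derivatives are bounded, for instance for a periodic
  function of class $C^k$.
\<close>

definition C_norm :: "nat \<Rightarrow> (real \<Rightarrow> real) \<Rightarrow> real" where
  "C_norm k f = (MAX j\<in>{..k}. SUP x. \<bar>(deriv ^^ j) f x\<bar>)"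

definition supp :: "(real \<Rightarrow> real) \<Rightarrow> real set" where
  "supp f = closure {x. f x \<noteq> 0}"

definition h0 :: "real \<Rightarrow> real \<Rightarrow> real" where
  "h0 x x' = (x - x')\<^sup>2 / 2"

definition u_pert :: "real \<Rightarrow> nat \<Rightarrow> real \<Rightarrow> real" where
  "u_pert a n x = 1 / real n powr a * (1 - cos (2 * pi * x))"

definition h_fam :: "real \<Rightarrow> (nat \<Rightarrow> real \<Rightarrow> real) \<Rightarrow> nat \<Rightarrow> real \<Rightarrow> real \<Rightarrow> real" where
  "h_fam a v n x x' = h0 x x' + u_pert a n x' + v n x'"

section \<open>Minimal configurations\<close>

type_synonym config = "int \<Rightarrow> real"

definition minimal_config :: "(real \<Rightarrow> real \<Rightarrow> real) \<Rightarrow> config \<Rightarrow> bool" where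
  "minimal_config h x \<longleftrightarrow>
     (\<forall>i j. i < j \<longrightarrow>
        (\<forall>z :: config. z i = x i \<and> z j = x j \<longrightarrow>
           (\<Sum>l\<in>{i..<j}. h (x l) (x (l + 1))) \<le> (\<Sum>l\<in>{i..<j}. h (z l) (z (l + 1)))))"

text \<open>The limit does not depend on the base point \<open>i\<close>.\<close>

definition has_rotation_number :: "config \<Rightarrow> real \<Rightarrow> bool" where
  "has_rotation_number x \<omega> \<longleftrightarrow>
     (\<forall>i. (\<lambda>m. (x (i + int m) - x i) / real m) \<longlonglongrightarrow> \<omega>)"

definition has_symbol_0 :: "config \<Rightarrow> bool" where
  "has_symbol_0 x \<longleftrightarrow> has_rotation_number x 0 \<and> (\<forall>i. x (i + 1) = x i)"

definition has_symbol_0plus :: "config \<Rightarrow> bool" where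
  "has_symbol_0plus x \<longleftrightarrow> has_rotation_number x 0 \<and> (\<forall>i. x (i + 1) > x i)"

text \<open>\<open>M_irr h \<omega>\<close> is the set $M_\omega^h$; it is meant for irrational \<open>\<omega>\<close> only.\<close>

definition M_irr :: "(real \<Rightarrow> real \<Rightarrow> real) \<Rightarrow> real \<Rightarrow> config set" where
  "M_irr h \<omega> = {x. minimal_config h x \<and> has_rotation_number x \<omega>}"

definition M_0plus :: "(real \<Rightarrow> real \<Rightarrow> real) \<Rightarrow> config set" where
  "M_0plus h = {x. minimal_config h x \<and> (has_symbol_0 x \<or> has_symbol_0plus x)}"

definition proj0 :: "config set \<Rightarrow> real set" where
  "proj0 M = (\<lambda>x. x 0) ` M"

section \<open>Peierls's barrier\<close>

text \<open>
  The barrier is defined for an arbitrary set \<open>M\<close> of configurations, so that $P_\omega^h$ and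
  $P_{0^+}^h$ are instances of one definition. For \<open>\<xi>\<close> outside \<open>proj0 M\<close>, the pair
  \<open>xm\<close>, \<open>xp\<close> lies above the endpoints of the complementary interval containing \<open>\<xi>\<close>.
\<close>

definition gap_configs :: "config set \<Rightarrow> real \<Rightarrow> config \<Rightarrow> config \<Rightarrow> bool" where
  "gap_configs M \<xi> xm xp \<longleftrightarrow>
     xm \<in> M \<and> xp \<in> M \<and> xm 0 < \<xi> \<and> \<xi> < xp 0 \<and> {xm 0<..<xp 0} \<inter> proj0 M = {}"

definition barrier_sums ::
    "(real \<Rightarrow> real \<Rightarrow> real) \<Rightarrow> real \<Rightarrow> config \<Rightarrow> config \<Rightarrow> real set" where
  "barrier_sums h \<xi> xm xp =
     {S. \<exists>x :: config. (\<forall>i. xm i \<le> x i \<and> x i \<le> xp i) \<and> x 0 = \<xi> \<and>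
          ((\<lambda>i. h (x i) (x (i + 1)) - h (xm i) (xm (i + 1))) has_sum S) UNIV}"

definition peierls_barrier ::
    "(real \<Rightarrow> real \<Rightarrow> real) \<Rightarrow> config set \<Rightarrow> real \<Rightarrow> real" where
  "peierls_barrier h M \<xi> =
     (if \<xi> \<in> proj0 M then 0
      else (THE p. \<exists>xm xp. gap_configs M \<xi> xm xp \<and>
              p \<in> barrier_sums h \<xi> xm xp \<and> (\<forall>q\<in>barrier_sums h \<xi> xm xp. p \<le> q)))"

definition P_irr :: "(real \<Rightarrow> real \<Rightarrow> real) \<Rightarrow> real \<Rightarrow> real \<Rightarrow> real" where
  "P_irr h \<omega> \<xi> = peierls_barrier h (M_irr h \<omega>) \<xi>"

definition P_0plus :: "(real \<Rightarrow> real \<Rightarrow> real) \<Rightarrow> real \<Rightarrow> real" where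
  "P_0plus h \<xi> = peierls_barrier h (M_0plus h) \<xi>"

end

theory Submission
  imports Defs
begin

text \<open>
  Put \<open>V x = u_pert a n x + v n x\<close>, so that the generating function is \<open>(x - x')\<^sup>2 / 2 + V x'\<close> with \<open>V\<close>
  nonnegative, 1-periodic and of class $C^1$. For large \<open>n\<close> the bump stays away from the integers,
  \<open>V\<close> vanishes exactly at the integers, and near them \<open>V\<close> is the unperturbed cosine.

  Why the two barriers are close. A configuration that passes the bump while it moves from 0 to 1, of
  rotation symbol 0+ or of small frequency, spends almost all of its time exponentially close to the
  integers. Where two configurations both lie within \<open>\<epsilon>\<close> of an integer one can jump from the one to the
  other at a cost \<open>O(\<epsilon>)\<close>. So both barriers are decided, up to \<open>O(\<epsilon>)\<close>, inside one common window of
  indices in which everything travels from \<open>\<epsilon>\<close>-near 0 to \<open>\<epsilon>\<close>-near 1, and there the two variational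
  problems are the same (\<open>barrier_comparison\<close>). The condition that competitors lie between $x^-$ and $x^+$
  costs nothing: the action is submodular, so replacing a competitor by its minimum with $x^+$ and then
  its maximum with $x^-$ does not raise the action.

  Why \<open>\<epsilon>\<close> is exponentially small. Let \<open>\<theta> = n powr (- a / 2)\<close>. A configuration of frequency below
  \<open>\<theta> / n powr \<delta>\<close> needs at least about \<open>T = n powr \<delta> / \<theta>\<close> steps to advance by 1. Minimality allows only
  \<open>O(1 / \<theta>)\<close> of them in the middle half of a period: walking back to an adjacent integer, waiting there for
  free and returning costs \<open>O(\<theta>)\<close>, whereas each step in the middle half costs at least \<open>\<theta>\<^sup>2\<close>
  (\<open>minimal_dwell_bound\<close>). The other steps lie within 1/4 of an integer, where the
  Euler-Lagrange equation makes the distance to the integer dominated by a sum of two geometric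
  sequences of ratio \<open>1 + 3 * \<theta>\<close>, one decaying from each end (\<open>discrete_convex_decay\<close>). In the middle
  of the stay this gives \<open>(1 + 3 * \<theta>) powr (- T / 2 + O(1 / \<theta>))\<close>, which is \<open>O(exp (- n powr \<delta>))\<close>.

  What has to be known about minimal configurations. The comparison uses that a barrier is a unique,
  attained minimum. This follows (locale \<open>ordered_family\<close>, \<open>barrier_data_exists\<close>) when the minimal
  configurations in question are totally ordered, invariant under translations and closed under
  pointwise limits, and when every gap lies below its shift by one index and has finite total length.
  Everything rests on one
  consequence of submodularity: if the maximum of two minimal configurations is again minimal, then it
  coincides with the one that it touches, by the Euler-Lagrange equation. This yields Aubry's crossing
  lemma and the fact that asymptotic minimal configurations do not cross.

  For irrational \<open>\<omega>\<close>, configurations that are ordered like a rotation exist as limits of periodic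
  minimizers; crossing arguments against them show that every minimal configuration of rotation number
  \<open>\<omega>\<close> is of this kind; and two such configurations that crossed would enclose intervals that are
  disjoint modulo 1, hence would be asymptotic. For the symbols 0 and 0+, a minimal configuration
  cannot pass a minimum point of \<open>V\<close>, since stopping there for one step would be a cheaper
  way to spend time, so that any two of them are separated by a minimum point or are asymptotic.

  The remaining finitely many \<open>n\<close>, for which the bump may cover the whole period, only need a bound on
  the barriers that is uniform in \<open>\<omega>\<close> and \<open>\<xi>\<close> (\<open>peierls_barrier_bounded\<close>).
\<close>

section \<open>The action and its minimizers\<close>

lemma critical_point_of_bond_sum:
  fixes V :: "real \<Rightarrow> real"
  assumes diff: "V differentiable at x"
    and min: "\<And>t. (a - x)\<^sup>2 / 2 + V x + (x - b)\<^sup>2 / 2 \<le> (a - t)\<^sup>2 / 2 + V t + (t - b)\<^sup>2 / 2"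
  shows "a + b = 2 * x + deriv V x"
proof -
  have V': "(V has_real_derivative deriv V x) (at x)"
    using diff by (simp add: DERIV_deriv_iff_real_differentiable)
  have "((\<lambda>t. (a - t)\<^sup>2 / 2 + V t + (t - b)\<^sup>2 / 2) has_real_derivative
          (- (a - x) + deriv V x + (x - b))) (at x)"
    by (auto intro!: derivative_eq_intros V' simp: field_simps)
  from DERIV_local_min[OF this, of 1] min have "- (a - x) + deriv V x + (x - b) = 0"
    by auto
  then show ?thesis by simp
qed

text \<open>
  The Lipschitz bound controls the change of action when an endpoint moves, and makes the barrier sums
  converge. It is kept out of all estimates that have to be uniform in \<open>n\<close>.
\<close>

locale twist_potential =
  fixes V :: "real \<Rightarrow> real" and L :: real
  assumes V_diff: "V differentiable at x"
    and V_periodic: "V (x + 1) = V x"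
    and V_nonneg: "0 \<le> V x"
    and V_lipschitz: "\<bar>V x - V y\<bar> \<le> L * \<bar>x - y\<bar>"
begin

definition h :: "real \<Rightarrow> real \<Rightarrow> real" where
  "h x y = (x - y)\<^sup>2 / 2 + V y"

definition action :: "config \<Rightarrow> int \<Rightarrow> int \<Rightarrow> real" where
  "action x i j = (\<Sum>l\<in>{i..<j}. h (x l) (x (l + 1)))"

abbreviation minimal :: "config \<Rightarrow> bool" where
  "minimal \<equiv> minimal_config h"

lemma h_nonneg: "0 \<le> h x y"
  by (simp add: h_def V_nonneg)

lemma L_nonneg: "0 \<le> L"
  using V_lipschitz[of 0 1] by auto

lemma V_continuous: "continuous_on UNIV V"
  by (intro continuous_at_imp_continuous_on ballI differentiable_imp_continuous_within V_diff)

lemma V_periodic_nat: "V (x + real n) = V x"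
proof (induction n)
  case (Suc n)
  have "x + real (Suc n) = (x + real n) + 1" by simp
  then have "V (x + real (Suc n)) = V (x + real n)" using V_periodic[of "x + real n"] by metis
  then show ?case using Suc by simp
qed simp

lemma V_periodic_int: "V (x + of_int p) = V x"
proof (cases "p \<ge> 0")
  case True
  then show ?thesis using V_periodic_nat[of x "nat p"] by simp
next
  case False
  then show ?thesis using V_periodic_nat[of "x + of_int p" "nat (- p)"] by simp
qed

lemma h_translate: "h (x + of_int p) (y + of_int p) = h x y"
  by (simp add: h_def V_periodic_int)

lemma action_split:
  "i \<le> j \<Longrightarrow> j \<le> k \<Longrightarrow> action x i k = action x i j + action x j k"
proof -
  assume "i \<le> j" "j \<le> k"
  then have "{i..<k} = {i..<j} \<union> {j..<k}" by auto
  then show ?thesis unfolding action_def by (simp add: sum.union_disjoint)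
qed

lemma action_cong:
  "(\<And>l. i \<le> l \<Longrightarrow> l \<le> j \<Longrightarrow> x l = y l) \<Longrightarrow> action x i j = action y i j"
  unfolding action_def by (intro sum.cong) auto

lemma action_single: "action x i (i + 1) = h (x i) (x (i + 1))"
proof -
  have "{i..<i + 1} = {i}" by auto
  then show ?thesis by (simp add: action_def)
qed

lemma action_empty: "j \<le> i \<Longrightarrow> action x i j = 0"
  by (simp add: action_def)

lemma action_nonneg: "0 \<le> action x i j"
  unfolding action_def by (intro sum_nonneg h_nonneg)

lemma action_translate:
  "action (\<lambda>i. x (i + q) + of_int p) i j = action x (i + q) (j + q)"
  unfolding action_def h_translate
  by (rule sum.reindex_bij_witness[of _ "\<lambda>l. l - q" "\<lambda>l. l + q"]) (auto simp: algebra_simps)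

lemma minimalD:
  "minimal x \<Longrightarrow> z i = x i \<Longrightarrow> z j = x j \<Longrightarrow> action x i j \<le> action z i j"
  unfolding minimal_config_def action_def by (cases "i < j") auto

lemma minimalI:
  "(\<And>i j z. i < j \<Longrightarrow> z i = x i \<Longrightarrow> z j = x j \<Longrightarrow> action x i j \<le> action z i j) \<Longrightarrow> minimal x"
  unfolding minimal_config_def action_def by auto

lemma minimal_translate:
  assumes "minimal x" shows "minimal (\<lambda>i. x (i + q) + of_int p)"
proof (rule minimalI)
  fix i j and z :: config
  assume *: "i < j" "z i = x (i + q) + of_int p" "z j = x (j + q) + of_int p"
  define z' where "z' = (\<lambda>l. z (l + - q) + of_int (- p))"
  have "action x (i + q) (j + q) \<le> action z' (i + q) (j + q)"
    by (rule minimalD[OF assms]) (simp_all add: z'_def *)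
  also have "\<dots> = action z i j"
    unfolding z'_def by (subst action_translate) simp
  finally show "action (\<lambda>i. x (i + q) + real_of_int p) i j \<le> action z i j"
    by (simp add: action_translate)
qed

text \<open>
  A change of a minimal configuration on a bounded interval that does not raise the action there
  produces another minimizer. Together with \<open>minimal_touch\<close> this turns equality of actions into
  equality of configurations.
\<close>

lemma minimal_exchange:
  assumes y: "minimal y" and "i \<le> k"
    and agree: "\<And>l. l \<le> i \<or> k \<le> l \<Longrightarrow> m l = y l"
    and le: "action m i k \<le> action y i k"
  shows "minimal m"
proof (rule minimalI)
  fix i' k' and z :: config
  assume *: "i' < k'" "z i' = m i'" "z k' = m k'"
  \<comment> \<open>An interval that contains both the modified part and the variation to be tested.\<close>
  define a where "a = min i i'"
  define b where "b = max k k'"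
  define w where "w = (\<lambda>l. if i' \<le> l \<and> l \<le> k' then z l else m l)"
  have ord: "a \<le> i'" "a \<le> i" "k' \<le> b" "k \<le> b" "i' \<le> k'" "a \<le> b" "i \<le> b" "i' \<le> b"
    using * \<open>i \<le> k\<close> by (auto simp: a_def b_def)
  have "w a = m a" "w b = m b" using * ord by (auto simp: w_def)
  then have "w a = y a" "w b = y b" using agree ord by auto
  then have 1: "action y a b \<le> action w a b" by (rule minimalD[OF y])
  have 2: "action w a b = action w a i' + action w i' k' + action w k' b"
    using ord action_split[of a i' b w] action_split[of i' k' b w] by auto
  have 3: "action w a i' = action m a i'" "action w i' k' = action z i' k'"
    "action w k' b = action m k' b"
    using * ord by (auto intro!: action_cong simp: w_def)
  have 4: "action m a b = action m a i' + action m i' k' + action m k' b"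
    using ord action_split[of a i' b m] action_split[of i' k' b m] by auto
  have 5: "action m a b = action m a i + action m i k + action m k b"
    "action y a b = action y a i + action y i k + action y k b"
    using ord \<open>i \<le> k\<close> action_split[of a i b] action_split[of i k b] by auto
  have 6: "action m a i = action y a i" "action m k b = action y k b"
    using agree by (auto intro!: action_cong)
  show "action m i' k' \<le> action z i' k'"
    using 1 2 3 4 5 6 le by linarith
qed

text \<open>
  The mixed derivative of \<open>h\<close> is -1: interchanging two bonds that cross lowers the elastic energy,
  and leaves the potential energy unchanged.
\<close>

lemma h_submodular:
  "h (min a b) (min a' b') + h (max a b) (max a' b') \<le> h a a' + h b b'"
proof -
  have *: "(a - b')\<^sup>2 / 2 + (b - a')\<^sup>2 / 2 \<le> (a - a')\<^sup>2 / 2 + (b - b')\<^sup>2 / 2"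
    if "(a - b) * (a' - b') \<le> 0"
  proof -
    have "(a - a')\<^sup>2 / 2 + (b - b')\<^sup>2 / 2 - ((a - b')\<^sup>2 / 2 + (b - a')\<^sup>2 / 2) = - ((a - b) * (a' - b'))"
      by (simp add: power2_eq_square field_simps)
    then show ?thesis using that by linarith
  qed
  have "(a - b) * (a' - b') \<le> 0" if "a \<le> b \<longleftrightarrow> \<not> a' \<le> b'"
    using that by (auto simp: mult_le_0_iff)
  with * show ?thesis
    by (cases "a \<le> b"; cases "a' \<le> b'") (auto simp: h_def min_def max_def)
qed

lemma action_submodular:
  "action (\<lambda>l. min (x l) (y l)) i j + action (\<lambda>l. max (x l) (y l)) i j \<le> action x i j + action y i j"
  unfolding action_def sum.distrib[symmetric] by (intro sum_mono h_submodular)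

text \<open>
  The discrete Euler-Lagrange equation.
\<close>

definition EL :: "config \<Rightarrow> bool" where
  "EL x \<longleftrightarrow> (\<forall>i. x (i - 1) + x (i + 1) = 2 * x i + deriv V (x i))"

lemma action_two: "action x (i - 1) (i + 1) = h (x (i - 1)) (x i) + h (x i) (x (i + 1))"
  using action_split[of "i - 1" i "i + 1" x] action_single[of x "i - 1"] action_single[of x i] by simp

lemma minimal_imp_EL:
  assumes "minimal x" shows "EL x"
  unfolding EL_def
proof
  fix i
  show "x (i - 1) + x (i + 1) = 2 * x i + deriv V (x i)"
  proof (rule critical_point_of_bond_sum[OF V_diff])
    fix t
    have "action x (i - 1) (i + 1) \<le> action (x(i := t)) (i - 1) (i + 1)"
      by (rule minimalD[OF assms]) auto
    then show "(x (i - 1) - x i)\<^sup>2 / 2 + V (x i) + (x i - x (i + 1))\<^sup>2 / 2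
       \<le> (x (i - 1) - t)\<^sup>2 / 2 + V t + (t - x (i + 1))\<^sup>2 / 2"
      by (simp add: action_two h_def)
  qed
qed

text \<open>
  At a point of contact the equation forces the sums of the two neighbours to agree, and by the order
  both neighbours agree; contact thus spreads over all indices.
\<close>

lemma EL_touch:
  assumes "EL x" "EL y" and le: "\<And>i. x i \<le> y i" and touch: "x c = y c"
  shows "x = y"
proof -
  have step: "x (i - 1) = y (i - 1) \<and> x (i + 1) = y (i + 1)" if "x i = y i" for i
  proof -
    have "x (i - 1) + x (i + 1) = y (i - 1) + y (i + 1)"
      using assms(1,2) that by (simp add: EL_def)
    then show ?thesis using le[of "i - 1"] le[of "i + 1"] by linarith
  qed
  have "x i = y i" for i
  proof (induction i rule: int_induct[where k = c])
    case base show ?case by (rule touch)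
  next
    case (step1 i) then show ?case using step[of i] by simp
  next
    case (step2 i) then show ?case using step[of i] by simp
  qed
  then show ?thesis by auto
qed

lemma minimal_touch:
  "minimal x \<Longrightarrow> minimal y \<Longrightarrow> (\<And>i. x i \<le> y i) \<Longrightarrow> x c = y c \<Longrightarrow> x = y"
  using EL_touch minimal_imp_EL by blast

section \<open>Crossings, splices and limits of minimal configurations\<close>

text \<open>
  Two minimal configurations cross at most once. Otherwise replace \<open>y\<close> by the maximum of \<open>x\<close> and \<open>y\<close>
  between the two crossings: by submodularity the result is minimal, and it touches \<open>y\<close> from above, so
  it is \<open>y\<close>.
\<close>

lemma Aubry_crossing:
  assumes x: "minimal x" and y: "minimal y"
    and le: "x i \<le> y i" "x k \<le> y k" and j: "i \<le> j" "j \<le> k"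
  shows "x j \<le> y j"
proof -
  define w where "w = (\<lambda>l. min (x l) (y l))"
  define m where "m = (\<lambda>l. if i \<le> l \<and> l \<le> k then max (x l) (y l) else y l)"
  have "action x i k \<le> action w i k"
    using le by (intro minimalD[OF x]) (auto simp: w_def min_def)
  moreover have "action w i k + action (\<lambda>l. max (x l) (y l)) i k \<le> action x i k + action y i k"
    unfolding w_def by (rule action_submodular)
  moreover have "action m i k = action (\<lambda>l. max (x l) (y l)) i k"
    by (rule action_cong) (auto simp: m_def)
  ultimately have le': "action m i k \<le> action y i k" by linarith
  have "minimal m"
    by (rule minimal_exchange[OF y _ _ le']) (use le j in \<open>auto simp: m_def\<close>)
  moreover have "y l \<le> m l" for l by (simp add: m_def)
  moreover have "y i = m i" using le by (simp add: m_def)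
  ultimately have "y = m" by (rule minimal_touch[OF y])
  then have "y j = m j" by simp
  then show ?thesis using j by (simp add: m_def max_def split: if_splits)
qed

definition splice :: "config \<Rightarrow> config \<Rightarrow> int \<Rightarrow> int \<Rightarrow> config" where
  "splice x z i j = (\<lambda>l. if i \<le> l \<and> l \<le> j then z l else x l)"

text \<open>
  The price of leaving \<open>x\<close> for \<open>z\<close> at index \<open>i\<close> and returning at \<open>j\<close>. Only the steps of \<open>x\<close> enter, so
  \<open>z\<close> may be arbitrary elsewhere.
\<close>

definition splice_cost :: "config \<Rightarrow> config \<Rightarrow> int \<Rightarrow> int \<Rightarrow> real" where
  "splice_cost x z i j =
     (h (x (i - 1)) (z i) - h (x (i - 1)) (x i)) + (h (z j) (x (j + 1)) - h (x j) (x (j + 1)))"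

lemma action_splice:
  assumes "i \<le> j"
  shows "action (splice x z i j) (i - 1) (j + 1) - action x (i - 1) (j + 1)
           = action z i j - action x i j + splice_cost x z i j"
proof -
  have *: "action w (i - 1) (j + 1) = h (w (i - 1)) (w i) + action w i j + h (w j) (w (j + 1))" for w
    using assms action_split[of "i - 1" i "j + 1" w] action_split[of i j "j + 1" w]
      action_single[of w "i - 1"] action_single[of w j] by simp
  have "action (splice x z i j) i j = action z i j"
    by (rule action_cong) (auto simp: splice_def)
  then show ?thesis
    using assms by (simp add: * splice_cost_def) (simp add: splice_def)
qed

lemma minimal_splice:
  assumes "minimal x" "i \<le> j"
  shows "action x i j - splice_cost x z i j \<le> action z i j"
proof -
  have "action x (i - 1) (j + 1) \<le> action (splice x z i j) (i - 1) (j + 1)"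
    by (rule minimalD[OF assms(1)]) (auto simp: splice_def)
  then show ?thesis using action_splice[OF assms(2), of x z] by linarith
qed

lemma half_square_diff_le:
  fixes a b c d B :: real
  assumes "\<bar>a - b\<bar> \<le> B" "\<bar>c - b\<bar> \<le> d"
  shows "\<bar>(a - c)\<^sup>2 / 2 - (a - b)\<^sup>2 / 2\<bar> \<le> d * (B + d)"
proof -
  have eq: "(a - c)\<^sup>2 / 2 - (a - b)\<^sup>2 / 2 = (c - b) * ((c - b) / 2 - (a - b))"
    by (simp add: power2_eq_square field_simps)
  have "0 \<le> d" using assms by linarith
  moreover have "\<bar>(c - b) / 2 - (a - b)\<bar> \<le> B + d" 
  proof -
    have "c - b \<le> d" "b - c \<le> d" "a - b \<le> B" "b - a \<le> B" using assms by (simp_all add: abs_le_iff)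
    then show ?thesis using \<open>0 \<le> d\<close> by (intro abs_leI) (simp_all add: field_simps)
  qed
  moreover have "\<bar>(c - b) * ((c - b) / 2 - (a - b))\<bar> = \<bar>c - b\<bar> * \<bar>(c - b) / 2 - (a - b)\<bar>"
    by (rule abs_mult)
  ultimately show ?thesis unfolding eq using assms(2) by (simp add: mult_mono)
qed

lemma splice_cost_le:
  assumes "\<And>l. \<bar>x l - x (l + 1)\<bar> \<le> B"
    and "\<bar>z i - x i\<bar> \<le> d" "\<bar>z j - x j\<bar> \<le> e" "\<bar>V (z i) - V (x i)\<bar> \<le> M"
  shows "\<bar>splice_cost x z i j\<bar> \<le> d * (B + d) + M + e * (B + e)"
proof -
  have 1: "\<bar>(x (i - 1) - z i)\<^sup>2 / 2 - (x (i - 1) - x i)\<^sup>2 / 2\<bar> \<le> d * (B + d)"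
    by (rule half_square_diff_le) (use assms(1)[of "i - 1"] assms(2) in auto)
  have 2: "\<bar>(x (j + 1) - z j)\<^sup>2 / 2 - (x (j + 1) - x j)\<^sup>2 / 2\<bar> \<le> e * (B + e)"
    by (rule half_square_diff_le) (use assms(1)[of j] assms(3) in auto)
  show ?thesis
    using 1 2 assms(4) unfolding splice_cost_def h_def by (simp add: power2_commute abs_le_iff)
qed

lemma bounded_factor_tendsto_0:
  fixes d :: "nat \<Rightarrow> real"
  assumes "d \<longlonglongrightarrow> 0" shows "(\<lambda>n. d n * (B + d n)) \<longlonglongrightarrow> 0"
  using tendsto_mult[OF assms tendsto_add[OF tendsto_const assms, of B]] by simp

lemma splice_cost_tendsto_0:
  assumes B: "\<And>l. \<bar>x l - x (l + 1)\<bar> \<le> B"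
    and "(\<lambda>n. z n (i n) - x (i n)) \<longlonglongrightarrow> 0" "(\<lambda>n. z n (j n) - x (j n)) \<longlonglongrightarrow> 0"
  shows "(\<lambda>n. splice_cost x (z n) (i n) (j n)) \<longlonglongrightarrow> (0::real)"
proof -
  define d where "d = (\<lambda>n. \<bar>z n (i n) - x (i n)\<bar>)"
  define e where "e = (\<lambda>n. \<bar>z n (j n) - x (j n)\<bar>)"
  have d: "d \<longlonglongrightarrow> 0" and e: "e \<longlonglongrightarrow> 0"
    using assms(2,3) by (auto simp: d_def e_def intro: tendsto_rabs_zero)
  have "(\<lambda>n. d n * (B + d n) + L * d n + e n * (B + e n)) \<longlonglongrightarrow> 0 + L * 0 + 0"
    by (intro tendsto_intros bounded_factor_tendsto_0 d e)
  then have lim: "(\<lambda>n. d n * (B + d n) + L * d n + e n * (B + e n)) \<longlonglongrightarrow> 0" by simp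
  have "\<bar>splice_cost x (z n) (i n) (j n)\<bar> \<le> d n * (B + d n) + L * d n + e n * (B + e n)" for n
    by (rule splice_cost_le) (auto simp: d_def e_def V_lipschitz B)
  then show ?thesis
    by (intro Lim_null_comparison[OF _ lim]) auto
qed

text \<open>
  The maximum of the two configurations is minimal: up to splice costs that vanish in the limit it has
  the endpoints of \<open>y\<close>, and the minimum has those of \<open>x\<close>, so submodularity bounds its action. As it
  touches one of the two, it equals that one.
\<close>

lemma asymptotic_minimal_comparable:
  assumes x: "minimal x" and y: "minimal y"
    and Bx: "\<And>l. \<bar>x l - x (l + 1)\<bar> \<le> B" and By: "\<And>l. \<bar>y l - y (l + 1)\<bar> \<le> B"
    and top: "(\<lambda>n. x (int n) - y (int n)) \<longlonglongrightarrow> 0"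
    and bot: "(\<lambda>n. x (- int n) - y (- int n)) \<longlonglongrightarrow> 0"
  shows "(\<forall>i. x i \<le> y i) \<or> (\<forall>i. y i \<le> x i)"
proof -
  define w where "w = (\<lambda>l. min (x l) (y l))"
  define m where "m = (\<lambda>l. max (x l) (y l))"
  have "minimal m"
  proof (rule minimalI)
    fix i j and z :: config
    assume *: "i < j" "z i = m i" "z j = m j"
    define w' where "w' = (\<lambda>l. if i \<le> l \<and> l \<le> j then z l else m l)"
    let ?c = "\<lambda>n. splice_cost x w (- int n) (int n) + splice_cost y w' (- int n) (int n)"
    have small: "\<bar>w l - x l\<bar> \<le> \<bar>x l - y l\<bar>" for l by (auto simp: w_def)
    have small': "\<bar>m l - y l\<bar> \<le> \<bar>x l - y l\<bar>" for l by (auto simp: m_def)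
    have "w' l = m l" if "l \<le> i \<or> j \<le> l" for l using that * by (auto simp: w'_def)
    then have "w' l = m l" if "\<bar>i\<bar> + \<bar>j\<bar> \<le> \<bar>l\<bar>" for l
      using that by (cases "l \<le> i") (auto simp: abs_if split: if_splits)
    then have ev: "eventually (\<lambda>n. w' (int n) = m (int n) \<and> w' (- int n) = m (- int n)) sequentially"
      by (intro eventually_sequentiallyI[of "nat (\<bar>i\<bar> + \<bar>j\<bar>)"]) (simp add: nat_le_iff)
    have "(\<lambda>n. splice_cost x w (- int n) (int n)) \<longlonglongrightarrow> 0"
    proof (intro splice_cost_tendsto_0[where z = "\<lambda>_. w"])
      show "\<bar>x l - x (l + 1)\<bar> \<le> B" for l by (rule Bx)
      show "(\<lambda>n. w (- int n) - x (- int n)) \<longlonglongrightarrow> 0"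
        by (rule Lim_null_comparison[OF _ tendsto_rabs_zero[OF bot]])
           (simp add: small)
      show "(\<lambda>n. w (int n) - x (int n)) \<longlonglongrightarrow> 0"
        by (rule Lim_null_comparison[OF _ tendsto_rabs_zero[OF top]])
           (simp add: small)
    qed
    moreover have "(\<lambda>n. splice_cost y w' (- int n) (int n)) \<longlonglongrightarrow> 0"
    proof (intro splice_cost_tendsto_0[where z = "\<lambda>_. w'"])
      show "\<bar>y l - y (l + 1)\<bar> \<le> B" for l by (rule By)
      show "(\<lambda>n. w' (- int n) - y (- int n)) \<longlonglongrightarrow> 0"
        by (rule Lim_null_comparison[OF eventually_mono[OF ev] tendsto_rabs_zero[OF bot]])
           (simp add: small')
      show "(\<lambda>n. w' (int n) - y (int n)) \<longlonglongrightarrow> 0"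
        by (rule Lim_null_comparison[OF eventually_mono[OF ev] tendsto_rabs_zero[OF top]])
           (simp add: small')
    qed
    ultimately have "?c \<longlonglongrightarrow> 0 + 0" by (rule tendsto_add)
    then have c0: "(\<lambda>n. action m i j - action z i j - ?c n) \<longlonglongrightarrow> action m i j - action z i j - (0 + 0)"
      by (rule tendsto_diff[OF tendsto_const])
    have "action m i j - action z i j - ?c n \<le> 0" if n: "n \<ge> nat (\<bar>i\<bar> + \<bar>j\<bar>)" for n
    proof -
      let ?a = "- int n" and ?b = "int n"
      have ord: "?a \<le> i" "i \<le> j" "j \<le> ?b" "i \<le> ?b" "?a \<le> ?b" using n * by auto
      have 1: "action x ?a ?b - splice_cost x w ?a ?b \<le> action w ?a ?b"
        "action y ?a ?b - splice_cost y w' ?a ?b \<le> action w' ?a ?b"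
        by (intro minimal_splice x y ord)+
      have 2: "action w ?a ?b + action m ?a ?b \<le> action x ?a ?b + action y ?a ?b"
        unfolding w_def m_def by (rule action_submodular)
      have 3: "action u ?a ?b = action u ?a i + action u i j + action u j ?b" for u
        using ord action_split[of ?a i ?b u] action_split[of i j ?b u] by auto
      have 4: "action w' ?a i = action m ?a i" "action w' i j = action z i j"
        "action w' j ?b = action m j ?b"
        using * by (auto intro!: action_cong simp: w'_def)
      from 1 2 3[of m] 3[of w'] 4 show ?thesis by linarith
    qed
    then have "eventually (\<lambda>n. action m i j - action z i j - ?c n \<le> 0) sequentially"
      by (rule eventually_sequentiallyI)
    then have "action m i j - action z i j - (0 + 0) \<le> 0"
      by (rule tendsto_upperbound[OF c0]) simp
    then show "action m i j \<le> action z i j" by simp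
  qed
  have le: "x l \<le> m l" "y l \<le> m l" for l by (simp_all add: m_def)
  have "x 0 = m 0 \<or> y 0 = m 0" by (simp add: m_def max_def)
  then have "x = m \<or> y = m"
    using minimal_touch[OF x \<open>minimal m\<close> le(1)] minimal_touch[OF y \<open>minimal m\<close> le(2)] by auto
  then show ?thesis
  proof
    assume "x = m" then show ?thesis using le(2) by simp
  next
    assume "y = m" then show ?thesis using le(1) by simp
  qed
qed

lemma h_tendsto:
  assumes "(f \<longlongrightarrow> a) F" "(g \<longlongrightarrow> b) F"
  shows "((\<lambda>n. h (f n) (g n)) \<longlongrightarrow> h a b) F"
proof -
  have "((\<lambda>n. V (g n)) \<longlongrightarrow> V b) F"
    using V_continuous assms(2) continuous_on_tendsto_compose[of UNIV V g b F] by auto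
  then show ?thesis unfolding h_def using assms by (intro tendsto_intros)
      auto
qed

lemma action_tendsto:
  assumes "\<And>l. ((\<lambda>n. X n l) \<longlongrightarrow> x l) F"
  shows "((\<lambda>n. action (X n) i j) \<longlongrightarrow> action x i j) F"
  unfolding action_def by (intro tendsto_sum h_tendsto assms)

text \<open>
  A competitor of the limit becomes a competitor of the n-th configuration after moving its two
  endpoints, and the action over a bounded interval is continuous.
\<close>

lemma minimal_limit:
  assumes X: "\<And>n. minimal (X n)" and lim: "\<And>l. (\<lambda>n. X n l) \<longlonglongrightarrow> x l"
  shows "minimal x"
proof (rule minimalI)
  fix i j and z :: config
  assume *: "i < j" "z i = x i" "z j = x j"
  define Z where "Z = (\<lambda>n l. z l + (if l = i \<or> l = j then X n l - x l else 0))"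
  have "(\<lambda>n. Z n l) \<longlonglongrightarrow> z l" for l
  proof -
    have "(\<lambda>n. z l + (X n l - x l)) \<longlonglongrightarrow> z l + (x l - x l)" by (intro tendsto_intros lim)
    then show ?thesis using tendsto_const[of "z l"] by (cases "l = i \<or> l = j") (auto simp: Z_def)
  qed
  then have "(\<lambda>n. action (Z n) i j) \<longlonglongrightarrow> action z i j" by (rule action_tendsto)
  moreover have "(\<lambda>n. action (X n) i j) \<longlonglongrightarrow> action x i j" by (rule action_tendsto[OF lim])
  moreover have "action (X n) i j \<le> action (Z n) i j" for n
    by (rule minimalD[OF X]) (auto simp: Z_def *)
  ultimately show "action x i j \<le> action z i j" by (intro LIMSEQ_le) auto
qed

end

lemma config_box_compact: "compact {x :: config. \<forall>i. l i \<le> x i \<and> x i \<le> u i}"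
proof -
  have "compactin (product_topology (\<lambda>_. euclidean) UNIV) (PiE UNIV (\<lambda>i. {l i..u i}))"
    by (rule compactin_PiE[THEN iffD2]) (auto simp: compactin_euclidean_iff)
  moreover have "PiE UNIV (\<lambda>i. {l i..u i}) = {x :: config. \<forall>i. l i \<le> x i \<and> x i \<le> u i}"
    by (auto simp: PiE_iff)
  ultimately show ?thesis by (simp add: euclidean_product_topology compactin_euclidean_iff)
qed

lemma config_convergent_subsequence:
  fixes X :: "nat \<Rightarrow> config"
  assumes "\<And>n i. \<bar>X n i\<bar> \<le> R i"
  obtains x r where "strict_mono (r :: nat \<Rightarrow> nat)" "\<And>i. (\<lambda>n. X (r n) i) \<longlonglongrightarrow> x i"
proof -
  have "seq_compact {x :: config. \<forall>i. - R i \<le> x i \<and> x i \<le> R i}"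
    using config_box_compact[of "\<lambda>i. - R i" R] unfolding compact_eq_seq_compact_metric .
  moreover have "\<forall>n. X n \<in> {x. \<forall>i. - R i \<le> x i \<and> x i \<le> R i}"
    using assms by (auto simp: abs_le_iff minus_le_iff)
  ultimately obtain x r where xr: "strict_mono (r :: nat \<Rightarrow> nat)" "(X \<circ> r) \<longlonglongrightarrow> x"
    by (rule seq_compactE)
  have "(\<lambda>n. X (r n) i) \<longlonglongrightarrow> x i" for i
  proof -
    have "continuous_on UNIV (\<lambda>x :: config. x i)"
      by (rule continuous_on_product_coordinates)
    then show ?thesis
      using continuous_on_tendsto_compose[of UNIV "\<lambda>x :: config. x i" "X \<circ> r" x sequentially] xr(2)
      by (auto simp: o_def)
  qed
  then show ?thesis using that xr(1) by blast
qed

section \<open>Periodic minimizers and Birkhoff configurations\<close>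

context twist_potential
begin

definition periodic :: "int \<Rightarrow> int \<Rightarrow> config set" where
  "periodic q p = {x. \<forall>i. x (i + q) = x i + of_int p}"

definition periodic_minimizer :: "int \<Rightarrow> int \<Rightarrow> config \<Rightarrow> bool" where
  "periodic_minimizer q p x \<longleftrightarrow>
     x \<in> periodic q p \<and> (\<forall>z\<in>periodic q p. action x 0 q \<le> action z 0 q)"

lemma chain_le:
  fixes x :: config
  assumes "\<And>i. x i + c \<le> x (i + q)"
  shows "x i + real k * c \<le> x (i + int k * q)"
proof (induction k)
  case (Suc k)
  then show ?case using assms[of "i + int k * q"] by (simp add: algebra_simps)
qed simp

lemma chain_ge:
  fixes x :: config
  assumes "\<And>i. x (i + q) \<le> x i + c"
  shows "x (i + int k * q) \<le> x i + real k * c"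
proof (induction k)
  case (Suc k)
  then show ?case using assms[of "i + int k * q"] by (simp add: algebra_simps)
qed simp

lemma periodic_multiple:
  assumes "x \<in> periodic q p"
  shows "x (i + int k * q) = x i + real k * of_int p"
  by (rule antisym[OF chain_ge chain_le]) (use assms in \<open>auto simp: periodic_def\<close>)

lemma periodic_translate:
  "x \<in> periodic q p \<Longrightarrow> (\<lambda>i. x (i + q') + of_int p') \<in> periodic q p"
  by (auto simp: periodic_def algebra_simps) (metis add.assoc add.commute)

lemma action_period:
  assumes x: "x \<in> periodic q p" and "q > 0"
  shows "action x i (i + q) = action x 0 q"
proof -
  have shift: "action x (i + 1) (i + 1 + q) = action x i (i + q)" for i
  proof -
    have "action x i (i + 1 + q) = h (x i) (x (i + 1)) + action x (i + 1) (i + 1 + q)"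
      using \<open>q > 0\<close> action_split[of i "i + 1" "i + 1 + q" x] action_single[of x i] by simp
    moreover have "action x i (i + 1 + q) = action x i (i + q) + h (x (i + q)) (x (i + q + 1))"
      using \<open>q > 0\<close> action_split[of i "i + q" "i + q + 1" x] action_single[of x "i + q"]
      by (simp add: algebra_simps)
    moreover have "h (x (i + q)) (x (i + q + 1)) = h (x i) (x (i + 1))"
    proof -
      have "x (i + q) = x i + of_int p" "x (i + q + 1) = x (i + 1) + of_int p"
        using x unfolding periodic_def by (auto simp: algebra_simps) (metis add.assoc add.commute)
      then show ?thesis by (simp add: h_translate)
    qed
    ultimately show ?thesis by simp
  qed
  show ?thesis
  proof (induction i rule: int_induct[where k = 0])
    case base show ?case by simp
  next
    case (step1 i) then show ?case using shift[of i] by simp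
  next
    case (step2 i) then show ?case using shift[of "i - 1"] by simp
  qed
qed

lemma continuous_on_action: "continuous_on S (\<lambda>x :: config. action x i j)"
proof -
  have *: "continuous_on S (\<lambda>x :: config. x l)" for l
    by (rule continuous_on_subset[OF continuous_on_product_coordinates]) auto
  have "continuous_on S (\<lambda>x :: config. V (x l))" for l
    by (rule continuous_on_compose2[OF V_continuous *]) auto
  then show ?thesis
    unfolding action_def h_def by (intro continuous_intros *) auto
qed

text \<open>
  Up to an integer translation, the candidates that are no worse than the linear configuration have
  bounded steps and start in [0,1]; they form a compact set.
\<close>

lemma periodic_minimizer_exists:
  assumes "q > 0" obtains x where "periodic_minimizer q p x"
proof -
  define z0 :: config where "z0 = (\<lambda>i. of_int p * of_int i / of_int q)"
  define M where "M = action z0 0 q"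
  define K where "K = sqrt (2 * M)"
  have z0: "z0 \<in> periodic q p"
    using assms by (auto simp: periodic_def z0_def field_simps)
  have step: "\<bar>z l - z (l + 1)\<bar> \<le> K" if "z \<in> periodic q p" "action z 0 q \<le> M" for z l
  proof -
    have "action z l (l + q) = h (z l) (z (l + 1)) + action z (l + 1) (l + q)"
      using assms action_split[of l "l + 1" "l + q" z] action_single[of z l] by simp
    then have "h (z l) (z (l + 1)) \<le> M"
      using action_period[OF that(1) assms, of l] that(2) action_nonneg[of z "l + 1" "l + q"] by simp
    then have "(z l - z (l + 1))\<^sup>2 \<le> 2 * M"
      using V_nonneg[of "z (l + 1)"] unfolding h_def by linarith
    then show ?thesis unfolding K_def using real_le_rsqrt[of "\<bar>z l - z (l + 1)\<bar>"] by simp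
  qed
  define S where "S = {x :: config. (\<forall>i. x (i + q) = x i + of_int p) \<and> 0 \<le> x 0 \<and> x 0 \<le> 1 \<and>
     (\<forall>l. \<bar>x l - x (l + 1)\<bar> \<le> K)}"
  have coord: "continuous_on UNIV (\<lambda>x :: config. x i)" for i
    by (rule continuous_on_product_coordinates)
  have "closed S" unfolding S_def
    by (intro closed_Collect_conj closed_Collect_all closed_Collect_eq closed_Collect_le
        continuous_intros coord)
  have bound: "\<bar>x i\<bar> \<le> 1 + K * \<bar>of_int i\<bar>" if "x \<in> S" for x i
  proof -
    have st: "\<bar>x l - x (l + 1)\<bar> \<le> K" for l using that by (auto simp: S_def)
    show ?thesis
    proof (induction i rule: int_induct[where k = 0])
      case base show ?case using that by (auto simp: S_def)
    next
      case (step1 i) then show ?case using st[of i] by (simp add: algebra_simps)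
    next
      case (step2 i)
      then have "\<bar>real_of_int (i - 1)\<bar> = \<bar>real_of_int i\<bar> + 1" by linarith
      then show ?case using step2 st[of "i - 1"] by (simp add: algebra_simps)
    qed
  qed
  define box where "box = {x :: config. \<forall>i. - (1 + K * \<bar>of_int i\<bar>) \<le> x i \<and> x i \<le> 1 + K * \<bar>of_int i\<bar>}"
  have "compact box" unfolding box_def by (rule config_box_compact)
  have "S \<subseteq> box" unfolding box_def using bound
    by (auto simp: abs_le_iff minus_le_iff) (smt (verit))
  then have "compact S"
    using compact_Int_closed[OF \<open>compact box\<close> \<open>closed S\<close>] by (simp add: Int_absorb1)
  moreover have "z0 \<in> S"
    using z0 step[OF z0] by (auto simp: S_def periodic_def M_def z0_def)
  ultimately obtain x where x: "x \<in> S" "\<And>y. y \<in> S \<Longrightarrow> action x 0 q \<le> action y 0 q"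
    using continuous_attains_inf[of S "\<lambda>x. action x 0 q"] continuous_on_action by blast
  have "action x 0 q \<le> action z 0 q" if z: "z \<in> periodic q p" for z
  proof (cases "action z 0 q \<le> M")
    case True
    define z' where "z' = (\<lambda>i. z (i + 0) + of_int (- \<lfloor>z 0\<rfloor>))"
    have z': "z' \<in> periodic q p" unfolding z'_def by (rule periodic_translate[OF z])
    have "action z' 0 q = action z 0 q" unfolding z'_def by (subst action_translate) simp
    moreover have "0 \<le> z' 0" "z' 0 \<le> 1" by (simp_all add: z'_def) linarith+
    then have "z' \<in> S"
      using z' step[OF z'] True calculation by (auto simp: S_def periodic_def)
    ultimately show ?thesis using x(2) by metis
  next
    case False
    then show ?thesis using x(2)[OF \<open>z0 \<in> S\<close>] by (simp add: M_def)
  qed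
  moreover have "x \<in> periodic q p" using x(1) by (simp add: S_def periodic_def)
  ultimately show ?thesis using that unfolding periodic_minimizer_def by blast
qed

text \<open>
  The hypothesis \<open>q \<ge> 2\<close> makes the two neighbours of a varied site different from its own periodic
  copies. It costs no generality later because \<open>p / q\<close> is not assumed to be in lowest terms.
\<close>

lemma periodic_minimizer_EL:
  assumes "q \<ge> 2" and x: "periodic_minimizer q p x"
  shows "EL x"
  unfolding EL_def
proof
  fix i
  have xp: "x \<in> periodic q p" using x by (simp add: periodic_minimizer_def)
  show "x (i - 1) + x (i + 1) = 2 * x i + deriv V (x i)"
  proof (rule critical_point_of_bond_sum[OF V_diff])
    fix t
    define z where "z = (\<lambda>j. x j + (if q dvd (j - i) then t - x i else 0))"
    have zp: "z \<in> periodic q p"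
    proof -
      have "q dvd (j + q - i) \<longleftrightarrow> q dvd (j - i)" for j
        using dvd_add_left_iff[of q q "j - i"] by (simp add: algebra_simps)
      then show ?thesis using xp by (auto simp: periodic_def z_def)
    qed
    have nd: "\<not> q dvd (l - i)" if "i + 1 \<le> l" "l \<le> i - 1 + q" for l
      using that zdvd_not_zless[of "l - i" q] by auto
    have "action x 0 q \<le> action z 0 q" using x zp by (simp add: periodic_minimizer_def)
    then have "action x (i - 1) (i - 1 + q) \<le> action z (i - 1) (i - 1 + q)"
      using action_period[OF xp] action_period[OF zp] assms(1) by simp
    moreover have "action w (i - 1) (i - 1 + q) = action w (i - 1) (i + 1) + action w (i + 1) (i - 1 + q)" for w
      using assms(1) by (intro action_split) auto
    moreover have "action x (i + 1) (i - 1 + q) = action z (i + 1) (i - 1 + q)"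
      by (rule action_cong) (use nd in \<open>auto simp: z_def\<close>)
    ultimately have "action x (i - 1) (i + 1) \<le> action z (i - 1) (i + 1)" by simp
    moreover have "z (i + 1) = x (i + 1)" "z i = t"
      using nd[of "i + 1"] assms(1) by (auto simp: z_def)
    moreover have "z (i - 1) = x (i - 1)"
      using assms(1) by (auto simp: z_def)
    ultimately show "(x (i - 1) - x i)\<^sup>2 / 2 + V (x i) + (x i - x (i + 1))\<^sup>2 / 2
       \<le> (x (i - 1) - t)\<^sup>2 / 2 + V t + (t - x (i + 1))\<^sup>2 / 2"
      by (simp add: action_two h_def)
  qed
qed

lemma periodic_minimizers_comparable:
  assumes "q \<ge> 2" and x: "periodic_minimizer q p x" and y: "periodic_minimizer q p y"
  shows "(\<forall>i. x i \<le> y i) \<or> (\<forall>i. y i \<le> x i)"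
proof -
  define w where "w = (\<lambda>l. min (x l) (y l))"
  define m where "m = (\<lambda>l. max (x l) (y l))"
  have per: "x \<in> periodic q p" "y \<in> periodic q p"
    using x y by (simp_all add: periodic_minimizer_def)
  then have wm: "w \<in> periodic q p" "m \<in> periodic q p"
    by (auto simp: periodic_def w_def m_def min_def max_def)
  have "action w 0 q + action m 0 q \<le> action x 0 q + action y 0 q"
    unfolding w_def m_def by (rule action_submodular)
  moreover have "action x 0 q \<le> action w 0 q" using x wm by (simp add: periodic_minimizer_def)
  ultimately have "action m 0 q \<le> action y 0 q" by simp
  then have "periodic_minimizer q p m"
    using y wm unfolding periodic_minimizer_def by (meson order_trans)
  then have EL: "EL m" "EL y" using periodic_minimizer_EL[OF assms(1)] y by auto
  show ?thesis
  proof (cases "\<exists>c. y c = m c")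
    case True
    then obtain c where "y c = m c" by blast
    then have "y = m" by (rule EL_touch[OF EL(2,1), rotated]) (simp add: m_def)
    have le: "x l \<le> m l" for l by (simp add: m_def)
    then show ?thesis using \<open>y = m\<close> by simp
  next
    case False
    then show ?thesis unfolding m_def by (metis max_def linear)
  qed
qed

lemma periodic_minimizer_translate:
  assumes "q > 0" and x: "periodic_minimizer q p x"
  shows "periodic_minimizer q p (\<lambda>i. x (i + q') + of_int p')"
proof -
  have xp: "x \<in> periodic q p" using x by (simp add: periodic_minimizer_def)
  have "action (\<lambda>i. x (i + q') + of_int p') 0 q = action x 0 q"
    unfolding action_translate using action_period[OF xp assms(1), of q'] by (simp add: add.commute)
  then show ?thesis
    using x periodic_translate[OF xp] by (simp add: periodic_minimizer_def)
qed

lemma periodic_minimizer_translate_cases: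
  assumes "q \<ge> 2" and x: "periodic_minimizer q p x"
  shows "(\<forall>i. x (i + q') \<le> x i + of_int p') \<or> (\<forall>i. x i + of_int p' \<le> x (i + q'))"
proof -
  have "periodic_minimizer q p (\<lambda>i. x (i + q') + of_int (- p'))"
    using assms by (intro periodic_minimizer_translate) auto
  from periodic_minimizers_comparable[OF assms(1) x this] show ?thesis
    by (auto simp: algebra_simps)
qed

lemma periodic_minimizer_iterate:
  assumes "q \<ge> 2" and x: "periodic_minimizer q p x"
  shows "x (i + int (nat q) * q') = x i + of_int q' * of_int p"
proof (cases "q' \<ge> 0")
  case True
  have "x (i + int (nat q') * q) = x i + real (nat q') * of_int p"
    using x by (intro periodic_multiple) (simp add: periodic_minimizer_def)
  then show ?thesis using True assms(1) by (simp add: mult.commute)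
next
  case False
  have "x ((i + q * q') + int (nat (- q')) * q) = x (i + q * q') + real (nat (- q')) * of_int p"
    using x by (intro periodic_multiple) (simp add: periodic_minimizer_def)
  then show ?thesis using False assms(1) by (simp add: algebra_simps)
qed

lemma periodic_minimizer_ordered:
  assumes "q \<ge> 2" and x: "periodic_minimizer q p x" and less: "q' * p < p' * q"
  shows "x (i + q') \<le> x i + of_int p'"
proof (rule ccontr)
  assume "\<not> x (i + q') \<le> x i + of_int p'"
  then have le: "x i + of_int p' \<le> x (i + q')" for i
    using periodic_minimizer_translate_cases[OF assms(1) x, of q' p'] by auto
  have "x 0 + real (nat q) * of_int p' \<le> x 0 + of_int q' * of_int p"
    using chain_le[of x "of_int p'" q' 0 "nat q", OF le]
      periodic_minimizer_iterate[OF assms(1) x, of 0 q'] by simp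
  then have "real_of_int (q * p') \<le> real_of_int (q' * p)" using assms(1) by simp
  then have "q * p' \<le> q' * p" by (simp only: of_int_le_iff)
  then show False using less by (simp add: mult.commute)
qed

text \<open>
  A translation that is a rotation by exactly \<open>p / q\<close> moves a minimizer up or down weakly everywhere,
  but its q-th iterate is the identity modulo the period, so it does not move it at all.
\<close>

lemma periodic_minimizer_invariant:
  assumes "q \<ge> 2" and x: "periodic_minimizer q p x" and eq: "q' * p = p' * q"
  shows "x (i + q') = x i + of_int p'"
proof -
  define k where "k = nat q - 1"
  have k: "nat q = Suc k" using assms(1) by (simp add: k_def)
  have it: "x ((i + q') + int k * q') = x i + of_int q' * of_int p"
    using periodic_minimizer_iterate[OF assms(1) x, of i q'] k by (simp add: algebra_simps)
  have "real_of_int q' * of_int p = of_int p' * of_int q" using eq by (metis of_int_mult)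
  moreover have "real_of_int q = 1 + real k" using k assms(1) by linarith
  ultimately have e: "real_of_int q' * of_int p = of_int p' + real k * of_int p'"
    by (simp add: algebra_simps)
  from periodic_minimizer_translate_cases[OF assms(1) x, of q' p'] show ?thesis
  proof
    assume le: "\<forall>i. x (i + q') \<le> x i + of_int p'"
    have "x ((i + q') + int k * q') \<le> x (i + q') + real k * of_int p'"
      using le by (intro chain_ge) auto
    then show ?thesis using it e le[rule_format, of i] by linarith
  next
    assume le: "\<forall>i. x i + of_int p' \<le> x (i + q')"
    have "x (i + q') + real k * of_int p' \<le> x ((i + q') + int k * q')"
      using le by (intro chain_le) auto
    then show ?thesis using it e le[rule_format, of i] by linarith
  qed
qed

lemma action_multiple:
  assumes x: "x \<in> periodic q p" and "q > 0"
  shows "action x 0 (int k * q) = real k * action x 0 q"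
proof (induction k)
  case 0 show ?case by (simp add: action_empty)
next
  case (Suc k)
  have "action x 0 (int (Suc k) * q) = action x 0 (int k * q) + action x (int k * q) (int k * q + q)"
    using action_split[of 0 "int k * q" "int k * q + q" x] \<open>q > 0\<close> by (simp add: algebra_simps)
  then show ?case using Suc action_period[OF x \<open>q > 0\<close>, of "int k * q"] by (simp add: algebra_simps)
qed

text \<open>
  By \<open>periodic_minimizer_invariant\<close> a minimizer for the longer period already has the shorter one.
\<close>

lemma periodic_minimizer_multiple:
  assumes "q \<ge> 2" "k \<ge> 1" and x: "periodic_minimizer q p x"
  shows "periodic_minimizer (int k * q) (int k * p) x"
proof -
  have xp: "x \<in> periodic q p" using x by (simp add: periodic_minimizer_def)
  have k2: "int k * q \<ge> 2"
    using assms(1,2) mult_mono[of 1 "int k" 2 q] by simp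
  obtain y where y: "periodic_minimizer (int k * q) (int k * p) y"
    using periodic_minimizer_exists[of "int k * q" "int k * p"] k2 by auto
  have yp: "y \<in> periodic q p"
    using periodic_minimizer_invariant[OF k2 y, of q p] by (simp add: periodic_def)
  have "action x 0 (int k * q) \<le> action y 0 (int k * q)"
    using action_multiple[OF xp, of k] action_multiple[OF yp, of k] x yp assms(1)
    by (simp add: periodic_minimizer_def mult_left_mono)
  moreover have "x \<in> periodic (int k * q) (int k * p)"
    using periodic_multiple[OF xp] by (simp add: periodic_def)
  ultimately show ?thesis
    using y unfolding periodic_minimizer_def by (meson order_trans)
qed

text \<open>
  A compactly supported variation fits into one period of a sufficiently long multiple of \<open>q\<close>, where
  \<open>x\<close> is still a periodic minimizer.
\<close>

lemma periodic_minimizer_minimal: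
  assumes "q \<ge> 2" and x: "periodic_minimizer q p x"
  shows "minimal x"
proof (rule minimalI)
  fix i j and z :: config
  assume *: "i < j" "z i = x i" "z j = x j"
  define k where "k = nat (j - i)"
  define Q where "Q = int k * q"
  define P where "P = int k * p"
  have "periodic_minimizer Q P x"
    unfolding Q_def P_def using assms * by (intro periodic_minimizer_multiple) (auto simp: k_def)
  then have xp: "x \<in> periodic Q P" and min: "\<And>w. w \<in> periodic Q P \<Longrightarrow> action x 0 Q \<le> action w 0 Q"
    by (auto simp: periodic_minimizer_def)
  have k: "int k = j - i" using * by (simp add: k_def)
  have "int k * 1 \<le> int k * q" using assms(1) by (intro mult_left_mono) auto
  then have "j - i \<le> Q" unfolding Q_def k by simp
  then have ji: "j \<le> i + Q" and "Q > 0" using * by simp_all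
  define b where "b = (\<lambda>l. if l \<le> j then z l else x l)"
  \<comment> \<open>The variation on one period, continued periodically.\<close>
  define w where "w = (\<lambda>l. b (i + (l - i) mod Q) + of_int (((l - i) div Q) * P))"
  have wp: "w \<in> periodic Q P"
  proof -
    have "(l + Q - i) mod Q = (l - i) mod Q" "(l + Q - i) div Q = (l - i) div Q + 1" for l
      using \<open>Q > 0\<close> mod_add_self2[of "l - i" Q] div_add_self2[of Q "l - i"] by (simp_all add: algebra_simps)
    then show ?thesis by (simp add: periodic_def w_def algebra_simps)
  qed
  have w_in: "w l = b l" if "i \<le> l" "l < i + Q" for l
    using that by (simp add: w_def)
  have w_end: "w (i + Q) = x (i + Q)"
    using xp \<open>Q > 0\<close> * by (simp add: w_def b_def periodic_def)
  have w1: "w l = z l" if "i \<le> l" "l \<le> j" for l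
    using w_in[of l] w_end that ji * by (cases "l = i + Q") (auto simp: b_def)
  have w2: "w l = x l" if "j \<le> l" "l \<le> i + Q" for l
    using w_in[of l] w_end that * by (cases "l = i + Q") (auto simp: b_def)
  have "action x i (i + Q) \<le> action w i (i + Q)"
    using min[OF wp] action_period[OF xp \<open>Q > 0\<close>] action_period[OF wp \<open>Q > 0\<close>] by simp
  moreover have "action u i (i + Q) = action u i j + action u j (i + Q)" for u
    using * ji by (intro action_split) auto
  moreover have "action w i j = action z i j" "action w j (i + Q) = action x j (i + Q)"
    using w1 w2 by (auto intro!: action_cong)
  ultimately show "action x i j \<le> action z i j" by simp
qed

text \<open>
  Minimal configurations that are ordered with respect to their translates like the orbits of the
  rotation by \<open>\<omega>\<close>. All conditions are weak inequalities under strict ones on \<open>\<omega>\<close>, so the notion survives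
  limits in which \<open>\<omega>\<close> varies too.
\<close>

definition Birkhoff :: "real \<Rightarrow> config set" where
  "Birkhoff \<omega> = {x. minimal x \<and>
     (\<forall>q p i. of_int q * \<omega> < of_int p \<longrightarrow> x (i + q) \<le> x i + of_int p)}"

lemma BirkhoffD:
  assumes "x \<in> Birkhoff \<omega>"
  shows "minimal x" "of_int q * \<omega> < of_int p \<Longrightarrow> x (i + q) \<le> x i + of_int p"
    "of_int p < of_int q * \<omega> \<Longrightarrow> x i + of_int p \<le> x (i + q)"
proof -
  show "minimal x" and *: "of_int q * \<omega> < of_int p \<Longrightarrow> x (i + q) \<le> x i + of_int p" for q p i
    using assms by (auto simp: Birkhoff_def)
  show "of_int p < of_int q * \<omega> \<Longrightarrow> x i + of_int p \<le> x (i + q)"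
    using *[of "- q" "- p" "i + q"] by simp
qed

lemma Birkhoff_translate:
  assumes "x \<in> Birkhoff \<omega>" shows "(\<lambda>i. x (i + q) + of_int p) \<in> Birkhoff \<omega>"
proof -
  have "x (i + q' + q) \<le> x (i + q) + of_int p'" if "of_int q' * \<omega> < of_int p'" for i q' p'
    using BirkhoffD(2)[OF assms that, of "i + q"] by (simp add: algebra_simps)
  then show ?thesis
    using minimal_translate[of x q p] BirkhoffD(1)[OF assms] by (auto simp: Birkhoff_def)
qed

lemma Birkhoff_deviation:
  assumes "x \<in> Birkhoff \<omega>"
  shows "\<bar>x (i + m) - x i - of_int m * \<omega>\<bar> \<le> 1"
proof -
  have "x (i + m) \<le> x i + of_int (\<lfloor>of_int m * \<omega>\<rfloor> + 1)"
    by (rule BirkhoffD(2)[OF assms]) linarith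
  moreover have "x i + of_int (\<lceil>of_int m * \<omega>\<rceil> - 1) \<le> x (i + m)"
    by (rule BirkhoffD(3)[OF assms]) linarith
  ultimately show ?thesis unfolding abs_le_iff by linarith
qed

lemma Birkhoff_rational:
  assumes "q \<ge> 2" shows "\<exists>x. x \<in> Birkhoff (of_int p / of_int q)"
proof -
  obtain x where x: "periodic_minimizer q p x" using periodic_minimizer_exists[of q p] assms by auto
  have "x (i + q') \<le> x i + of_int p'" if "of_int q' * (of_int p / of_int q :: real) < of_int p'" for q' p' i
  proof -
    have "real_of_int (q' * p) < of_int (p' * q)" using that assms by (simp add: field_simps)
    then have "q' * p < p' * q" by (simp only: of_int_less_iff)
    then show ?thesis by (rule periodic_minimizer_ordered[OF assms x])
  qed
  then show ?thesis using periodic_minimizer_minimal[OF assms x] by (auto simp: Birkhoff_def)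
qed

lemma Birkhoff_limit:
  assumes X: "\<And>n. X n \<in> Birkhoff (w n)" and w: "w \<longlonglongrightarrow> \<omega>"
    and lim: "\<And>l. (\<lambda>n. X n l) \<longlonglongrightarrow> x l"
  shows "x \<in> Birkhoff \<omega>"
proof -
  have "minimal x" by (rule minimal_limit[OF _ lim]) (use X BirkhoffD(1) in blast)
  moreover have "x (i + q) \<le> x i + of_int p" if "of_int q * \<omega> < of_int p" for q p i
  proof (rule tendsto_le[OF sequentially_bot])
    show "(\<lambda>n. X n (i + q)) \<longlonglongrightarrow> x (i + q)" "(\<lambda>n. X n i + of_int p) \<longlonglongrightarrow> x i + of_int p"
      by (intro tendsto_intros lim)+
    have "(\<lambda>n. of_int q * w n) \<longlonglongrightarrow> of_int q * \<omega>" by (intro tendsto_intros w)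
    then have "eventually (\<lambda>n. of_int q * w n < of_int p) sequentially"
      using that by (rule order_tendstoD)
    then show "eventually (\<lambda>n. X n (i + q) \<le> X n i + of_int p) sequentially"
      by eventually_elim (use X BirkhoffD(2) in blast)
  qed
  ultimately show ?thesis by (auto simp: Birkhoff_def)
qed

lemma Birkhoff_convergent_subsequence:
  assumes X: "\<And>n. X n \<in> Birkhoff (w n)" and w: "w \<longlonglongrightarrow> \<omega>" and R: "\<And>n. \<bar>X n 0\<bar> \<le> R"
  obtains x r where "strict_mono (r :: nat \<Rightarrow> nat)" "x \<in> Birkhoff \<omega>" "\<And>i. (\<lambda>n. X (r n) i) \<longlonglongrightarrow> x i"
proof -
  have "Bseq w" using w by (simp add: convergent_imp_Bseq convergentI)
  then obtain W where W: "\<And>n. \<bar>w n\<bar> \<le> W" using BseqE by (metis real_norm_def)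
  have "\<bar>X n i\<bar> \<le> R + 1 + \<bar>of_int i\<bar> * W" for n i
  proof -
    have "\<bar>of_int i * w n\<bar> \<le> \<bar>of_int i\<bar> * W" unfolding abs_mult by (intro mult_left_mono W) auto
    then show ?thesis using Birkhoff_deviation[OF X, of n 0 i] R[of n] by (simp add: abs_le_iff)
  qed
  then obtain x r where *: "strict_mono (r :: nat \<Rightarrow> nat)" "\<And>i. (\<lambda>n. X (r n) i) \<longlonglongrightarrow> x i"
    using config_convergent_subsequence[of X "\<lambda>i. R + 1 + \<bar>of_int i\<bar> * W"] by metis
  have "x \<in> Birkhoff \<omega>"
    by (rule Birkhoff_limit[of "\<lambda>n. X (r n)" "\<lambda>n. w (r n)", OF X _ *(2)])
       (use LIMSEQ_subseq_LIMSEQ[OF w *(1)] in \<open>simp add: o_def\<close>)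
  with * that show ?thesis by blast
qed

text \<open>
  The limit of periodic minimizers with the rational rotation numbers \<open>\<lfloor>n * \<omega>\<rfloor> / n\<close>.
\<close>

lemma Birkhoff_nonempty: "\<exists>x. x \<in> Birkhoff \<omega>"
proof -
  define w where "w = (\<lambda>n. of_int \<lfloor>real (n + 2) * \<omega>\<rfloor> / real (n + 2))"
  have "\<exists>x. x \<in> Birkhoff (w n) \<and> \<bar>x 0\<bar> \<le> 1" for n
  proof -
    obtain x where x: "x \<in> Birkhoff (w n)"
      using Birkhoff_rational[of "int (n + 2)" "\<lfloor>real (n + 2) * \<omega>\<rfloor>"] by (auto simp: w_def)
    have "(\<lambda>i. x (i + 0) + of_int (- \<lfloor>x 0\<rfloor>)) \<in> Birkhoff (w n)" by (rule Birkhoff_translate[OF x])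
    moreover have "\<bar>x (0 + 0) + of_int (- \<lfloor>x 0\<rfloor>)\<bar> \<le> 1" by simp linarith
    ultimately show ?thesis by blast
  qed
  then obtain X where X: "\<And>n. X n \<in> Birkhoff (w n)" "\<And>n. \<bar>X n 0\<bar> \<le> 1" by metis
  have "\<bar>w n - \<omega>\<bar> \<le> 1 / real (Suc n)" for n
  proof -
    have "w n - \<omega> = (of_int \<lfloor>real (n + 2) * \<omega>\<rfloor> - real (n + 2) * \<omega>) / real (n + 2)"
      by (simp add: w_def field_simps)
    then have "\<bar>w n - \<omega>\<bar> = \<bar>of_int \<lfloor>real (n + 2) * \<omega>\<rfloor> - real (n + 2) * \<omega>\<bar> / real (n + 2)" by simp
    also have "\<dots> \<le> 1 / real (Suc n)"
      by (intro frac_le) linarith+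
    finally show ?thesis .
  qed
  then have "(\<lambda>n. w n - \<omega>) \<longlonglongrightarrow> 0"
    by (intro Lim_null_comparison[OF always_eventually LIMSEQ_Suc[OF lim_1_over_n]]) auto
  then have "w \<longlonglongrightarrow> \<omega>" by (rule LIM_zero_cancel)
  from Birkhoff_convergent_subsequence[OF X(1) this X(2)] show ?thesis by metis
qed

end

section \<open>Minimal configurations of irrational rotation number\<close>

lemma nat_multiples_bounded_imp_nonpos:
  fixes c C :: real
  assumes "\<And>m::nat. real m * c \<le> C" shows "c \<le> 0"
proof (rule ccontr)
  assume "\<not> c \<le> 0"
  then obtain n :: nat where "C < real n * c" using reals_Archimedean3[of c] by auto
  then show False using assms[of n] by simp
qed

lemma ordered_intervals_sum_le:
  fixes \<alpha> \<beta> key :: "'a \<Rightarrow> real"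
  assumes "finite F"
    and "\<And>i j. i \<in> F \<Longrightarrow> j \<in> F \<Longrightarrow> key i < key j \<Longrightarrow> \<beta> i \<le> \<alpha> j"
    and "inj_on key F"
    and "\<And>i. i \<in> F \<Longrightarrow> lo \<le> \<alpha> i" "\<And>i. i \<in> F \<Longrightarrow> \<beta> i \<le> hi" "lo \<le> hi"
  shows "(\<Sum>i\<in>F. \<beta> i - \<alpha> i) \<le> hi - lo"
  using assms
proof (induction F arbitrary: hi rule: finite_ranking_induct[where f = key])
  case empty
  then show ?case by simp
next
  case (insert x S)
  show ?case
  proof (cases "x \<in> S")
    case True
    then have "insert x S = S" by auto
    then show ?thesis using insert by metis
  next
    case False
    have "\<beta> i \<le> \<alpha> x" if "i \<in> S" for i
    proof -
      have "key i \<noteq> key x" using insert.prems(2) that False by (metis inj_on_def insertI1 insertI2)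
      then have "key i < key x" using insert.hyps(2)[OF that] by simp
      then show ?thesis using insert.prems(1) that by auto
    qed
    then have "(\<Sum>i\<in>S. \<beta> i - \<alpha> i) \<le> \<alpha> x - lo"
      using insert.prems by (intro insert.IH) auto
    moreover have "\<beta> x \<le> hi" using insert.prems by auto
    ultimately show ?thesis using insert.hyps(1) False by simp
  qed
qed

text \<open>
  Translated by \<open>\<lfloor>i * \<omega>\<rfloor>\<close>, the intervals follow each other in the order of the fractional parts of
  \<open>i * \<omega>\<close>, which are distinct for irrational \<open>\<omega>\<close>, and all lie in one interval of length 1.
\<close>

lemma rotated_intervals_sum_le_1:
  fixes \<alpha> \<beta> :: config and \<omega> :: real
  assumes irr: "\<omega> \<notin> \<rat>"
    and ord: "\<And>i q p. of_int p < of_int q * \<omega> \<Longrightarrow> \<beta> i + of_int p \<le> \<alpha> (i + q)"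
    and "finite F"
  shows "(\<Sum>i\<in>F. \<beta> i - \<alpha> i) \<le> 1"
proof (cases "F = {}")
  case False
  define key where "key = (\<lambda>i. frac (of_int i * \<omega>))"
  define \<alpha>' where "\<alpha>' = (\<lambda>i. \<alpha> i - of_int \<lfloor>of_int i * \<omega>\<rfloor>)"
  define \<beta>' where "\<beta>' = (\<lambda>i. \<beta> i - of_int \<lfloor>of_int i * \<omega>\<rfloor>)"
  have ord': "\<beta>' i + of_int p \<le> \<alpha>' j" if "of_int p < key j - key i" for i j p
    using ord[of "\<lfloor>of_int j * \<omega>\<rfloor> - \<lfloor>of_int i * \<omega>\<rfloor> + p" "j - i" i] that
    by (simp add: key_def frac_def \<alpha>'_def \<beta>'_def algebra_simps)
  have "inj_on key F"
  proof (rule inj_onI, rule ccontr)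
    fix i j assume "key i = key j" "i \<noteq> j"
    then have "(of_int i - of_int j) * \<omega> = of_int (\<lfloor>of_int i * \<omega>\<rfloor> - \<lfloor>of_int j * \<omega>\<rfloor>)"
      by (simp add: key_def frac_def algebra_simps)
    then have "\<omega> = of_int (\<lfloor>of_int i * \<omega>\<rfloor> - \<lfloor>of_int j * \<omega>\<rfloor>) / of_int (i - j)"
      using \<open>i \<noteq> j\<close> by (simp add: field_simps)
    then have "\<omega> \<in> \<rat>" by (metis Rats_divide Rats_of_int)
    then show False using irr by simp
  qed
  moreover have "Min (\<alpha>' ` F) \<in> \<alpha>' ` F" using False \<open>finite F\<close> by simp
  then obtain c where c: "c \<in> F" "Min (\<alpha>' ` F) = \<alpha>' c" by auto
  moreover have "\<alpha>' c \<le> \<alpha>' i" if "i \<in> F" for i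
    using c \<open>finite F\<close> that by (metis Min_le finite_imageI imageI)
  moreover have "\<beta>' i \<le> \<alpha>' c + 1" for i
  proof -
    have "real_of_int (- 1) < key c - key i"
      using frac_lt_1[of "of_int i * \<omega>"] frac_ge_0[of "of_int c * \<omega>"] unfolding key_def by linarith
    from ord'[OF this] show ?thesis by simp
  qed
  moreover have "\<beta>' i \<le> \<alpha>' j" if "key i < key j" for i j
    using ord'[of 0 j i] that by simp
  ultimately have "(\<Sum>i\<in>F. \<beta>' i - \<alpha>' i) \<le> (\<alpha>' c + 1) - \<alpha>' c"
    using \<open>finite F\<close> by (intro ordered_intervals_sum_le[where key = key]) auto
  then show ?thesis by (simp add: \<alpha>'_def \<beta>'_def)
qed simp

lemma bounded_sums_tendsto_0:
  fixes g :: "int \<Rightarrow> real"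
  assumes nonneg: "\<And>i. 0 \<le> g i" and bound: "\<And>F. finite F \<Longrightarrow> (\<Sum>i\<in>F. g i) \<le> C" and "inj f"
  shows "(\<lambda>n::nat. g (f n)) \<longlonglongrightarrow> 0"
proof (rule summable_LIMSEQ_zero, rule summableI_nonneg_bounded)
  show "(\<Sum>i<n. g (f i)) \<le> C" for n
    using bound[of "f ` {..<n}"] \<open>inj f\<close> by (simp add: sum.reindex inj_on_subset)
qed (rule nonneg)

text \<open>
  Iterates of the rotation that return arbitrarily close from above, once far in the future and once
  far in the past.
\<close>

lemma irrational_small_steps:
  fixes \<omega> \<theta> :: real and Q :: int
  assumes irr: "\<omega> \<notin> \<rat>" and "\<theta> > 0"
  obtains q p q' p' :: int where "Q < q" "q' < - Q"
    "of_int p < of_int q * \<omega>" "of_int q * \<omega> < of_int p + \<theta>"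
    "of_int p' < of_int q' * \<omega>" "of_int q' * \<omega> < of_int p' + \<theta>"
proof -
  define m where "m = \<bar>Q\<bar> + 1"
  have m: "m > 0" "real_of_int m > 0" "m > Q" by (simp_all add: m_def)
  \<comment> \<open>The \<open>m\<close>-th multiple of a step shorter than \<open>2 * \<eta>\<close> is still shorter than \<open>\<theta>\<close>, and reaches beyond \<open>Q\<close>.\<close>
  define \<eta> where "\<eta> = \<theta> / (2 * of_int m)"
  have \<eta>: "\<eta> > 0" "of_int m * (2 * \<eta>) = \<theta>" using m assms by (simp_all add: \<eta>_def)
  obtain p k where k: "(k::int) > 0" "\<bar>of_int k * \<omega> - of_int p - \<eta>\<bar> < \<eta>"
    using sequence_of_fractional_parts_is_dense[OF irr \<eta>(1)] by metis
  obtain p' k' where k': "(k'::int) > 0" "\<bar>of_int k' * \<omega> - of_int p' - (- \<eta>)\<bar> < \<eta>"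
    using sequence_of_fractional_parts_is_dense[OF irr \<eta>(1)] by metis
  have big: "Q < m * j" if "j > 0" for j :: int
  proof -
    have "m * 1 \<le> m * j" using that m by (intro mult_left_mono) auto
    then show ?thesis using m by linarith
  qed
  have "of_int m * 0 < of_int m * (of_int k * \<omega> - of_int p)"
    using k m by (intro mult_strict_left_mono) linarith+
  moreover have "of_int m * (of_int k * \<omega> - of_int p) < of_int m * (2 * \<eta>)"
    using k m by (intro mult_strict_left_mono) linarith+
  moreover have "of_int m * 0 < of_int m * (of_int p' - of_int k' * \<omega>)"
    using k' m by (intro mult_strict_left_mono) linarith+
  moreover have "of_int m * (of_int p' - of_int k' * \<omega>) < of_int m * (2 * \<eta>)"
    using k' m by (intro mult_strict_left_mono) linarith+
  ultimately show ?thesis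
    using that[of "m * k" "- (m * k')" "m * p" "- (m * p')"] big k k' \<eta>(2)
    by (simp add: algebra_simps)
qed

context twist_potential
begin

text \<open>
  Only the forward rotation number is given. Let \<open>y\<close> be a Birkhoff configuration of rotation number
  \<open>r < \<omega>\<close>. Then \<open>x\<close> is eventually above every integer translate of \<open>y\<close>; if \<open>x 0\<close> lies below such a
  translate, Aubry's lemma forbids \<open>x\<close> to have been above it before.
\<close>

lemma rotation_bounds_backward_growth:
  assumes x: "minimal x" and rot: "has_rotation_number x \<omega>"
    and less: "r < \<omega>"
  shows "\<exists>C. \<forall>i\<le>0. x i \<le> r * of_int i + C"
proof -
  obtain y where y: "y \<in> Birkhoff r" using Birkhoff_nonempty by blast
  have dev: "\<bar>y i - y 0 - of_int i * r\<bar> \<le> 1" for i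
    using Birkhoff_deviation[OF y, of 0 i] by simp
  have ymin: "minimal (\<lambda>i. y i + of_int p)" for p
    using minimal_translate[OF BirkhoffD(1)[OF y], of 0 p] by simp
  have "(\<lambda>m. (x (0 + int m) - x 0) / real m) \<longlonglongrightarrow> \<omega>"
    using rot unfolding has_rotation_number_def by blast
  then have lim: "(\<lambda>m. (x (int m) - x 0) / real m) \<longlonglongrightarrow> \<omega>" by simp
  define r' where "r' = (r + \<omega>) / 2"
  have r': "r < r'" "r' < \<omega>" using less by (simp_all add: r'_def)
  obtain N where N: "\<And>m. m \<ge> N \<Longrightarrow> r' < (x (int m) - x 0) / real m"
    using order_tendstoD(1)[OF lim r'(2)] by (auto simp: eventually_sequentially)
  define J where "J = \<lfloor>x 0 - y 0\<rfloor> + 1"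
  obtain n :: nat where n: "of_int J + y 0 + 1 - x 0 < real n * (r' - r)"
    using reals_Archimedean3[of "r' - r"] r' by auto
  define k where "k = max (max n N) 1"
  have k: "k \<ge> N" "k \<ge> n" "k \<ge> 1" by (simp_all add: k_def)
  have "real n * (r' - r) \<le> real k * (r' - r)" using k r' by (intro mult_right_mono) auto
  moreover have "real k * r' < x (int k) - x 0" using N[OF k(1)] k(3) by (simp add: field_simps)
  ultimately have big: "y (int k) + of_int J \<le> x (int k)"
    using n dev[of "int k"] by (simp add: algebra_simps abs_le_iff)
  have "x i \<le> y i + of_int J" if "i \<le> 0" for i
  proof (rule ccontr)
    assume "\<not> x i \<le> y i + of_int J"
    then have "y 0 + of_int J \<le> x 0"
      using Aubry_crossing[OF ymin[of J] x, of i "int k" 0] big that by simp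
    then show False unfolding J_def by linarith
  qed
  then have "\<forall>i\<le>0. x i \<le> r * of_int i + (y 0 + 1 + of_int J)"
    using dev by (smt (verit) mult.commute)
  then show ?thesis by blast
qed

lemma has_rotation_number_translate:
  assumes "has_rotation_number x \<omega>" shows "has_rotation_number (\<lambda>l. x (l + i)) \<omega>"
  unfolding has_rotation_number_def
proof
  fix j
  have "(\<lambda>m. (x ((j + i) + int m) - x (j + i)) / real m) \<longlonglongrightarrow> \<omega>"
    using assms unfolding has_rotation_number_def by blast
  then show "(\<lambda>m. (x (j + int m + i) - x (j + i)) / real m) \<longlonglongrightarrow> \<omega>"
    by (simp add: add_ac)
qed

lemma rotation_number_le_slope:
  assumes rot: "has_rotation_number x \<omega>" and "q > 0"
    and slope: "\<And>m. x (int m * q) \<le> x 0 + real m * of_int p"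
  shows "of_int q * \<omega> \<le> of_int p"
proof -
  define f where "f = (\<lambda>m. Suc m * nat q)"
  have "(\<lambda>m. (x (0 + int m) - x 0) / real m) \<longlonglongrightarrow> \<omega>"
    using rot unfolding has_rotation_number_def by blast
  then have "(\<lambda>m. (x (int m) - x 0) / real m) \<longlonglongrightarrow> \<omega>" by simp
  moreover have "strict_mono f"
    using \<open>q > 0\<close> by (intro strict_monoI_Suc) (simp add: f_def)
  ultimately have "((\<lambda>m. (x (int m) - x 0) / real m) \<circ> f) \<longlonglongrightarrow> \<omega>" by (rule LIMSEQ_subseq_LIMSEQ)
  moreover have f: "int (f m) = int (Suc m) * q" for m using \<open>q > 0\<close> by (simp add: f_def distrib_right)
  moreover have "real (f m) = real (Suc m) * of_int q" for m using f by (metis of_int_mult of_int_of_nat_eq)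
  ultimately have lim: "(\<lambda>m. (x (int (Suc m) * q) - x 0) / (real (Suc m) * of_int q)) \<longlonglongrightarrow> \<omega>"
    by (simp add: o_def)
  have pos: "real (Suc m) * of_int q > 0" for m using \<open>q > 0\<close> by simp
  have eq: "of_int p / of_int q = (real (Suc m) * of_int p) / (real (Suc m) * of_int q)" for m by simp
  have "(x (int (Suc m) * q) - x 0) / (real (Suc m) * of_int q) \<le> of_int p / of_int q" for m
    unfolding eq[of m] using slope[of "Suc m"] pos[of m] by (intro divide_right_mono) auto
  then have "\<omega> \<le> of_int p / of_int q" by (intro LIMSEQ_le_const2[OF lim]) auto
  then show ?thesis using \<open>q > 0\<close> by (simp add: field_simps)
qed

text \<open>
  If \<open>x\<close> and its translate were out of order at 0, then by Aubry's lemma they would be out of order on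
  a whole half-line, and the growth of \<open>x\<close> on that half-line would contradict \<open>p < q * \<omega>\<close>.
\<close>

lemma rotation_number_translate_ge_0:
  assumes x: "minimal x" and rot: "has_rotation_number x \<omega>" and "q > 0"
    and less: "of_int p < of_int q * \<omega>"
  shows "x 0 + of_int p \<le> x q"
proof (rule ccontr)
  assume neg: "\<not> x 0 + of_int p \<le> x q"
  define y where "y = (\<lambda>l. x (l + q) + of_int (- p))"
  have y: "minimal y" unfolding y_def by (rule minimal_translate[OF x])
  have y0: "\<not> x 0 \<le> y 0" using neg by (simp add: y_def)
  have "(\<forall>k\<ge>0. y k \<le> x k) \<or> (\<forall>k\<le>0. y k \<le> x k)"
    using Aubry_crossing[OF x y, of _ _ 0] y0 by (meson linear)
  then show False
  proof
    assume 1: "\<forall>k\<ge>0. y k \<le> x k"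
    have "x (int m * q) \<le> x 0 + real m * of_int p" for m
    proof (induction m)
      case (Suc m)
      then show ?case using 1[rule_format, of "int m * q"] \<open>q > 0\<close> by (simp add: y_def algebra_simps)
    qed simp
    then have "of_int q * \<omega> \<le> of_int p" by (rule rotation_number_le_slope[OF rot \<open>q > 0\<close>])
    then show False using less by simp
  next
    assume 2: "\<forall>k\<le>0. y k \<le> x k"
    have chain: "x 0 - real m * of_int p \<le> x (- (int m * q))" for m
    proof (induction m)
      case (Suc m)
      have "- (int (Suc m) * q) \<le> 0" using \<open>q > 0\<close> by simp
      then show ?case using 2[rule_format, of "- (int (Suc m) * q)"] Suc by (simp add: y_def algebra_simps)
    qed simp
    obtain r where r: "r < \<omega>" "of_int p < of_int q * r"
      using less \<open>q > 0\<close> dense[of "of_int p / of_int q" \<omega>] by (auto simp: field_simps)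
    obtain C where C: "\<And>j. j \<le> 0 \<Longrightarrow> x j \<le> r * of_int j + C"
      using rotation_bounds_backward_growth[OF x rot r(1)] by blast
    have "real m * (of_int q * r - of_int p) \<le> C - x 0" for m
      using chain[of m] C[of "- (int m * q)"] \<open>q > 0\<close> by (simp add: algebra_simps)
    then have "of_int q * r - of_int p \<le> 0" by (rule nat_multiples_bounded_imp_nonpos)
    then show False using r(2) by simp
  qed
qed

lemma reflected_twist_potential: "twist_potential (\<lambda>x. V (- x)) L"
proof
  show "(\<lambda>x. V (- x)) differentiable at x" for x
    by (rule differentiable_compose[of V uminus, OF _ differentiable_minus[OF differentiable_ident]])
       (simp add: V_diff)
  show "V (- (x + 1)) = V (- x)" for x using V_periodic[of "- x - 1"] by simp
  show "0 \<le> V (- x)" for x by (rule V_nonneg)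
  show "\<bar>V (- x) - V (- y)\<bar> \<le> L * \<bar>x - y\<bar>" for x y
    using V_lipschitz[of "- x" "- y"] by (simp add: abs_minus_commute)
qed

text \<open>
  The previous lemma for the configuration \<open>- x\<close>, which is minimal for the reflected potential.
\<close>

lemma rotation_number_translate_le_0:
  assumes x: "minimal x" and rot: "has_rotation_number x \<omega>" and "q > 0"
    and less: "of_int q * \<omega> < of_int p"
  shows "x q \<le> x 0 + of_int p"
proof -
  interpret R: twist_potential "\<lambda>x. V (- x)" L by (rule reflected_twist_potential)
  have act: "R.action z i j = action (\<lambda>l. - z l) i j" for z i j
  proof -
    have "(- a - - b)\<^sup>2 = (a - b)\<^sup>2" for a b :: real by (simp add: power2_eq_square algebra_simps)
    then show ?thesis by (simp add: action_def R.action_def h_def R.h_def)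
  qed
  have "R.minimal (\<lambda>i. - x i)"
  proof (rule R.minimalI)
    fix i j and z :: config
    assume "z i = - x i" "z j = - x j"
    then have "action x i j \<le> action (\<lambda>l. - z l) i j" by (intro minimalD[OF x]) auto
    then show "R.action (\<lambda>i. - x i) i j \<le> R.action z i j" by (simp add: act)
  qed
  moreover have "has_rotation_number (\<lambda>i. - x i) (- \<omega>)"
    unfolding has_rotation_number_def
  proof
    fix i
    have "(\<lambda>m. (x (i + int m) - x i) / real m) \<longlonglongrightarrow> \<omega>"
      using rot unfolding has_rotation_number_def by blast
    from tendsto_minus[OF this] show "(\<lambda>m. (- x (i + int m) - - x i) / real m) \<longlonglongrightarrow> - \<omega>"
      by (simp add: minus_divide_left)
  qed
  ultimately have "- x 0 + of_int (- p) \<le> - x q"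
    using \<open>q > 0\<close> less by (intro R.rotation_number_translate_ge_0) auto
  then show ?thesis by simp
qed

theorem minimal_rotation_number_imp_Birkhoff:
  assumes x: "minimal x" and rot: "has_rotation_number x \<omega>"
  shows "x \<in> Birkhoff \<omega>"
proof -
  have min: "minimal (\<lambda>l. x (l + i))" for i using minimal_translate[OF x, of i 0] by simp
  have rot': "has_rotation_number (\<lambda>l. x (l + i)) \<omega>" for i
    by (rule has_rotation_number_translate[OF rot])
  have "x (i + q) \<le> x i + of_int p" if less: "of_int q * \<omega> < of_int p" for q p i
  proof -
    consider "q > 0" | "q = 0" | "q < 0" by linarith
    then show ?thesis
    proof cases
      case 1
      then show ?thesis using rotation_number_translate_le_0[OF min[of i] rot'[of i] _ less] by (simp add: add.commute)
    next
      case 2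
      then show ?thesis using less by simp
    next
      case 3
      then show ?thesis
        using rotation_number_translate_ge_0[OF min[of "i + q"] rot'[of "i + q"], of "- q" "- p"] less by simp
    qed
  qed
  then show ?thesis using x by (auto simp: Birkhoff_def)
qed

lemma Birkhoff_rotation_number:
  assumes "x \<in> Birkhoff \<omega>" shows "has_rotation_number x \<omega>"
  unfolding has_rotation_number_def
proof
  fix i
  have "(\<lambda>m. (x (i + int m) - x i) / real m - \<omega>) \<longlonglongrightarrow> 0"
  proof (rule Lim_null_comparison[OF _ lim_1_over_n], rule eventually_sequentiallyI)
    fix m :: nat assume "1 \<le> m"
    then have "(x (i + int m) - x i) / real m - \<omega> = (x (i + int m) - x i - of_int (int m) * \<omega>) / real m"
      by (simp add: field_simps)
    then have "norm ((x (i + int m) - x i) / real m - \<omega>) = \<bar>x (i + int m) - x i - of_int (int m) * \<omega>\<bar> / real m"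
      by (simp add: abs_divide)
    also have "\<dots> \<le> 1 / real m"
      by (intro divide_right_mono Birkhoff_deviation[OF assms]) simp
    finally show "norm ((x (i + int m) - x i) / real m - \<omega>) \<le> 1 / real m" .
  qed
  then show "(\<lambda>m. (x (i + int m) - x i) / real m) \<longlonglongrightarrow> \<omega>" by (rule LIM_zero_cancel)
qed

corollary M_irr_eq_Birkhoff: "M_irr h \<omega> = Birkhoff \<omega>"
  using minimal_rotation_number_imp_Birkhoff Birkhoff_rotation_number BirkhoffD(1)
  unfolding M_irr_def by blast

lemma Birkhoff_step:
  assumes "x \<in> Birkhoff \<omega>" "0 < \<omega>" "\<omega> < 1"
  shows "x i \<le> x (i + 1)" "x (i + 1) \<le> x i + 1"
  using BirkhoffD(3)[OF assms(1), of 0 1 i] BirkhoffD(2)[OF assms(1), of 1 1 i] assms(2,3) by simp_all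

text \<open>
  Far in the past \<open>x\<close> is below \<open>y\<close>, far in the future above. A translation that moves less than the
  given one and reaches far enough in either direction transports that order back to \<open>i\<close>.
\<close>

lemma crossing_Birkhoff_interlace:
  assumes irr: "\<omega> \<notin> \<rat>" and x: "x \<in> Birkhoff \<omega>" and y: "y \<in> Birkhoff \<omega>"
    and left: "\<And>l. l \<le> a \<Longrightarrow> x l \<le> y l" and right: "\<And>l. b \<le> l \<Longrightarrow> y l \<le> x l"
    and less: "of_int p < of_int q * \<omega>"
  shows "max (x i) (y i) + of_int p \<le> min (x (i + q)) (y (i + q))"
proof -
  have pos: "0 < of_int q * \<omega> - of_int p" using less by simp
  obtain q1 q2 p1 p2 :: int where
    *: "\<bar>a\<bar> + \<bar>b\<bar> + \<bar>i\<bar> < q1" "q2 < - (\<bar>a\<bar> + \<bar>b\<bar> + \<bar>i\<bar>)"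
    "of_int p1 < of_int q1 * \<omega>" "of_int q1 * \<omega> < of_int p1 + (of_int q * \<omega> - of_int p)"
    "of_int p2 < of_int q2 * \<omega>" "of_int q2 * \<omega> < of_int p2 + (of_int q * \<omega> - of_int p)"
    by (rule irrational_small_steps[OF irr pos, where Q = "\<bar>a\<bar> + \<bar>b\<bar> + \<bar>i\<bar>"])
  have "x i + of_int p \<le> x (i + q)" "y i + of_int p \<le> y (i + q)"
    by (rule BirkhoffD(3)[OF x less], rule BirkhoffD(3)[OF y less])
  moreover have "x i + of_int p \<le> y (i + q)"
  proof -
    have "x i + of_int p2 \<le> x (i + q2)" by (rule BirkhoffD(3)[OF x *(5)])
    also have "\<dots> \<le> y (i + q2)" using *(2) by (intro left) linarith
    finally have "x i + of_int p2 \<le> y (i + q2)" .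
    moreover have "y (i + q2) + of_int (p - p2) \<le> y (i + q2 + (q - q2))"
      by (rule BirkhoffD(3)[OF y]) (use *(6) in \<open>simp add: algebra_simps\<close>)
    ultimately show ?thesis by simp
  qed
  moreover have "y i + of_int p \<le> x (i + q)"
  proof -
    have "y i + of_int p1 \<le> y (i + q1)" by (rule BirkhoffD(3)[OF y *(3)])
    also have "\<dots> \<le> x (i + q1)" using *(1) by (intro right) linarith
    finally have "y i + of_int p1 \<le> x (i + q1)" .
    moreover have "x (i + q1) + of_int (p - p1) \<le> x (i + q1 + (q - q1))"
      by (rule BirkhoffD(3)[OF x]) (use *(4) in \<open>simp add: algebra_simps\<close>)
    ultimately show ?thesis by simp
  qed
  ultimately show ?thesis by (simp add: max_def)
qed

text \<open>
  The intervals between \<open>x i\<close> and \<open>y i\<close> have total length at most 1 by interlacing, so the two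
  configurations are asymptotic and cannot cross.
\<close>

lemma Birkhoff_comparable_aux:
  assumes irr: "\<omega> \<notin> \<rat>" and x: "x \<in> Birkhoff \<omega>" and y: "y \<in> Birkhoff \<omega>"
    and left: "\<And>l. l \<le> a \<Longrightarrow> x l \<le> y l" and right: "\<And>l. b \<le> l \<Longrightarrow> y l \<le> x l"
  shows "(\<forall>i. x i \<le> y i) \<or> (\<forall>i. y i \<le> x i)"
proof -
  define g where "g = (\<lambda>i. max (x i) (y i) - min (x i) (y i))"
  have bound: "(\<Sum>i\<in>F. g i) \<le> 1" if "finite F" for F
    unfolding g_def
    by (rule rotated_intervals_sum_le_1[OF irr _ that], rule crossing_Birkhoff_interlace[OF irr x y left right])
  have g: "\<bar>x i - y i\<bar> = g i" "0 \<le> g i" for i by (auto simp: g_def)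
  have "(\<lambda>n::nat. \<bar>x (f n) - y (f n)\<bar>) \<longlonglongrightarrow> 0" if "inj f" for f
    unfolding g(1) by (rule bounded_sums_tendsto_0[OF g(2) bound that])
  then have lim: "(\<lambda>n::nat. x (f n) - y (f n)) \<longlonglongrightarrow> 0" if "inj f" for f
    using that by (simp add: tendsto_rabs_zero_iff)
  have step: "\<bar>z l - z (l + 1)\<bar> \<le> 1 + \<bar>\<omega>\<bar>" if "z \<in> Birkhoff \<omega>" for z l
    using Birkhoff_deviation[OF that, of l 1] by simp
  show ?thesis
    by (rule asymptotic_minimal_comparable[OF BirkhoffD(1)[OF x] BirkhoffD(1)[OF y] step[OF x] step[OF y]])
       (auto intro!: lim injI)
qed

text \<open>
  By Aubry's lemma a crossing separates a half-line on which \<open>x\<close> is below \<open>y\<close> from one on which it is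
  above.
\<close>

theorem Birkhoff_comparable:
  assumes irr: "\<omega> \<notin> \<rat>" and x: "x \<in> Birkhoff \<omega>" and y: "y \<in> Birkhoff \<omega>"
  shows "(\<forall>i. x i \<le> y i) \<or> (\<forall>i. y i \<le> x i)"
proof (rule ccontr)
  assume neg: "\<not> ?thesis"
  then obtain i j where ij: "\<not> x i \<le> y i" "\<not> y j \<le> x j" by blast
  note xy = Aubry_crossing[OF BirkhoffD(1)[OF x] BirkhoffD(1)[OF y]]
  note yx = Aubry_crossing[OF BirkhoffD(1)[OF y] BirkhoffD(1)[OF x]]
  have "i \<noteq> j" using ij by auto
  then consider "j < i" | "i < j" by linarith
  then show False
  proof cases
    case 1
    have "x l \<le> y l" if "l \<le> j" for l
      using yx[of l i j] ij that 1 by linarith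
    moreover have "y l \<le> x l" if "i \<le> l" for l
      using xy[of j l i] ij that 1 by linarith
    ultimately show False using Birkhoff_comparable_aux[OF irr x y] neg by blast
  next
    case 2
    have "y l \<le> x l" if "l \<le> i" for l
      using xy[of l j i] ij that 2 by linarith
    moreover have "x l \<le> y l" if "j \<le> l" for l
      using yx[of i l j] ij that 2 by linarith
    ultimately show False using Birkhoff_comparable_aux[OF irr y x] neg by blast
  qed
qed

end

section \<open>Minimal configurations of rotation symbol 0 and 0+\<close>

lemma config_mono:
  fixes x :: config
  assumes "\<And>i. x i \<le> x (i + 1)" "i \<le> j" shows "x i \<le> x j"
  using assms(2)
proof (induction j rule: int_ge_induct)
  case (step j) then show ?case using assms(1)[of j] by simp
qed simp

lemma constant_config:
  fixes x :: config
  assumes "\<And>i. x (i + 1) = x i" shows "x i = x j"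
proof -
  have "x i = x 0" for i
  proof (induction i rule: int_induct[where k = 0])
    case (step2 i) then show ?case using assms[of "i - 1"] by simp
  qed (use assms in auto)
  from this[of i] this[of j] show ?thesis by simp
qed

context twist_potential
begin

definition minima :: "real set" where
  "minima = {z. \<forall>t. V z \<le> V t}"

lemma minima_translate: "z \<in> minima \<Longrightarrow> z + of_int p \<in> minima"
  by (simp add: minima_def V_periodic_int)

lemma minima_nonempty: "\<exists>z. z \<in> minima"
proof -
  obtain z where z: "z \<in> {0..1}" "\<And>t. t \<in> {0..1} \<Longrightarrow> V z \<le> V t"
    using continuous_attains_inf[of "{0..1}" V] continuous_on_subset[OF V_continuous] by auto
  have "V z \<le> V t" for t
  proof -
    have "V t = V (frac t)"
      using V_periodic_int[of "frac t" "\<lfloor>t\<rfloor>"] by (simp add: frac_def)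
    then show ?thesis using z(2)[of "frac t"] frac_ge_0[of t] frac_lt_1[of t] by simp
  qed
  then show ?thesis unfolding minima_def by blast
qed

lemma deriv_minimum: "z \<in> minima \<Longrightarrow> deriv V z = 0"
  using DERIV_local_min[of V "deriv V z" z 1] V_diff[of z]
  by (auto simp: minima_def DERIV_deriv_iff_real_differentiable)

text \<open>
  A constant at any other height would profit from spending a long time at a minimum of \<open>V\<close>, at the
  fixed price of two jumps.
\<close>

lemma constant_minimal_iff: "minimal (\<lambda>_. c) \<longleftrightarrow> c \<in> minima"
proof
  assume c: "c \<in> minima"
  show "minimal (\<lambda>_. c)"
  proof (rule minimalI)
    fix i j and z :: config
    have "h c c \<le> h (z l) (z (l + 1))" for l
      using c by (simp add: h_def minima_def add_increasing)
    then show "action (\<lambda>_. c) i j \<le> action z i j" unfolding action_def by (intro sum_mono)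
  qed
next
  assume min: "minimal (\<lambda>_. c)"
  show "c \<in> minima"
    unfolding minima_def
  proof (intro CollectI allI)
    fix t
    have "real m * (V c - V t) \<le> (c - t)\<^sup>2 - (V c - V t)" for m :: nat
    proof -
      define z :: config where "z = (\<lambda>l. if 1 \<le> l \<and> l \<le> int m + 1 then t else c)"
      have "action (\<lambda>_. c) 0 (int m + 2) \<le> action z 0 (int m + 2)"
        by (rule minimalD[OF min]) (auto simp: z_def)
      also have "action z 0 (int m + 2) = action z 0 1 + action z 1 (int m + 1) + action z (int m + 1) (int m + 2)"
        using action_split[of 0 1 "int m + 2" z] action_split[of 1 "int m + 1" "int m + 2" z] by simp
      also have "action z 0 1 = (c - t)\<^sup>2 / 2 + V t"
        using action_single[of z 0] by (simp add: z_def h_def)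
      also have "action z (int m + 1) (int m + 2) = (t - c)\<^sup>2 / 2 + V c"
      proof -
        have "int m + 2 = (int m + 1) + 1" by simp
        then have "action z (int m + 1) (int m + 2) = h (z (int m + 1)) (z (int m + 1 + 1))"
          using action_single[of z "int m + 1"] by metis
        then show ?thesis by (simp add: z_def h_def)
      qed
      also have "action z 1 (int m + 1) = action (\<lambda>_. t) 1 (int m + 1)"
        by (rule action_cong) (auto simp: z_def)
      finally show ?thesis by (simp add: action_def h_def power2_commute algebra_simps)
    qed
    then have "V c - V t \<le> 0" by (rule nat_multiples_bounded_imp_nonpos)
    then show "V c \<le> V t" by simp
  qed
qed

text \<open>
  A site inserted at the height \<open>z\<close> adds \<open>V z\<close> and splits a long bond, which saves energy. If \<open>x i\<close> is
  itself \<open>z\<close> no bond is split, but two consecutive sites at height \<open>z\<close>, approached from below, violate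
  the Euler-Lagrange equation and can be improved.
\<close>

lemma insert_minimum_gain:
  assumes x: "x i \<le> z" "z < x (i + 1)" "x (i - 1) < x i" and z: "z \<in> minima"
  obtains s t c where "0 < c"
    "h (x (i - 1)) s + h s t + h t (x (i + 1)) \<le> h (x (i - 1)) (x i) + h (x i) (x (i + 1)) + V z - c"
proof (cases "x i = z")
  case False
  define c where "c = (z - x i) * (x (i + 1) - z)"
  have "c > 0" using x False by (simp add: c_def)
  moreover have "h (x i) z + h z (x (i + 1)) = h (x i) (x (i + 1)) + V z - c"
    by (simp add: h_def c_def power2_eq_square field_simps)
  ultimately show ?thesis using that[of c "x i" z] by simp
next
  case True
  have "\<exists>t. h (x (i - 1)) t + h t z < h (x (i - 1)) z + h z z"
  proof (rule ccontr)
    assume "\<nexists>t. h (x (i - 1)) t + h t z < h (x (i - 1)) z + h z z"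
    then have le: "h (x (i - 1)) z + h z z \<le> h (x (i - 1)) t + h t z" for t by (simp add: not_less)
    have "x (i - 1) + z = 2 * z + deriv V z"
    proof (rule critical_point_of_bond_sum[OF V_diff])
      fix t
      show "(x (i - 1) - z)\<^sup>2 / 2 + V z + (z - z)\<^sup>2 / 2
          \<le> (x (i - 1) - t)\<^sup>2 / 2 + V t + (t - z)\<^sup>2 / 2"
        using le[of t] by (simp add: h_def)
    qed
    then show False using deriv_minimum[OF z] x True by simp
  qed
  then obtain s where s: "h (x (i - 1)) s + h s z < h (x (i - 1)) z + h z z" by blast
  define c where "c = (h (x (i - 1)) z + h z z) - (h (x (i - 1)) s + h s z)"
  have "h z z = V z" by (simp add: h_def)
  then show ?thesis using that[of c s z] s True by (simp add: c_def)
qed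

lemma rotation_zero_small_steps:
  assumes mono: "\<And>i. x i \<le> x (i + 1)" and rot: "has_rotation_number x 0" and "\<epsilon> > 0"
  obtains M where "M > b" "x (M + 1) - x (M - 1) < \<epsilon>"
proof -
  have "\<exists>M>b. x (M + 1) - x (M - 1) < \<epsilon>"
  proof (rule ccontr)
    assume "\<not> ?thesis"
    then have big: "\<epsilon> \<le> x (M + 1) - x (M - 1)" if "b < M" for M using that by (meson not_less)
    have grow: "real m * \<epsilon> \<le> x (b + int (2 * m)) - x b" for m
    proof (induction m)
      case (Suc m)
      then show ?case using big[of "b + int (2 * m) + 1"] by (simp add: algebra_simps)
    qed simp
    have "(\<lambda>m. (x (b + int m) - x b) / real m) \<longlonglongrightarrow> 0"
      using rot unfolding has_rotation_number_def by blast
    then have "eventually (\<lambda>m. (x (b + int m) - x b) / real m < \<epsilon> / 2) sequentially"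
      using \<open>\<epsilon> > 0\<close> by (intro order_tendstoD(2)) auto
    then obtain N where N: "\<And>m. m \<ge> N \<Longrightarrow> (x (b + int m) - x b) / real m < \<epsilon> / 2"
      unfolding eventually_sequentially by blast
    have "x (b + int (2 * Suc N)) - x b < real (Suc N) * \<epsilon>"
      using N[of "2 * Suc N"] by (simp add: field_simps)
    then show False using grow[of "Suc N"] by simp
  qed
  then show ?thesis using that by blast
qed

text \<open>
  Insert a site at the minimum and make up for the delay much later, where two consecutive steps of \<open>x\<close>
  together are so short that one site can be dropped almost for free. The dropped site saves at least
  \<open>V z\<close>, so the gain of the insertion remains.
\<close>

lemma no_crossing_of_minimum:
  assumes x: "minimal x" and inc: "\<And>i. x i < x (i + 1)" and rot: "has_rotation_number x 0"
    and z: "z \<in> minima" and cross: "x i \<le> z" "z < x (i + 1)"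
  shows False
proof -
  obtain s t c where c: "0 < c"
    "h (x (i - 1)) s + h s t + h t (x (i + 1)) \<le> h (x (i - 1)) (x i) + h (x i) (x (i + 1)) + V z - c"
    by (rule insert_minimum_gain[OF cross _ z]) (use inc[of "i - 1"] in auto)
  \<comment> \<open>Small enough that dropping a site between two steps of total length \<open>\<epsilon>\<close> costs less than \<open>c\<close>.\<close>
  define \<epsilon> where "\<epsilon> = min 1 (c / (2 + L))"
  have \<epsilon>: "\<epsilon> > 0" "\<epsilon> \<le> 1" "\<epsilon> \<le> c / (2 + L)" using c L_nonneg by (simp_all add: \<epsilon>_def)
  obtain M where M: "M > i + 1" "x (M + 1) - x (M - 1) < \<epsilon>"
    by (rule rotation_zero_small_steps[OF less_imp_le[OF inc] rot \<epsilon>(1), of "i + 1"])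
  define w where "w = (\<lambda>l. if l \<le> i - 1 then x l else if l = i then s else if l = i + 1 then t
     else if l \<le> M then x (l - 1) else x l)"
  have w: "w (i - 1) = x (i - 1)" "w i = s" "w (i + 1) = t" "w (i + 2) = x (i + 1)"
    "w M = x (M - 1)" "w (M + 1) = x (M + 1)"
    using M(1) by (auto simp: w_def add.commute)
  have 1: "action x (i - 1) (M + 1) \<le> action w (i - 1) (M + 1)"
    by (rule minimalD[OF x]) (auto simp: w)
  have 2: "action x (i - 1) (M + 1) =
      h (x (i - 1)) (x i) + h (x i) (x (i + 1)) + action x (i + 1) (M - 1) + h (x (M - 1)) (x M) + h (x M) (x (M + 1))"
    using M(1) action_split[of "i - 1" "i + 1" "M + 1" x] action_split[of "i + 1" "M - 1" "M + 1" x]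
      action_two[of x i] action_two[of x M] by simp
  have "action w (i + 1) (i + 2) = h t (x (i + 1))"
  proof -
    have "i + 2 = (i + 1) + 1" by simp
    then show ?thesis using action_single[of w "i + 1"] w by metis
  qed
  then have 3: "action w (i - 1) (M + 1) =
      h (x (i - 1)) s + h s t + h t (x (i + 1)) + action w (i + 2) M + h (x (M - 1)) (x (M + 1))"
    using M(1) action_split[of "i - 1" "i + 1" "M + 1" w] action_split[of "i + 1" "i + 2" "M + 1" w]
      action_split[of "i + 2" M "M + 1" w]
      action_two[of w i] action_single[of w M] w by simp
  have 4: "action w (i + 2) M = action x (i + 1) (M - 1)"
  proof -
    have "action w (i + 2) M = action (\<lambda>l. x (l + - 1) + of_int 0) (i + 2) M"
      by (rule action_cong) (auto simp: w_def)
    then show ?thesis by (subst (asm) action_translate) (simp add: add.commute)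
  qed
  have 5: "V z \<le> V (x (M + 1))" using z by (simp add: minima_def)
  have 6: "h (x (M - 1)) (x (M + 1)) \<le> h (x (M - 1)) (x M) + V (x (M + 1)) - V (x M) + \<epsilon>\<^sup>2 / 2"
  proof -
    have "(x (M - 1) - x (M + 1))\<^sup>2 \<le> \<epsilon>\<^sup>2"
      using M(2) inc[of "M - 1"] inc[of M] \<epsilon> by (subst power2_commute) (intro power_mono, auto)
    then show ?thesis
      using zero_le_power2[of "x (M - 1) - x M"] unfolding h_def by linarith
  qed
  have 7: "V (x (M + 1)) - V (x M) \<le> L * \<epsilon>"
  proof -
    have "\<bar>V (x (M + 1)) - V (x M)\<bar> \<le> L * \<bar>x (M + 1) - x M\<bar>" by (rule V_lipschitz)
    also have "\<dots> \<le> L * \<epsilon>"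
      using M(2) inc[of "M - 1"] inc[of M] L_nonneg by (intro mult_left_mono) auto
    finally show ?thesis by simp
  qed
  have 8: "V (x (M + 1)) \<le> h (x M) (x (M + 1))" by (simp add: h_def)
  have 9: "L * \<epsilon> + \<epsilon>\<^sup>2 / 2 < c"
  proof -
    have "\<epsilon>\<^sup>2 \<le> \<epsilon>" using \<epsilon> by (simp add: power2_eq_square mult_left_le)
    moreover have "\<epsilon> * (2 + L) \<le> c" using \<epsilon>(3) L_nonneg by (simp add: field_simps)
    ultimately show ?thesis using \<epsilon>(1) by (simp add: algebra_simps)
  qed
  have "h (x M) (x (M + 1)) \<le> V z - c + (h (x (M - 1)) (x (M + 1)) - h (x (M - 1)) (x M))"
    using 1 c(2) unfolding 2 3 4 by linarith
  moreover have "h (x (M - 1)) (x (M + 1)) - h (x (M - 1)) (x M) < c"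
    using 6 7 9 by linarith
  ultimately show False using 5 8 by linarith
qed

lemma increasing_side_of_minimum:
  assumes x: "minimal x" and inc: "\<And>i. x i < x (i + 1)" and rot: "has_rotation_number x 0"
    and z: "z \<in> minima"
  shows "(\<forall>i. x i \<le> z) \<or> (\<forall>i. z \<le> x i)"
proof (rule ccontr)
  assume "\<not> ?thesis"
  then obtain a b where "\<not> x a \<le> z" "\<not> z \<le> x b" by blast
  then have ab: "z < x a" "x b < z" by simp_all
  have "x i \<le> z" if "b \<le> i" for i
    using that
  proof (induction i rule: int_ge_induct)
    case base then show ?case using ab by simp
  next
    case (step i)
    then show ?case using no_crossing_of_minimum[OF x inc rot z, of i] by (meson not_le)
  qed
  moreover have "b \<le> a"
    using config_mono[of x a b, OF less_imp_le[OF inc]] ab by linarith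
  ultimately show False using ab by force
qed

lemma M_0plus_side_of_minimum:
  assumes "x \<in> M_0plus h" "z \<in> minima"
  shows "(\<forall>i. x i \<le> z) \<or> (\<forall>i. z \<le> x i)"
proof (cases "has_symbol_0 x")
  case True
  then have "x (i + 1) = x i" for i by (simp add: has_symbol_0_def)
  then have eq: "x i = x 0" for i by (rule constant_config)
  define c where "c = x 0"
  have "x i = c" for i unfolding c_def by (rule eq)
  then show ?thesis using linear[of c z] by simp
next
  case False
  then show ?thesis
    using assms increasing_side_of_minimum by (auto simp: M_0plus_def has_symbol_0plus_def)
qed

text \<open>
  A form without limits and strict inequalities, hence stable under pointwise convergence. The width 1
  comes from being trapped between neighbouring translates of a minimum of \<open>V\<close>.
\<close>

lemma M_0plus_iff:
  "x \<in> M_0plus h \<longleftrightarrow> minimal x \<and> (\<forall>i. x i \<le> x (i + 1)) \<and> (\<forall>i j. x i \<le> x j + 1)"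
proof (intro iffI conjI)
  assume x: "x \<in> M_0plus h"
  then show "minimal x" by (simp add: M_0plus_def)
  show "\<forall>i. x i \<le> x (i + 1)"
    using x by (auto simp: M_0plus_def has_symbol_0_def has_symbol_0plus_def less_imp_le)
  obtain z where z: "z \<in> minima" using minima_nonempty by blast
  \<comment> \<open>The translate of a minimum just below \<open>x 0\<close>; \<open>x\<close> stays on one side of it and of its two neighbours.\<close>
  define c where "c = z + of_int \<lfloor>x 0 - z\<rfloor>"
  have c: "c \<le> x 0" "x 0 < c + 1" unfolding c_def by linarith+
  have cmin: "c \<in> minima" "c + 1 \<in> minima" "c - 1 \<in> minima"
    using minima_translate[OF z, of "\<lfloor>x 0 - z\<rfloor>"] minima_translate[OF z, of "\<lfloor>x 0 - z\<rfloor> + 1"]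
      minima_translate[OF z, of "\<lfloor>x 0 - z\<rfloor> - 1"] by (simp_all add: c_def algebra_simps)
  have upper: "x i \<le> c + 1" for i
    using M_0plus_side_of_minimum[OF x cmin(2)] c(2) by (meson not_less)
  have "\<not> x 0 \<le> c - 1" using c(1) by simp
  then have lower: "c - 1 \<le> x i" for i
    using M_0plus_side_of_minimum[OF x cmin(3)] by blast
  from M_0plus_side_of_minimum[OF x cmin(1)] show "\<forall>i j. x i \<le> x j + 1"
  proof
    assume *: "\<forall>i. x i \<le> c"
    show ?thesis
    proof (intro allI)
      fix i j show "x i \<le> x j + 1" using *[rule_format, of i] lower[of j] by linarith
    qed
  next
    assume *: "\<forall>i. c \<le> x i"
    show ?thesis
    proof (intro allI)
      fix i j show "x i \<le> x j + 1" using *[rule_format, of j] upper[of i] by linarith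
    qed
  qed
next
  assume *: "minimal x \<and> (\<forall>i. x i \<le> x (i + 1)) \<and> (\<forall>i j. x i \<le> x j + 1)"
  have rot: "has_rotation_number x 0"
    unfolding has_rotation_number_def
  proof
    fix i
    have "\<bar>x (i + int m) - x i\<bar> \<le> 1" for m
    proof -
      have "x (i + int m) \<le> x i + 1" "x i \<le> x (i + int m) + 1" using * by blast+
      then show ?thesis by linarith
    qed
    then have "norm ((x (i + int m) - x i) / real m) \<le> 1 / real m" for m
      by (simp add: abs_divide divide_right_mono)
    then show "(\<lambda>m. (x (i + int m) - x i) / real m) \<longlonglongrightarrow> 0"
      by (intro Lim_null_comparison[OF always_eventually lim_1_over_n]) auto
  qed
  show "x \<in> M_0plus h"
  proof (cases "\<exists>c. x c = x (c + 1)")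
    case True
    then obtain c where c: "x c = x (c + 1)" by blast
    have sh: "minimal (\<lambda>i. x (i + 1))" using minimal_translate[of x 1 0] * by simp
    have "x = (\<lambda>i. x (i + 1))"
      by (rule minimal_touch[OF _ sh, of _ c]) (use * c in auto)
    then have "x (i + 1) = x i" for i by (rule fun_cong[symmetric])
    then show ?thesis using * rot by (simp add: M_0plus_def has_symbol_0_def)
  next
    case False
    then have "x i < x (i + 1)" for i using * by (metis order_le_less)
    then show ?thesis using * rot by (simp add: M_0plus_def has_symbol_0plus_def)
  qed
qed

text \<open>
  The limit heights are constant limits of translates, hence minimal, hence minima of \<open>V\<close>.
\<close>

lemma M_0plus_limits:
  assumes x: "x \<in> M_0plus h"
  obtains \<alpha> \<beta> where "\<alpha> \<in> minima" "\<beta> \<in> minima" "\<And>i. \<alpha> \<le> x i" "\<And>i. x i \<le> \<beta>"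
    "(\<lambda>n. x (int n)) \<longlonglongrightarrow> \<beta>" "(\<lambda>n. x (- int n)) \<longlonglongrightarrow> \<alpha>"
proof -
  have min: "minimal x" and step: "\<And>i. x i \<le> x (i + 1)" and width: "\<And>i j. x i \<le> x j + 1"
    using x by (auto simp: M_0plus_iff)
  note mono = config_mono[of x, OF step]
  define \<beta> where "\<beta> = (SUP i. x i)"
  define \<alpha> where "\<alpha> = (INF i. x i)"
  have bdd: "bdd_above (range x)" "bdd_below (range x)"
    using width[of _ 0] width[of 0] by (auto intro!: bdd_aboveI[of _ "x 0 + 1"] bdd_belowI[of _ "x 0 - 1"] simp: algebra_simps)
  have \<beta>: "x i \<le> \<beta>" and \<alpha>: "\<alpha> \<le> x i" for i
    unfolding \<alpha>_def \<beta>_def using bdd by (auto intro: cSUP_upper cINF_lower)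
  have top: "(\<lambda>n. x (i + int n)) \<longlonglongrightarrow> \<beta>" for i
  proof (rule increasing_tendsto)
    fix y assume "y < \<beta>"
    then obtain j where j: "y < x j" unfolding \<beta>_def using less_cSUP_iff[OF _ bdd(1)] by auto
    have "y < x (i + int n)" if "n \<ge> nat (j - i)" for n
      using mono[of j "i + int n"] j that by (simp add: nat_le_iff)
    then show "eventually (\<lambda>n. y < x (i + int n)) sequentially" by (rule eventually_sequentiallyI)
  qed (simp add: \<beta>)
  have bot: "(\<lambda>n. x (i - int n)) \<longlonglongrightarrow> \<alpha>" for i
  proof (rule decreasing_tendsto)
    fix y assume "\<alpha> < y"
    then obtain j where j: "x j < y" unfolding \<alpha>_def using cINF_less_iff[OF _ bdd(2)] by auto
    have "x (i - int n) < y" if "n \<ge> nat (i - j)" for n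
      using mono[of "i - int n" j] j that by (simp add: nat_le_iff)
    then show "eventually (\<lambda>n. x (i - int n) < y) sequentially" by (rule eventually_sequentiallyI)
  qed (simp add: \<alpha>)
  have tr: "minimal (\<lambda>i. x (i + q))" "minimal (\<lambda>i. x (i - q))" for q
    using minimal_translate[OF min, of q 0] minimal_translate[OF min, of "- q" 0] by simp_all
  have "minimal (\<lambda>_. \<beta>)" by (rule minimal_limit[OF tr(1) top])
  moreover have "minimal (\<lambda>_. \<alpha>)" by (rule minimal_limit[OF tr(2) bot])
  ultimately have "minimal (\<lambda>_. \<beta>)" "minimal (\<lambda>_. \<alpha>)" by blast+
  then show ?thesis using that[of \<alpha> \<beta>] \<alpha> \<beta> top[of 0] bot[of 0] by (simp add: constant_minimal_iff)
qed

text \<open>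
  If the two configurations have different limits on some side, one of these limits is a minimum that
  separates them; otherwise they are asymptotic.
\<close>

theorem M_0plus_comparable:
  assumes x: "x \<in> M_0plus h" and y: "y \<in> M_0plus h"
  shows "(\<forall>i. x i \<le> y i) \<or> (\<forall>i. y i \<le> x i)"
proof -
  obtain a b where x': "a \<in> minima" "b \<in> minima" "\<And>i. a \<le> x i" "\<And>i. x i \<le> b"
    "(\<lambda>n. x (int n)) \<longlonglongrightarrow> b" "(\<lambda>n. x (- int n)) \<longlonglongrightarrow> a"
    using M_0plus_limits[OF x] by metis
  obtain a' b' where y': "a' \<in> minima" "b' \<in> minima" "\<And>i. a' \<le> y i" "\<And>i. y i \<le> b'"
    "(\<lambda>n. y (int n)) \<longlonglongrightarrow> b'" "(\<lambda>n. y (- int n)) \<longlonglongrightarrow> a'"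
    using M_0plus_limits[OF y] by metis
  have above: "(\<forall>i. z \<le> u i)" if "u \<in> M_0plus h" "z \<in> minima" "(\<lambda>n. u (f n)) \<longlonglongrightarrow> c" "z < c"
    for u z c and f :: "nat \<Rightarrow> int"
  proof -
    have "\<not> (\<forall>i. u i \<le> z)" using LIMSEQ_le_const2[OF that(3), of z] that(4) by auto
    then show ?thesis using M_0plus_side_of_minimum[OF that(1,2)] by blast
  qed
  have below: "(\<forall>i. u i \<le> z)" if "u \<in> M_0plus h" "z \<in> minima" "(\<lambda>n. u (f n)) \<longlonglongrightarrow> c" "c < z"
    for u z c and f :: "nat \<Rightarrow> int"
  proof -
    have "\<not> (\<forall>i. z \<le> u i)" using LIMSEQ_le_const[OF that(3), of z] that(4) by auto
    then show ?thesis using M_0plus_side_of_minimum[OF that(1,2)] by blast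
  qed
  consider "b < b'" | "b' < b" | "a < a'" | "a' < a" | "a = a'" "b = b'" by linarith
  then show ?thesis
  proof cases
    case 1
    note * = above[OF y x'(2) y'(5) this, rule_format]
    have "x i \<le> y i" for i using x'(4)[of i] *[of i] by linarith
    then show ?thesis by blast
  next
    case 2
    note * = above[OF x y'(2) x'(5) this, rule_format]
    have "y i \<le> x i" for i using y'(4)[of i] *[of i] by linarith
    then show ?thesis by blast
  next
    case 3
    note * = below[OF x y'(1) x'(6) this, rule_format]
    have "x i \<le> y i" for i using y'(3)[of i] *[of i] by linarith
    then show ?thesis by blast
  next
    case 4
    note * = below[OF y x'(1) y'(6) this, rule_format]
    have "y i \<le> x i" for i using x'(3)[of i] *[of i] by linarith
    then show ?thesis by blast
  next
    case 5
    have step: "\<bar>u l - u (l + 1)\<bar> \<le> 1" if "u \<in> M_0plus h" for u l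
    proof -
      have "u l \<le> u (l + 1)" "u (l + 1) \<le> u l + 1" using that by (auto simp: M_0plus_iff)
      then show ?thesis by simp
    qed
    show ?thesis
    proof (rule asymptotic_minimal_comparable[of x y 1])
      show "minimal x" "minimal y" using x y by (simp_all add: M_0plus_iff)
      show "(\<lambda>n. x (int n) - y (int n)) \<longlonglongrightarrow> 0" "(\<lambda>n. x (- int n) - y (- int n)) \<longlonglongrightarrow> 0"
        using tendsto_diff[OF x'(5) y'(5)] tendsto_diff[OF x'(6) y'(6)] 5 by simp_all
    qed (use step x y in blast)+
  qed
qed

end

section \<open>Peierls's barrier in an ordered family\<close>

lemma symmetric_intervals_exhaust:
  "filterlim (\<lambda>n. {- int n..<int n}) (finite_subsets_at_top UNIV) sequentially"
  unfolding filterlim_finite_subsets_at_top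
proof (intro allI impI)
  fix X :: "int set"
  assume "finite X \<and> X \<subseteq> UNIV"
  then have X: "finite (abs ` X)" by simp
  define N where "N = nat (Max (insert 0 (abs ` X)) + 1)"
  have N: "\<bar>i\<bar> < int N" if "i \<in> X" for i
  proof -
    have "\<bar>i\<bar> \<le> Max (insert 0 (abs ` X))" using X that by (intro Max_ge) auto
    then show ?thesis by (simp add: N_def)
  qed
  show "eventually (\<lambda>n. finite {- int n..<int n} \<and> X \<subseteq> {- int n..<int n} \<and> {- int n..<int n} \<subseteq> UNIV) sequentially"
  proof (rule eventually_sequentiallyI[of N])
    fix n assume "N \<le> n"
    then have "i \<in> {- int n..<int n}" if "i \<in> X" for i using N[OF that] by auto
    then show "finite {- int n..<int n} \<and> X \<subseteq> {- int n..<int n} \<and> {- int n..<int n} \<subseteq> UNIV"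
      by blast
  qed
qed

lemma has_sum_int_tendsto:
  fixes f :: "int \<Rightarrow> real"
  assumes "(f has_sum S) UNIV"
  shows "(\<lambda>n. \<Sum>i\<in>{- int n..<int n}. f i) \<longlonglongrightarrow> S"
  using assms unfolding has_sum_def by (rule filterlim_compose[OF _ symmetric_intervals_exhaust])

lemma sum_symmetric_interval:
  fixes f :: "int \<Rightarrow> real"
  shows "(\<Sum>n<N. f (int n) + f (- int n - 1)) = (\<Sum>i\<in>{- int N..<int N}. f i)"
proof (induction N)
  case (Suc N)
  have "{- int (Suc N)..<int (Suc N)} = insert (- int N - 1) (insert (int N) {- int N..<int N})"
    by auto
  then show ?case using Suc by simp
qed simp

context twist_potential
begin

lemma finite_perturbation_has_sum:
  assumes "a \<le> b" and agree: "\<And>l. l \<le> a \<or> b \<le> l \<Longrightarrow> z l = x l"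
  shows "((\<lambda>i. h (z i) (z (i + 1)) - h (x i) (x (i + 1))) has_sum (action z a b - action x a b)) UNIV"
proof -
  have "((\<lambda>i. h (z i) (z (i + 1)) - h (x i) (x (i + 1))) has_sum (action z a b - action x a b)) {a..<b}"
    unfolding action_def sum_subtractf[symmetric] by (rule has_sum_finite) simp
  moreover have "h (z i) (z (i + 1)) - h (x i) (x (i + 1)) = 0" if "i \<notin> {a..<b}" for i
  proof -
    have "i < a \<or> b \<le> i" using that by auto
    then have "z i = x i" "z (i + 1) = x (i + 1)" using agree[of i] agree[of "i + 1"] by auto
    then show ?thesis by simp
  qed
  then have "((\<lambda>i. h (z i) (z (i + 1)) - h (x i) (x (i + 1))) has_sum (action z a b - action x a b)) UNIV \<longleftrightarrow>
      ((\<lambda>i. h (z i) (z (i + 1)) - h (x i) (x (i + 1))) has_sum (action z a b - action x a b)) {a..<b}"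
    by (intro has_sum_cong_neutral) auto
  ultimately show ?thesis by blast
qed

lemma action_difference_tendsto:
  assumes "((\<lambda>i. h (z i) (z (i + 1)) - h (x i) (x (i + 1))) has_sum S) UNIV"
  shows "(\<lambda>n. action z (- int n) (int n) - action x (- int n) (int n)) \<longlonglongrightarrow> S"
  using has_sum_int_tendsto[OF assms] by (simp add: action_def sum_subtractf)

definition unit_steps :: "config \<Rightarrow> bool" where
  "unit_steps x \<longleftrightarrow> (\<forall>i. x i \<le> x (i + 1) \<and> x (i + 1) \<le> x i + 1)"

lemma unit_steps_abs:
  assumes "unit_steps x" shows "\<bar>x l - x (l + 1)\<bar> \<le> 1"
proof -
  have "x l \<le> x (l + 1)" "x (l + 1) \<le> x l + 1" using assms unfolding unit_steps_def by blast+
  then show ?thesis by linarith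
qed

end

text \<open>
  The properties of $M_\omega^h$ and $M_{0^+}^h$ from which the barrier is constructed.
\<close>

locale ordered_family = twist_potential V L for V L +
  fixes M :: "config set"
  assumes M_minimal: "x \<in> M \<Longrightarrow> minimal x"
    and M_unit_steps: "x \<in> M \<Longrightarrow> unit_steps x"
    and M_translate: "x \<in> M \<Longrightarrow> (\<lambda>i. x (i + q) + of_int p) \<in> M"
    and M_comparable: "x \<in> M \<Longrightarrow> y \<in> M \<Longrightarrow> (\<forall>i. x i \<le> y i) \<or> (\<forall>i. y i \<le> x i)"
    and M_closed: "(\<And>n. X n \<in> M) \<Longrightarrow> (\<And>i. (\<lambda>n. X n i) \<longlonglongrightarrow> x i) \<Longrightarrow> x \<in> M"
    and M_nonempty: "M \<noteq> {}"
begin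

lemma M_eq:
  assumes x: "x \<in> M" and y: "y \<in> M" and eq: "x 0 = y 0" shows "x = y"
  using M_comparable[OF x y]
proof
  assume "\<forall>i. x i \<le> y i"
  then show ?thesis by (intro minimal_touch[OF M_minimal[OF x] M_minimal[OF y] _ eq]) simp
next
  assume "\<forall>i. y i \<le> x i"
  then have "y = x" by (intro minimal_touch[OF M_minimal[OF y] M_minimal[OF x] _ eq[symmetric]]) simp
  then show ?thesis by simp
qed

lemma M_le:
  assumes x: "x \<in> M" and y: "y \<in> M" and le: "x 0 \<le> y 0" shows "x i \<le> y i"
  using M_comparable[OF x y]
proof
  assume *: "\<forall>i. y i \<le> x i"
  then have "x 0 = y 0" using le by (simp add: order_antisym)
  then show ?thesis using M_eq[OF x y] by simp
qed blast

lemma M_bound: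
  assumes "x \<in> M" shows "\<bar>x i\<bar> \<le> \<bar>x 0\<bar> + \<bar>of_int i\<bar>"
proof -
  have b: "\<bar>x l - x (l + 1)\<bar> \<le> 1" for l by (rule unit_steps_abs[OF M_unit_steps[OF assms]])
  show ?thesis
  proof (induction i rule: int_induct[where k = 0])
    case base show ?case by simp
  next
    case (step1 i) then show ?case using b[of i] by simp
  next
    case (step2 i)
    then have "\<bar>real_of_int (i - 1)\<bar> = \<bar>real_of_int i\<bar> + 1" by linarith
    then show ?case using step2 b[of "i - 1"] by simp
  qed
qed

lemma closed_proj0: "closed (proj0 M)"
  unfolding closed_sequential_limits
proof (intro allI impI, elim conjE)
  fix a \<xi> assume a: "\<forall>n. a n \<in> proj0 M" and lim: "a \<longlonglongrightarrow> \<xi>"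
  have "\<exists>x. x \<in> M \<and> x 0 = a n" for n using a[rule_format, of n] by (auto simp: proj0_def)
  then obtain X where X: "\<And>n. X n \<in> M" "\<And>n. X n 0 = a n" by metis
  have "Bseq a" using lim by (intro convergent_imp_Bseq convergentI)
  then obtain R where R: "\<And>n. \<bar>a n\<bar> \<le> R" using BseqE by (metis real_norm_def)
  have "\<bar>X n i\<bar> \<le> R + \<bar>of_int i\<bar>" for n i using M_bound[OF X(1), of n i] X(2)[of n] R[of n] by simp
  then obtain x r where r: "strict_mono (r :: nat \<Rightarrow> nat)" "\<And>i. (\<lambda>n. X (r n) i) \<longlonglongrightarrow> x i"
    by (rule config_convergent_subsequence[where X = X and R = "\<lambda>i. R + \<bar>of_int i\<bar>"]) (rule that)
  have "x \<in> M" by (rule M_closed[OF _ r(2)]) (rule X(1))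
  moreover have "(\<lambda>n. a (r n)) \<longlonglongrightarrow> x 0" using r(2)[of 0] X(2) by simp
  then have "x 0 = \<xi>"
    using LIMSEQ_subseq_LIMSEQ[OF lim r(1)] by (intro LIMSEQ_unique) (auto simp: o_def)
  ultimately show "\<xi> \<in> proj0 M" by (auto simp: proj0_def)
qed

text \<open>
  The set of heights at index 0 is closed and, by the integer translations, unbounded in both
  directions.
\<close>

lemma gap_exists:
  assumes "\<xi> \<notin> proj0 M" obtains xm xp where "gap_configs M \<xi> xm xp"
proof -
  obtain x where x: "x \<in> M" using M_nonempty by blast
  define A where "A = proj0 M \<inter> {..\<xi>}"
  define B where "B = proj0 M \<inter> {\<xi>..}"
  have shift: "x 0 + of_int p \<in> proj0 M" for p
    using M_translate[OF x, of 0 p] by (force simp: proj0_def)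
  have "x 0 + of_int \<lfloor>\<xi> - x 0\<rfloor> \<in> A" "x 0 + of_int \<lceil>\<xi> - x 0\<rceil> \<in> B"
    using shift by (auto simp: A_def B_def) linarith+
  then have ne: "A \<noteq> {}" "B \<noteq> {}" by blast+
  have bdd: "bdd_above A" "bdd_below B" by (auto simp: A_def B_def intro: bdd_aboveI bdd_belowI)
  have cl: "closed A" "closed B" unfolding A_def B_def by (intro closed_Int closed_proj0 closed_atMost closed_atLeast)+
  have in_A: "Sup A \<in> A" and in_B: "Inf B \<in> B"
    using closed_contains_Sup[OF ne(1) bdd(1) cl(1)] closed_contains_Inf[OF ne(2) bdd(2) cl(2)] .
  then obtain xm xp where xm: "xm \<in> M" "xm 0 = Sup A" and xp: "xp \<in> M" "xp 0 = Inf B"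
    by (auto simp: A_def B_def proj0_def)
  have "xm 0 \<noteq> \<xi>" "xp 0 \<noteq> \<xi>" using assms xm(1) xp(1) by (auto simp: proj0_def)
  then have "xm 0 < \<xi>" "\<xi> < xp 0" using in_A in_B xm xp by (auto simp: A_def B_def)
  moreover have "y \<notin> proj0 M" if "xm 0 < y" "y < xp 0" for y
  proof
    assume y: "y \<in> proj0 M"
    show False
    proof (cases "y \<le> \<xi>")
      case True
      then have "y \<le> Sup A" using y bdd(1) by (intro cSup_upper) (auto simp: A_def)
      then show False using that xm by simp
    next
      case False
      then have "Inf B \<le> y" using y bdd(2) by (intro cInf_lower) (auto simp: B_def)
      then show False using that xp by simp
    qed
  qed
  ultimately have "gap_configs M \<xi> xm xp" using xm(1) xp(1) by (auto simp: gap_configs_def)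
  then show ?thesis by (rule that)
qed

lemma gap_avoids:
  assumes "gap_configs M \<xi> xm xp" "x \<in> M" shows "x 0 \<le> xm 0 \<or> xp 0 \<le> x 0"
proof -
  have "x 0 \<in> proj0 M" using assms(2) by (auto simp: proj0_def)
  moreover have "{xm 0<..<xp 0} \<inter> proj0 M = {}" using assms(1) by (simp add: gap_configs_def)
  ultimately have "x 0 \<notin> {xm 0<..<xp 0}" by blast
  then show ?thesis by auto
qed

lemma gap_unique:
  assumes g: "gap_configs M \<xi> xm xp" and g': "gap_configs M \<xi> ym yp"
  shows "ym = xm \<and> yp = xp"
proof -
  have *: "xm \<in> M" "xp \<in> M" "ym \<in> M" "yp \<in> M" "xm 0 < \<xi>" "\<xi> < xp 0" "ym 0 < \<xi>" "\<xi> < yp 0"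
    using g g' by (simp_all add: gap_configs_def)
  have "ym 0 = xm 0" "yp 0 = xp 0"
    using gap_avoids[OF g *(3)] gap_avoids[OF g *(4)] gap_avoids[OF g' *(1)] gap_avoids[OF g' *(2)] *
    by linarith+
  then show ?thesis using * by (simp add: M_eq)
qed

lemma gap_le: "gap_configs M \<xi> xm xp \<Longrightarrow> xm i \<le> xp i"
  by (rule M_le) (auto simp: gap_configs_def)

lemma gap_width:
  assumes g: "gap_configs M \<xi> xm xp" shows "xp i \<le> xm i + 1"
proof -
  have x: "xm \<in> M" "xp \<in> M" using g by (simp_all add: gap_configs_def)
  have up: "(\<lambda>i. xm (i + 0) + of_int 1) \<in> M" by (rule M_translate[OF x(1)])
  have "xp 0 \<le> xm 0 + 1" using gap_avoids[OF g up] by simp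
  then show ?thesis using M_le[OF x(2) up, of i] by simp
qed

text \<open>
  The upper bound moves a single site of the lower configuration to \<open>\<xi>\<close>. The lower bound is minimality
  of \<open>xm\<close> with free ends, which are at most 1 apart from it.
\<close>

lemma barrier_sums_bounds:
  assumes g: "gap_configs M \<xi> xm xp"
  shows "\<exists>S\<in>barrier_sums h \<xi> xm xp. S \<le> 4 + L" and "S \<in> barrier_sums h \<xi> xm xp \<Longrightarrow> - (4 + L) \<le> S"
proof -
  have x: "xm \<in> M" "xp \<in> M" "xm 0 < \<xi>" "\<xi> < xp 0" using g by (simp_all add: gap_configs_def)
  have cost: "\<bar>splice_cost xm z i j\<bar> \<le> 4 + L" if "\<And>l. l = i \<or> l = j \<Longrightarrow> \<bar>z l - xm l\<bar> \<le> 1" for z i j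
  proof -
    have "\<bar>V (z i) - V (xm i)\<bar> \<le> L * 1"
      using V_lipschitz[of "z i" "xm i"] that[of i] mult_left_mono[of _ 1 L] L_nonneg by (meson order_trans)
    then have "\<bar>splice_cost xm z i j\<bar> \<le> 1 * (1 + 1) + L * 1 + 1 * (1 + 1)"
      using that by (intro splice_cost_le unit_steps_abs[OF M_unit_steps[OF x(1)]]) auto
    then show ?thesis by simp
  qed
  show "\<exists>S\<in>barrier_sums h \<xi> xm xp. S \<le> 4 + L"
  proof
    define z where "z = splice xm (\<lambda>_. \<xi>) 0 0"
    have "\<bar>\<xi> - xm 0\<bar> \<le> 1" using x gap_width[OF g, of 0] by simp
    then have "splice_cost xm (\<lambda>_. \<xi>) 0 0 \<le> 4 + L" using cost[of 0 0 "\<lambda>_. \<xi>"] by (auto simp: abs_le_iff)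
    then show "action z (0 - 1) (0 + 1) - action xm (0 - 1) (0 + 1) \<le> 4 + L"
      unfolding z_def by (subst action_splice) (simp_all add: action_empty)
    have "\<forall>i. xm i \<le> z i \<and> z i \<le> xp i" "z 0 = \<xi>"
      using x gap_le[OF g] by (auto simp: z_def splice_def)
    moreover have "((\<lambda>i. h (z i) (z (i + 1)) - h (xm i) (xm (i + 1))) has_sum
        (action z (0 - 1) (0 + 1) - action xm (0 - 1) (0 + 1))) UNIV"
      by (rule finite_perturbation_has_sum) (auto simp: z_def splice_def)
    ultimately show "action z (0 - 1) (0 + 1) - action xm (0 - 1) (0 + 1) \<in> barrier_sums h \<xi> xm xp"
      unfolding barrier_sums_def by blast
  qed
  show "- (4 + L) \<le> S" if "S \<in> barrier_sums h \<xi> xm xp"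
  proof -
    obtain z where z: "\<And>i. xm i \<le> z i \<and> z i \<le> xp i"
      and S: "((\<lambda>i. h (z i) (z (i + 1)) - h (xm i) (xm (i + 1))) has_sum S) UNIV"
      using \<open>S \<in> barrier_sums h \<xi> xm xp\<close> unfolding barrier_sums_def by blast
    have "\<bar>z l - xm l\<bar> \<le> 1" for l using z[of l] gap_width[OF g, of l] by simp
    then have "splice_cost xm z (- int n) (int n) \<le> 4 + L" for n
      using cost[of "- int n" "int n" z] by (auto simp: abs_le_iff)
    moreover have "action xm (- int n) (int n) - splice_cost xm z (- int n) (int n) \<le> action z (- int n) (int n)" for n
      by (rule minimal_splice[OF M_minimal[OF x(1)]]) simp
    ultimately have "- (4 + L) \<le> action z (- int n) (int n) - action xm (- int n) (int n)" for n
      by (smt (verit))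
    then show ?thesis
      by (intro LIMSEQ_le_const[OF action_difference_tendsto[OF S]]) auto
  qed
qed

lemma peierls_barrier_eq:
  assumes g: "gap_configs M \<xi> xm xp" and p: "p \<in> barrier_sums h \<xi> xm xp"
    and min: "\<And>q. q \<in> barrier_sums h \<xi> xm xp \<Longrightarrow> p \<le> q"
  shows "peierls_barrier h M \<xi> = p"
proof -
  have "\<xi> \<notin> proj0 M" using g by (auto simp: gap_configs_def)
  moreover have "(THE p. \<exists>xm xp. gap_configs M \<xi> xm xp \<and>
              p \<in> barrier_sums h \<xi> xm xp \<and> (\<forall>q\<in>barrier_sums h \<xi> xm xp. p \<le> q)) = p"
  proof (rule the_equality)
    show "\<exists>xm xp. gap_configs M \<xi> xm xp \<and>
              p \<in> barrier_sums h \<xi> xm xp \<and> (\<forall>q\<in>barrier_sums h \<xi> xm xp. p \<le> q)"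
      using assms by blast
  next
    fix p' assume "\<exists>xm xp. gap_configs M \<xi> xm xp \<and>
              p' \<in> barrier_sums h \<xi> xm xp \<and> (\<forall>q\<in>barrier_sums h \<xi> xm xp. p' \<le> q)"
    then obtain ym yp where y: "gap_configs M \<xi> ym yp" "p' \<in> barrier_sums h \<xi> ym yp"
      "\<forall>q\<in>barrier_sums h \<xi> ym yp. p' \<le> q" by blast
    have "ym = xm" "yp = xp" using gap_unique[OF g y(1)] by simp_all
    then show "p' = p" using y p min by (meson order_antisym)
  qed
  ultimately show ?thesis by (simp add: peierls_barrier_def)
qed

text \<open>
  The bound covers also heights at which no minimum is attained: there the definite description
  denotes one fixed real number, independent of the family and of \<open>\<xi>\<close>.
\<close>

lemma peierls_barrier_bounded:
  "\<bar>peierls_barrier h M \<xi>\<bar> \<le> 4 + L + \<bar>THE p::real. False\<bar>"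
proof -
  define Q where "Q = (\<lambda>p. \<exists>xm xp. gap_configs M \<xi> xm xp \<and>
              p \<in> barrier_sums h \<xi> xm xp \<and> (\<forall>q\<in>barrier_sums h \<xi> xm xp. p \<le> q))"
  consider "\<xi> \<in> proj0 M" | "\<xi> \<notin> proj0 M" "\<exists>p. Q p" | "\<xi> \<notin> proj0 M" "Q = (\<lambda>_. False)" by blast
  then show ?thesis
  proof cases
    case 1
    then show ?thesis using L_nonneg by (simp add: peierls_barrier_def)
  next
    case 2
    then obtain p xm xp where g: "gap_configs M \<xi> xm xp" and p: "p \<in> barrier_sums h \<xi> xm xp"
      and min: "\<And>q. q \<in> barrier_sums h \<xi> xm xp \<Longrightarrow> p \<le> q" unfolding Q_def by blast
    have "peierls_barrier h M \<xi> = p" by (rule peierls_barrier_eq[OF g p min])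
    moreover have "p \<le> 4 + L" using barrier_sums_bounds(1)[OF g] min by force
    moreover have "- (4 + L) \<le> p" by (rule barrier_sums_bounds(2)[OF g p])
    ultimately show ?thesis
      using abs_ge_zero[of "THE p::real. False"] unfolding abs_le_iff by linarith
  next
    case 3
    then have "peierls_barrier h M \<xi> = (THE p. Q p)" by (simp add: peierls_barrier_def Q_def)
    then show ?thesis using 3 L_nonneg by simp
  qed
qed

end

section \<open>Attainment and comparison of barriers\<close>

context twist_potential
begin

text \<open>
  A gap of minimal configurations around \<open>\<xi>\<close> together with a minimizing competitor. The case in which
  \<open>\<xi>\<close> itself belongs to a minimal configuration is included as the degenerate gap \<open>xm = xp = x\<close> with
  \<open>P = 0\<close>.
\<close>

definition barrier_data :: "real \<Rightarrow> real \<Rightarrow> config \<Rightarrow> config \<Rightarrow> config \<Rightarrow> bool" where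
  "barrier_data \<xi> P xm xp x \<longleftrightarrow>
     minimal xm \<and> minimal xp \<and> unit_steps xm \<and> (\<forall>i. xm i \<le> x i \<and> x i \<le> xp i) \<and> x 0 = \<xi> \<and>
     (\<forall>i. xp i \<le> xm (i + 1)) \<and>
     (\<lambda>n. xp (int n) - xm (int n)) \<longlonglongrightarrow> 0 \<and> (\<lambda>n. xp (- int n) - xm (- int n)) \<longlonglongrightarrow> 0 \<and>
     ((\<lambda>i. h (x i) (x (i + 1)) - h (xm i) (xm (i + 1))) has_sum P) UNIV \<and>
     (\<forall>q\<in>barrier_sums h \<xi> xm xp. P \<le> q)"

text \<open>
  Outside the window the competitor can beat \<open>xm\<close> at most by splice costs: those at \<open>a\<close> and \<open>b\<close>, and
  those at the far ends, which vanish because the gaps shrink to zero.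
\<close>

lemma barrier_data_window_le:
  assumes d: "barrier_data \<xi> P xm xp x" and "a \<le> b"
    and e: "\<bar>x a - xm a\<bar> \<le> e" "\<bar>x b - xm b\<bar> \<le> e" "\<bar>V (x b) - V (xm b)\<bar> \<le> M"
  shows "action x a b - action xm a b \<le> P + (2 * e * (1 + e) + M)"
proof -
  have min: "minimal xm" and b: "unit_steps xm" and between: "\<And>i. xm i \<le> x i \<and> x i \<le> xp i"
    and top: "(\<lambda>n. xp (int n) - xm (int n)) \<longlonglongrightarrow> 0"
    and bot: "(\<lambda>n. xp (- int n) - xm (- int n)) \<longlonglongrightarrow> 0"
    and S: "((\<lambda>i. h (x i) (x (i + 1)) - h (xm i) (xm (i + 1))) has_sum P) UNIV"
    using d by (simp_all add: barrier_data_def)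
  define l where "l = (\<lambda>n. xp (- int n) - xm (- int n))"
  define r where "r = (\<lambda>n. xp (int n) - xm (int n))"
  have near: "\<bar>x i - xm i\<bar> \<le> xp i - xm i" for i using between[of i] by simp
  have D: "(\<lambda>n. action x (- int n) (int n) - action xm (- int n) (int n)) \<longlonglongrightarrow> P"
    by (rule action_difference_tendsto[OF S])
  have E: "(\<lambda>n. (action x a b - action xm a b) - ((l n * (1 + l n) + L * l n + e * (1 + e)) + (e * (1 + e) + M + r n * (1 + r n))))
      \<longlonglongrightarrow> (action x a b - action xm a b) - ((0 + L * 0 + e * (1 + e)) + (e * (1 + e) + M + 0))"
    unfolding l_def r_def by (intro tendsto_diff tendsto_add tendsto_mult_left tendsto_const bounded_factor_tendsto_0 top bot)
  have "(action x a b - action xm a b) - ((l n * (1 + l n) + L * l n + e * (1 + e)) + (e * (1 + e) + M + r n * (1 + r n)))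
      \<le> action x (- int n) (int n) - action xm (- int n) (int n)" if n: "nat (\<bar>a\<bar> + \<bar>b\<bar>) \<le> n" for n
  proof -
    have ord: "- int n \<le> a" "b \<le> int n" "a \<le> int n" using n by (simp_all add: nat_le_iff)
    have split: "action u (- int n) (int n) = action u (- int n) a + action u a b + action u b (int n)" for u
      using ord \<open>a \<le> b\<close> action_split[of "- int n" a "int n" u] action_split[of a b "int n" u] by simp
    have "\<bar>V (x (- int n)) - V (xm (- int n))\<bar> \<le> L * l n"
      using order_trans[OF V_lipschitz mult_left_mono[OF near L_nonneg]] by (simp add: l_def)
    then have "\<bar>splice_cost xm x (- int n) a\<bar> \<le> l n * (1 + l n) + L * l n + e * (1 + e)"
      using near[of "- int n"] e(1) by (intro splice_cost_le unit_steps_abs[OF b]) (simp_all add: l_def)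
    moreover have "\<bar>splice_cost xm x b (int n)\<bar> \<le> e * (1 + e) + M + r n * (1 + r n)"
      using near[of "int n"] e by (intro splice_cost_le unit_steps_abs[OF b]) (simp_all add: r_def)
    moreover have "action xm (- int n) a - splice_cost xm x (- int n) a \<le> action x (- int n) a"
      "action xm b (int n) - splice_cost xm x b (int n) \<le> action x b (int n)"
      by (rule minimal_splice[OF min ord(1)], rule minimal_splice[OF min ord(2)])
    ultimately show ?thesis unfolding split by linarith
  qed
  then have "(action x a b - action xm a b) - ((0 + L * 0 + e * (1 + e)) + (e * (1 + e) + M + 0)) \<le> P"
    by (intro LIMSEQ_le[OF E D] exI[of _ "nat (\<bar>a\<bar> + \<bar>b\<bar>)"] allI impI)
  then show ?thesis by simp
qed

text \<open>
  Follow \<open>xm\<close> outside the window and \<open>z\<close> inside. The result may leave the gap; clamping it with \<open>xp\<close>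
  and \<open>xm\<close> does not raise the action, since the other halves of the two submodular splittings compete
  with \<open>xp\<close> and \<open>xm\<close> themselves.
\<close>

lemma barrier_data_le_competitor:
  assumes d: "barrier_data \<xi> P xm xp x" and ab: "a \<le> 0" "0 \<le> b" and z: "z 0 = \<xi>"
  shows "P \<le> action z a b - action xm a b + splice_cost xm z a b"
proof -
  have min: "minimal xm" "minimal xp" and between: "\<And>i. xm i \<le> x i \<and> x i \<le> xp i" and "x 0 = \<xi>"
    and P: "\<forall>q\<in>barrier_sums h \<xi> xm xp. P \<le> q"
    using d by (simp_all add: barrier_data_def)
  have le: "xm i \<le> xp i" for i using between[of i] by simp
  define w where "w = splice xm z a b"
  define u where "u = (\<lambda>l. min (w l) (xp l))"
  define c where "c = (\<lambda>l. max (u l) (xm l))"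
  have out: "w l = xm l" if "l \<le> a - 1 \<or> b + 1 \<le> l" for l using that by (auto simp: w_def splice_def)
  then have out_u: "u l = xm l" if "l \<le> a - 1 \<or> b + 1 \<le> l" for l
    using that le[of l] by (auto simp: u_def)
  then have out_c: "c l = xm l" if "l \<le> a - 1 \<or> b + 1 \<le> l" for l
    using that by (auto simp: c_def)
  have "action xp (a - 1) (b + 1) \<le> action (\<lambda>l. max (w l) (xp l)) (a - 1) (b + 1)"
    by (rule minimalD[OF min(2)]) (simp_all add: out le max_absorb2)
  then have 1: "action u (a - 1) (b + 1) \<le> action w (a - 1) (b + 1)"
    using action_submodular[of w xp "a - 1" "b + 1"] unfolding u_def by linarith
  have "action xm (a - 1) (b + 1) \<le> action (\<lambda>l. min (u l) (xm l)) (a - 1) (b + 1)"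
    by (rule minimalD[OF min(1)]) (simp_all add: out_u)
  then have 2: "action c (a - 1) (b + 1) \<le> action u (a - 1) (b + 1)"
    using action_submodular[of u xm "a - 1" "b + 1"] unfolding c_def by linarith
  have "c 0 = \<xi>" using ab z between[of 0] \<open>x 0 = \<xi>\<close> by (auto simp: c_def u_def w_def splice_def)
  moreover have "xm i \<le> c i \<and> c i \<le> xp i" for i using le[of i] by (auto simp: c_def u_def)
  moreover have "((\<lambda>i. h (c i) (c (i + 1)) - h (xm i) (xm (i + 1))) has_sum
      (action c (a - 1) (b + 1) - action xm (a - 1) (b + 1))) UNIV"
    by (rule finite_perturbation_has_sum) (use ab out_c in auto)
  ultimately have "action c (a - 1) (b + 1) - action xm (a - 1) (b + 1) \<in> barrier_sums h \<xi> xm xp"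
    unfolding barrier_sums_def by blast
  then have "P \<le> action c (a - 1) (b + 1) - action xm (a - 1) (b + 1)" using P by blast
  moreover have "action w (a - 1) (b + 1) - action xm (a - 1) (b + 1) = action z a b - action xm a b + splice_cost xm z a b"
    unfolding w_def by (rule action_splice) (use ab in simp)
  ultimately show ?thesis using 1 2 by linarith
qed

text \<open>
  The competitor \<open>y\<close> of the second problem is used in the first; the reference actions of \<open>xm\<close> and \<open>ym\<close>
  in the window are compared through minimality.
\<close>

lemma barrier_difference_le:
  assumes x: "barrier_data \<xi> P xm xp x" and y: "barrier_data \<xi> Q ym yp y"
    and ab: "a \<le> 0" "0 \<le> b"
    and near: "\<And>u v i. u \<in> {xm, ym, y} \<Longrightarrow> v \<in> {xm, ym, y} \<Longrightarrow> i \<in> {a, b} \<Longrightarrow> \<bar>u i - v i\<bar> \<le> e \<and> \<bar>V (u i) - V (v i)\<bar> \<le> M"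
  shows "P - Q \<le> 3 * (2 * e * (1 + e) + M)"
proof -
  have min: "minimal ym" and b: "unit_steps xm" "unit_steps ym" and "y 0 = \<xi>"
    using x y by (simp_all add: barrier_data_def)
  have "a \<le> b" using ab by simp
  have "P \<le> action y a b - action xm a b + splice_cost xm y a b"
    by (rule barrier_data_le_competitor[OF x ab]) (rule \<open>y 0 = \<xi>\<close>)
  moreover have "action y a b - action ym a b \<le> Q + (2 * e * (1 + e) + M)"
    using near by (intro barrier_data_window_le[OF y \<open>a \<le> b\<close>]) auto
  moreover have "action ym a b - splice_cost ym xm a b \<le> action xm a b"
    by (rule minimal_splice[OF min \<open>a \<le> b\<close>])
  moreover have "\<bar>splice_cost xm y a b\<bar> \<le> e * (1 + e) + M + e * (1 + e)"
    using near by (intro splice_cost_le unit_steps_abs[OF b(1)]) auto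
  moreover have "\<bar>splice_cost ym xm a b\<bar> \<le> e * (1 + e) + M + e * (1 + e)"
    using near by (intro splice_cost_le unit_steps_abs[OF b(2)]) auto
  ultimately show ?thesis by (simp add: abs_le_iff)
qed

theorem barrier_comparison:
  assumes x: "barrier_data \<xi> P xm xp x" and y: "barrier_data \<xi> Q ym yp y"
    and ab: "a \<le> 0" "0 \<le> b"
    and a: "\<And>u. u \<in> {xm, xp, ym, yp} \<Longrightarrow> \<bar>u a - c\<bar> \<le> \<epsilon>"
    and b: "\<And>u. u \<in> {xm, xp, ym, yp} \<Longrightarrow> \<bar>u b - d\<bar> \<le> \<epsilon>"
    and V: "\<And>t. \<bar>t - c\<bar> \<le> \<epsilon> \<or> \<bar>t - d\<bar> \<le> \<epsilon> \<Longrightarrow> V t \<le> M"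
  shows "\<bar>P - Q\<bar> \<le> 3 * (4 * \<epsilon> * (1 + 2 * \<epsilon>) + M)"
proof -
  have between: "\<And>i. xm i \<le> x i \<and> x i \<le> xp i" "\<And>i. ym i \<le> y i \<and> y i \<le> yp i"
    using x y by (simp_all add: barrier_data_def)
  have ends: "\<bar>xm a - c\<bar> \<le> \<epsilon>" "\<bar>xp a - c\<bar> \<le> \<epsilon>" "\<bar>ym a - c\<bar> \<le> \<epsilon>" "\<bar>yp a - c\<bar> \<le> \<epsilon>"
    "\<bar>xm b - d\<bar> \<le> \<epsilon>" "\<bar>xp b - d\<bar> \<le> \<epsilon>" "\<bar>ym b - d\<bar> \<le> \<epsilon>" "\<bar>yp b - d\<bar> \<le> \<epsilon>"
    by (intro a b; simp)+
  have "\<bar>x a - c\<bar> \<le> \<epsilon>" using between(1)[of a] ends(1,2) by linarith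
  moreover have "\<bar>y a - c\<bar> \<le> \<epsilon>" using between(2)[of a] ends(3,4) by linarith
  ultimately have a': "\<bar>u a - c\<bar> \<le> \<epsilon>" if "u \<in> {xm, x, ym, y}" for u
    using that ends(1,3) by blast
  have "\<bar>x b - d\<bar> \<le> \<epsilon>" using between(1)[of b] ends(5,6) by linarith
  moreover have "\<bar>y b - d\<bar> \<le> \<epsilon>" using between(2)[of b] ends(7,8) by linarith
  ultimately have b': "\<bar>u b - d\<bar> \<le> \<epsilon>" if "u \<in> {xm, x, ym, y}" for u
    using that ends(5,7) by blast
  have near: "\<bar>u i - v i\<bar> \<le> 2 * \<epsilon> \<and> \<bar>V (u i) - V (v i)\<bar> \<le> M"
    if "u \<in> {xm, x, ym, y}" "v \<in> {xm, x, ym, y}" "i \<in> {a, b}" for u v i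
  proof -
    have *: "(\<bar>u i - c\<bar> \<le> \<epsilon> \<and> \<bar>v i - c\<bar> \<le> \<epsilon>) \<or> (\<bar>u i - d\<bar> \<le> \<epsilon> \<and> \<bar>v i - d\<bar> \<le> \<epsilon>)"
      using that(3) a'[OF that(1)] a'[OF that(2)] b'[OF that(1)] b'[OF that(2)] by auto
    then have "\<bar>u i - v i\<bar> \<le> 2 * \<epsilon>" by linarith
    moreover have "V (u i) \<le> M" "V (v i) \<le> M" using * by (intro V; blast)+
    ultimately show ?thesis using V_nonneg[of "u i"] V_nonneg[of "v i"] by linarith
  qed
  have "P - Q \<le> 3 * (2 * (2 * \<epsilon>) * (1 + 2 * \<epsilon>) + M)"
    by (rule barrier_difference_le[OF x y ab]) (use near in auto)
  moreover have "Q - P \<le> 3 * (2 * (2 * \<epsilon>) * (1 + 2 * \<epsilon>) + M)"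
    by (rule barrier_difference_le[OF y x ab]) (use near in auto)
  ultimately show ?thesis by (simp add: abs_le_iff)
qed

end

context ordered_family
begin

lemma bond_difference_bound:
  assumes g: "gap_configs M \<xi> xm xp" and x: "\<And>i. xm i \<le> x i \<and> x i \<le> xp i"
  shows "\<bar>h (x i) (x (i + 1)) - h (xm i) (xm (i + 1))\<bar> \<le> (2 + L) * ((xp i - xm i) + (xp (i + 1) - xm (i + 1)))"
proof -
  have xm: "xm \<in> M" using g by (simp add: gap_configs_def)
  define D where "D = (x i - xm i) - (x (i + 1) - xm (i + 1))"
  define s where "s = xm i - xm (i + 1)"
  have s: "\<bar>s\<bar> \<le> 1" unfolding s_def by (rule unit_steps_abs[OF M_unit_steps[OF xm]])
  have w: "xp j \<le> xm j + 1" for j by (rule gap_width[OF g])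
  have D: "\<bar>D\<bar> \<le> (xp i - xm i) + (xp (i + 1) - xm (i + 1))" "\<bar>D\<bar> \<le> 1"
    using x[of i] x[of "i + 1"] w[of i] w[of "i + 1"] by (auto simp: D_def)
  have eq: "(x i - x (i + 1))\<^sup>2 / 2 - (xm i - xm (i + 1))\<^sup>2 / 2 = D * (D / 2 + s)"
    by (simp add: D_def s_def power2_eq_square field_simps)
  have "\<bar>D / 2 + s\<bar> \<le> 2" using D(2) s by linarith
  then have 1: "\<bar>D * (D / 2 + s)\<bar> \<le> ((xp i - xm i) + (xp (i + 1) - xm (i + 1))) * 2"
    unfolding abs_mult using D(1) by (intro mult_mono) auto
  have "\<bar>V (x (i + 1)) - V (xm (i + 1))\<bar> \<le> L * \<bar>x (i + 1) - xm (i + 1)\<bar>" by (rule V_lipschitz)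
  also have "\<dots> \<le> L * ((xp i - xm i) + (xp (i + 1) - xm (i + 1)))"
    using x[of i] x[of "i + 1"] L_nonneg by (intro mult_left_mono) auto
  finally have 2: "\<bar>V (x (i + 1)) - V (xm (i + 1))\<bar> \<le> L * ((xp i - xm i) + (xp (i + 1) - xm (i + 1)))" .
  have "h (x i) (x (i + 1)) - h (xm i) (xm (i + 1)) = D * (D / 2 + s) + (V (x (i + 1)) - V (xm (i + 1)))"
    unfolding eq[symmetric] by (simp add: h_def)
  then have "\<bar>h (x i) (x (i + 1)) - h (xm i) (xm (i + 1))\<bar> \<le> \<bar>D * (D / 2 + s)\<bar> + \<bar>V (x (i + 1)) - V (xm (i + 1))\<bar>"
    by simp
  also have "\<dots> \<le> (2 + L) * ((xp i - xm i) + (xp (i + 1) - xm (i + 1)))"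
    unfolding distrib_right[of 2 L] using 1 2 by linarith
  finally show ?thesis .
qed

text \<open>
  Summable gaps dominate the bond differences uniformly, so the sum is a continuous function on the
  compact product of the intervals of the gap.
\<close>

theorem barrier_minimum_attained:
  assumes g: "gap_configs M \<xi> xm xp" and sum: "\<And>F. finite F \<Longrightarrow> (\<Sum>i\<in>F. xp i - xm i) \<le> C"
  shows "\<exists>x. (\<forall>i. xm i \<le> x i \<and> x i \<le> xp i) \<and> x 0 = \<xi> \<and>
     ((\<lambda>i. h (x i) (x (i + 1)) - h (xm i) (xm (i + 1))) has_sum peierls_barrier h M \<xi>) UNIV \<and>
     (\<forall>q\<in>barrier_sums h \<xi> xm xp. peierls_barrier h M \<xi> \<le> q)"
proof -
  define t where "t = (\<lambda>x i. h (x i) (x (i + 1)) - h (xm i) (xm (i + 1)))"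
  define B where "B = (\<lambda>i. (2 + L) * ((xp i - xm i) + (xp (i + 1) - xm (i + 1))))"
  define K where "K = {x :: config. \<forall>i. (xm(0 := \<xi>)) i \<le> x i \<and> x i \<le> (xp(0 := \<xi>)) i}"
  have ends: "xm 0 < \<xi>" "\<xi> < xp 0" using g by (simp_all add: gap_configs_def)
  have K_iff: "x \<in> K \<longleftrightarrow> (\<forall>i. xm i \<le> x i \<and> x i \<le> xp i) \<and> x 0 = \<xi>" for x
  proof
    assume "x \<in> K"
    then have *: "(xm(0 := \<xi>)) i \<le> x i" "x i \<le> (xp(0 := \<xi>)) i" for i by (simp_all add: K_def)
    have "x 0 = \<xi>" using *[of 0] by simp
    moreover have "xm i \<le> x i \<and> x i \<le> xp i" for i
      using *[of i] ends \<open>x 0 = \<xi>\<close> by (cases "i = 0") simp_all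
    ultimately show "(\<forall>i. xm i \<le> x i \<and> x i \<le> xp i) \<and> x 0 = \<xi>" by simp
  qed (simp add: K_def)
  have tB: "\<bar>t x i\<bar> \<le> B i" if "x \<in> K" for x i
    unfolding t_def B_def by (rule bond_difference_bound[OF g]) (use that K_iff in blast)
  have B_nonneg: "0 \<le> B i" for i
    using gap_le[OF g, of i] gap_le[OF g, of "i + 1"] L_nonneg by (simp add: B_def)
  have B_sum: "sum B F \<le> (2 + L) * (C + C)" if "finite F" for F
  proof -
    have "(\<Sum>i\<in>F. xp (i + 1) - xm (i + 1)) = (\<Sum>i\<in>(\<lambda>i. i + 1) ` F. xp i - xm i)"
      by (subst sum.reindex) (auto simp: inj_on_def)
    then have "(\<Sum>i\<in>F. xp (i + 1) - xm (i + 1)) \<le> C" using sum that by simp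
    then have "(\<Sum>i\<in>F. (xp i - xm i) + (xp (i + 1) - xm (i + 1))) \<le> C + C"
      using sum[OF that] by (simp only: sum.distrib)
    then show ?thesis
      unfolding B_def sum_distrib_left[symmetric] using L_nonneg by (intro mult_left_mono) auto
  qed
  have B_summable: "B summable_on UNIV"
    by (rule nonneg_bdd_above_summable_on)
       (use B_nonneg B_sum in \<open>auto intro!: bdd_aboveI[of _ "(2 + L) * (C + C)"]\<close>)
  \<comment> \<open>Pairing the indices \<open>n\<close> and \<open>- n - 1\<close> makes the two-sided sum an ordinary series.\<close>
  define f where "f = (\<lambda>n x. t x (int n) + t x (- int n - 1))"
  have summable_B: "summable (\<lambda>n. B (int n) + B (- int n - 1))"
  proof (rule summableI_nonneg_bounded)
    show "(\<Sum>n<N. B (int n) + B (- int n - 1)) \<le> (2 + L) * (C + C)" for N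
      unfolding sum_symmetric_interval by (rule B_sum) simp
  qed (simp add: B_nonneg)
  have f_bound: "norm (f n x) \<le> B (int n) + B (- int n - 1)" if "x \<in> K" for n x
    using tB[OF that, of "int n"] tB[OF that, of "- int n - 1"] by (auto simp: f_def)
  have unif: "uniform_limit K (\<lambda>N x. \<Sum>n<N. f n x) (\<lambda>x. \<Sum>n. f n x) sequentially"
    by (rule Weierstrass_m_test[OF f_bound summable_B])
  have partial: "(\<Sum>n<N. f n x) = action x (- int N) (int N) - action xm (- int N) (int N)" for N x
    unfolding f_def sum_symmetric_interval by (simp add: t_def action_def sum_subtractf)
  have "continuous_on K (\<lambda>x. \<Sum>n. f n x)"
    by (rule uniform_limit_theorem[OF _ unif])
       (auto simp: partial intro!: always_eventually continuous_intros continuous_on_action)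
  moreover have "compact K" unfolding K_def by (rule config_box_compact)
  moreover have "xm(0 := \<xi>) \<in> K" using ends gap_le[OF g] by (auto simp: K_iff)
  ultimately obtain x where x: "x \<in> K" and inf: "\<And>y. y \<in> K \<Longrightarrow> (\<Sum>n. f n x) \<le> (\<Sum>n. f n y)"
    using continuous_attains_inf[of K "\<lambda>x. \<Sum>n. f n x"] by blast
  have has_sum: "(t y has_sum (\<Sum>n. f n y)) UNIV" if y: "y \<in> K" for y
  proof -
    have "(\<lambda>i. norm (t y i)) summable_on UNIV"
      by (rule summable_on_comparison_test[OF B_summable]) (use tB[OF y] in auto)
    then have "t y summable_on UNIV" by (rule abs_summable_summable)
    then have S: "(t y has_sum infsum (t y) UNIV) UNIV" by (rule has_sum_infsum)
    have "(\<lambda>N. \<Sum>n<N. f n y) \<longlonglongrightarrow> infsum (t y) UNIV"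
      unfolding f_def sum_symmetric_interval by (rule has_sum_int_tendsto[OF S])
    then have "(\<lambda>n. f n y) sums infsum (t y) UNIV" by (simp add: sums_def)
    then have "infsum (t y) UNIV = (\<Sum>n. f n y)" by (rule sums_unique)
    then show ?thesis using S by simp
  qed
  have in_sums: "S \<in> barrier_sums h \<xi> xm xp \<longleftrightarrow> (\<exists>y\<in>K. (t y has_sum S) UNIV)" for S
    unfolding barrier_sums_def mem_Collect_eq Bex_def K_iff t_def conj_assoc ..
  have least: "(\<Sum>n. f n x) \<le> q" if "q \<in> barrier_sums h \<xi> xm xp" for q
  proof -
    have "\<exists>y\<in>K. (t y has_sum q) UNIV" using that by (simp only: in_sums)
    then obtain y where "y \<in> K" and q: "(t y has_sum q) UNIV" by (rule bexE)
    have "q = (\<Sum>n. f n y)" by (rule has_sum_unique[OF q has_sum[OF \<open>y \<in> K\<close>]])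
    then show ?thesis using inf[OF \<open>y \<in> K\<close>] by simp
  qed
  have "(\<Sum>n. f n x) \<in> barrier_sums h \<xi> xm xp"
    unfolding in_sums by (rule bexI[of _ x]) (rule has_sum[OF x], rule x)
  then have "peierls_barrier h M \<xi> = (\<Sum>n. f n x)" by (rule peierls_barrier_eq[OF g _ least])
  then have "((\<lambda>i. h (x i) (x (i + 1)) - h (xm i) (xm (i + 1))) has_sum peierls_barrier h M \<xi>) UNIV"
    "\<forall>q\<in>barrier_sums h \<xi> xm xp. peierls_barrier h M \<xi> \<le> q"
    using has_sum[OF x] least by (simp_all add: t_def)
  then show ?thesis using x unfolding K_iff by (intro exI[of _ x]) simp
qed

theorem barrier_data_exists:
  assumes sum: "\<And>xm xp. gap_configs M \<xi> xm xp \<Longrightarrow> \<exists>C. \<forall>F. finite F \<longrightarrow> (\<Sum>i\<in>F. xp i - xm i) \<le> C"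
    and next_gap: "\<And>xm xp i. gap_configs M \<xi> xm xp \<Longrightarrow> xp i \<le> xm (i + 1)"
  shows "\<exists>xm xp x. xm \<in> M \<and> xp \<in> M \<and> barrier_data \<xi> (peierls_barrier h M \<xi>) xm xp x"
proof (cases "\<xi> \<in> proj0 M")
  case True
  then obtain x where x: "x \<in> M" "x 0 = \<xi>" by (auto simp: proj0_def)
  have "peierls_barrier h M \<xi> = 0" using True by (simp add: peierls_barrier_def)
  moreover have "0 \<le> q" if "q \<in> barrier_sums h \<xi> x x" for q
  proof -
    have "\<exists>y :: config. (\<forall>i. x i \<le> y i \<and> y i \<le> x i) \<and> y 0 = \<xi> \<and>
        ((\<lambda>i. h (y i) (y (i + 1)) - h (x i) (x (i + 1))) has_sum q) UNIV"
      using that unfolding barrier_sums_def by simp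
    then obtain y :: config where y: "\<forall>i. x i \<le> y i \<and> y i \<le> x i"
      and S: "((\<lambda>i. h (y i) (y (i + 1)) - h (x i) (x (i + 1))) has_sum q) UNIV"
      by (elim exE conjE)
    have "y = x" by (rule ext, rule antisym) (simp_all add: y)
    then have "((\<lambda>i::int. 0::real) has_sum q) UNIV" using S by simp
    moreover have "((\<lambda>i::int. 0::real) has_sum 0) UNIV" by (rule has_sum_0) simp
    ultimately have "q = 0" by (rule has_sum_unique)
    then show ?thesis by simp
  qed
  moreover have "unit_steps x" by (rule M_unit_steps[OF x(1)])
  ultimately have "barrier_data \<xi> (peierls_barrier h M \<xi>) x x x"
    using x M_minimal[OF x(1)] by (auto simp: barrier_data_def unit_steps_def intro!: has_sum_0)
  then show ?thesis using x(1) by (intro exI conjI)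
next
  case False
  then obtain xm xp where g: "gap_configs M \<xi> xm xp" by (rule gap_exists)
  obtain C where C: "\<And>F. finite F \<Longrightarrow> (\<Sum>i\<in>F. xp i - xm i) \<le> C" using sum[OF g] by blast
  obtain x where x: "(\<forall>i. xm i \<le> x i \<and> x i \<le> xp i) \<and> x 0 = \<xi> \<and>
     ((\<lambda>i. h (x i) (x (i + 1)) - h (xm i) (xm (i + 1))) has_sum peierls_barrier h M \<xi>) UNIV \<and>
     (\<forall>q\<in>barrier_sums h \<xi> xm xp. peierls_barrier h M \<xi> \<le> q)"
    using barrier_minimum_attained[OF g C] by (rule exE)
  have M: "xm \<in> M" "xp \<in> M" using g by (simp_all add: gap_configs_def)
  have nn: "0 \<le> xp i - xm i" for i using gap_le[OF g] by simp
  have "(\<lambda>n. xp (int n) - xm (int n)) \<longlonglongrightarrow> 0" "(\<lambda>n. xp (- int n) - xm (- int n)) \<longlonglongrightarrow> 0"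
    by (rule bounded_sums_tendsto_0[of "\<lambda>i. xp i - xm i", OF nn C]; simp add: inj_on_def)+
  then have "barrier_data \<xi> (peierls_barrier h M \<xi>) xm xp x"
    unfolding barrier_data_def using M_minimal[OF M(1)] M_minimal[OF M(2)] M_unit_steps[OF M(1)] x next_gap[OF g]
    by simp
  then show ?thesis using M by (intro exI conjI)
qed

end

section \<open>The two families of minimal configurations\<close>

context ordered_family
begin

text \<open>
  A translate that starts above the lower end of the gap cannot start inside it.
\<close>

lemma gap_below_translate:
  assumes g: "gap_configs M \<xi> xm xp" and above: "xm 0 < xm q - of_int p"
  shows "xp i + of_int p \<le> xm (i + q)"
proof -
  have x: "xm \<in> M" "xp \<in> M" using g by (simp_all add: gap_configs_def)
  have tr: "(\<lambda>i. xm (i + q) + of_int (- p)) \<in> M" by (rule M_translate[OF x(1)])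
  have "xp 0 \<le> xm (0 + q) + of_int (- p)" using gap_avoids[OF g tr] above by simp
  then show ?thesis using M_le[OF x(2) tr, of i] by simp
qed

end

lemma crossing_index:
  fixes x :: config
  assumes "x a \<le> c" "c < x b" "a \<le> b" shows "\<exists>i. x i \<le> c \<and> c < x (i + 1)"
proof (rule ccontr)
  assume *: "\<nexists>i. x i \<le> c \<and> c < x (i + 1)"
  have "x i \<le> c" if "a \<le> i" for i
    using that
  proof (induction i rule: int_ge_induct)
    case base show ?case by (rule assms(1))
  next
    case (step i) then show ?case using *[unfolded not_ex, rule_format, of i] by simp
  qed
  then show False using assms(2,3) by force
qed

context twist_potential
begin

lemma Birkhoff_not_periodic_below:
  assumes x: "x \<in> Birkhoff \<omega>" and less: "of_int p < of_int q * \<omega>"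
    and eq: "\<And>i. x (i + q) = x i + of_int p"
  shows False
proof -
  have it: "x (int m * q) = x 0 + real m * of_int p" for m
    using periodic_multiple[of x q p 0 m] eq by (simp add: periodic_def)
  have "real m * (of_int q * \<omega> - of_int p) \<le> 1" for m
    using Birkhoff_deviation[OF x, of 0 "int m * q"] it[of m] by (simp add: abs_le_iff algebra_simps)
  then have "of_int q * \<omega> - of_int p \<le> 0" by (rule nat_multiples_bounded_imp_nonpos)
  then show False using less by simp
qed

lemma Birkhoff_ordered_family:
  assumes irr: "\<omega> \<notin> \<rat>" and "0 < \<omega>" "\<omega> < 1"
  shows "ordered_family V L (Birkhoff \<omega>)"
proof unfold_locales
  show "minimal x" if "x \<in> Birkhoff \<omega>" for x by (rule BirkhoffD(1)[OF that])
  show "unit_steps x" if "x \<in> Birkhoff \<omega>" for x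
    unfolding unit_steps_def using Birkhoff_step[OF that assms(2,3)] by simp
  show "(\<lambda>i. x (i + q) + of_int p) \<in> Birkhoff \<omega>" if "x \<in> Birkhoff \<omega>" for x q p
    by (rule Birkhoff_translate[OF that])
  show "(\<forall>i. x i \<le> y i) \<or> (\<forall>i. y i \<le> x i)" if "x \<in> Birkhoff \<omega>" "y \<in> Birkhoff \<omega>" for x y
    by (rule Birkhoff_comparable[OF irr that])
  show "x \<in> Birkhoff \<omega>" if "\<And>n. X n \<in> Birkhoff \<omega>" "\<And>i. (\<lambda>n. X n i) \<longlonglongrightarrow> x i" for X x
    by (rule Birkhoff_limit[OF that(1) tendsto_const that(2)])
  show "Birkhoff \<omega> \<noteq> {}" using Birkhoff_nonempty by blast
qed

text \<open>
  All translates of a gap are disjoint: a Birkhoff configuration of irrational rotation number is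
  different from each of its nontrivial translates.
\<close>

lemma Birkhoff_gap_translate:
  assumes irr: "\<omega> \<notin> \<rat>" and \<omega>: "0 < \<omega>" "\<omega> < 1"
    and g: "gap_configs (Birkhoff \<omega>) \<xi> xm xp" and less: "of_int p < of_int q * \<omega>"
  shows "xp i + of_int p \<le> xm (i + q)"
proof -
  interpret ordered_family V L "Birkhoff \<omega>" by (rule Birkhoff_ordered_family[OF irr \<omega>])
  have x: "xm \<in> Birkhoff \<omega>" using g by (simp add: gap_configs_def)
  have "xm 0 \<noteq> xm q - of_int p"
  proof
    assume eq: "xm 0 = xm q - of_int p"
    have "xm = (\<lambda>i. xm (i + q) + of_int (- p))"
      by (rule M_eq[OF x M_translate[OF x]]) (simp add: eq)
    then have "xm i = xm (i + q) + of_int (- p)" for i by (rule fun_cong)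
    then have "xm (i + q) = xm i + of_int p" for i by (simp add: algebra_simps)
    then show False by (rule Birkhoff_not_periodic_below[OF x less])
  qed
  moreover have "xm 0 + of_int p \<le> xm (0 + q)" by (rule BirkhoffD(3)[OF x less])
  ultimately show ?thesis by (intro gap_below_translate[OF g]) simp
qed

theorem Birkhoff_barrier_data:
  assumes irr: "\<omega> \<notin> \<rat>" and \<omega>: "0 < \<omega>" "\<omega> < 1"
  shows "\<exists>xm xp x. xm \<in> Birkhoff \<omega> \<and> xp \<in> Birkhoff \<omega> \<and>
    barrier_data \<xi> (peierls_barrier h (Birkhoff \<omega>) \<xi>) xm xp x"
proof -
  interpret ordered_family V L "Birkhoff \<omega>" by (rule Birkhoff_ordered_family[OF irr \<omega>])
  show ?thesis
  proof (rule barrier_data_exists)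
    fix xm xp assume g: "gap_configs (Birkhoff \<omega>) \<xi> xm xp"
    show "\<exists>C. \<forall>F. finite F \<longrightarrow> (\<Sum>i\<in>F. xp i - xm i) \<le> C"
    proof (intro exI[of _ 1] allI impI)
      fix F :: "int set" assume "finite F"
      then show "(\<Sum>i\<in>F. xp i - xm i) \<le> 1"
        by (rule rotated_intervals_sum_le_1[OF irr, rotated]) (rule Birkhoff_gap_translate[OF irr \<omega> g])
    qed
    show "xp i \<le> xm (i + 1)" for i
      using Birkhoff_gap_translate[OF irr \<omega> g, of 0 1 i] \<omega>(1) by simp
  qed
qed

lemma M_0plus_ordered_family: "ordered_family V L (M_0plus h)"
proof unfold_locales
  show "minimal x" if "x \<in> M_0plus h" for x using that by (simp add: M_0plus_iff)
  show "unit_steps x" if "x \<in> M_0plus h" for x using that by (simp add: M_0plus_iff unit_steps_def)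
  show "(\<lambda>i. x (i + q) + of_int p) \<in> M_0plus h" if "x \<in> M_0plus h" for x q p
  proof -
    have "x (i + q) \<le> x (i + 1 + q)" for i
      using that by (metis M_0plus_iff add.commute add.left_commute)
    then show ?thesis using that minimal_translate[of x q p] by (simp add: M_0plus_iff)
  qed
  show "(\<forall>i. x i \<le> y i) \<or> (\<forall>i. y i \<le> x i)" if "x \<in> M_0plus h" "y \<in> M_0plus h" for x y
    by (rule M_0plus_comparable[OF that])
  show "x \<in> M_0plus h" if X: "\<And>n. X n \<in> M_0plus h" and lim: "\<And>i. (\<lambda>n. X n i) \<longlonglongrightarrow> x i" for X x
  proof -
    have "minimal x" by (rule minimal_limit[OF _ lim]) (use X in \<open>simp add: M_0plus_iff\<close>)
    moreover have "x i \<le> x (i + 1)" for i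
      by (rule LIMSEQ_le[OF lim lim]) (use X in \<open>simp add: M_0plus_iff\<close>)
    moreover have "x i \<le> x j + 1" for i j
      by (rule LIMSEQ_le[OF lim tendsto_add[OF lim tendsto_const]]) (use X in \<open>simp add: M_0plus_iff\<close>)
    ultimately show ?thesis by (simp add: M_0plus_iff)
  qed
  obtain z where "z \<in> minima" using minima_nonempty by blast
  then have "(\<lambda>_. z) \<in> M_0plus h" by (simp add: M_0plus_iff constant_minimal_iff)
  then show "M_0plus h \<noteq> {}" by blast
qed

text \<open>
  Birkhoff configurations of rotation number \<open>1 / n\<close>, shifted so that they pass the level \<open>c\<close> at index 0,
  converge to one of symbol 0 or 0+.
\<close>

lemma M_0plus_through_level:
  obtains y where "y \<in> M_0plus h" "y 0 \<le> c" "c \<le> y 1"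
proof -
  define w where "w = (\<lambda>n. 1 / real (n + 2))"
  have w: "0 < w n" "w n < 1" for n by (simp_all add: w_def)
  have "\<exists>y. y \<in> Birkhoff (w n) \<and> y 0 \<le> c \<and> c < y 1" for n
  proof -
    obtain x where x: "x \<in> Birkhoff (w n)" using Birkhoff_nonempty by blast
    have dev: "\<bar>x i - x 0 - of_int i * w n\<bar> \<le> 1" for i
      using Birkhoff_deviation[OF x, of 0 i] by simp
    obtain m :: nat where m: "\<bar>c - x 0\<bar> + 2 < real m * w n"
      using reals_Archimedean3[OF w(1)[of n]] by blast
    have "x (- int m) \<le> c" "c < x (int m)"
      using dev[of "- int m"] dev[of "int m"] m by (auto simp: abs_le_iff)
    then obtain i where i: "x i \<le> c" "c < x (i + 1)"
      using crossing_index[of x "- int m" c "int m"] by auto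
    have "(\<lambda>j. x (j + i) + of_int 0) \<in> Birkhoff (w n)" by (rule Birkhoff_translate[OF x])
    then show ?thesis using i by (intro exI[of _ "\<lambda>j. x (j + i) + of_int 0"]) (simp add: add.commute)
  qed
  then obtain Y where Y: "\<And>n. Y n \<in> Birkhoff (w n)" "\<And>n. Y n 0 \<le> c" "\<And>n. c < Y n 1" by metis
  have step: "Y n i \<le> Y n (i + 1)" "Y n (i + 1) \<le> Y n i + 1" for n i
    by (rule Birkhoff_step[OF Y(1) w])+
  have "\<bar>Y n 0\<bar> \<le> \<bar>c\<bar> + 1" for n
    using Y(2,3)[of n] step(2)[of n 0] by (simp add: abs_le_iff) linarith
  moreover have lim_w: "w \<longlonglongrightarrow> 0"
    unfolding w_def using LIMSEQ_ignore_initial_segment[OF lim_1_over_n, of 2] by simp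
  ultimately obtain y r where r: "strict_mono (r :: nat \<Rightarrow> nat)" and y: "y \<in> Birkhoff 0"
    and lim: "\<And>i. (\<lambda>n. Y (r n) i) \<longlonglongrightarrow> y i"
    using Birkhoff_convergent_subsequence[of Y w 0 "\<bar>c\<bar> + 1", OF Y(1)] by metis
  have "y i \<le> y (i + 1)" for i by (rule LIMSEQ_le[OF lim lim]) (use step in auto)
  moreover have "y i \<le> y j + 1" for i j using BirkhoffD(2)[OF y, of "i - j" 1 j] by simp
  ultimately have "y \<in> M_0plus h" using BirkhoffD(1)[OF y] by (simp add: M_0plus_iff)
  moreover have "y 0 \<le> c" by (rule LIMSEQ_le_const2[OF lim]) (use Y(2) in auto)
  moreover have "c \<le> y 1" by (rule LIMSEQ_le_const[OF lim]) (use Y(3) less_imp_le in blast)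
  ultimately show ?thesis by (rule that)
qed

text \<open>
  The configuration through the level 1/2 cannot be constant, so it joins 0 to 1; its distant past
  comes arbitrarily close to 0.
\<close>

lemma M_0plus_heteroclinic_below:
  assumes ints: "minima = \<int>" and "0 < \<xi>" "\<xi> < 1"
  obtains y where "y \<in> M_0plus h" "0 < y 0" "y 0 < \<xi>"
proof -
  interpret ordered_family V L "M_0plus h" by (rule M_0plus_ordered_family)
  obtain y where y: "y \<in> M_0plus h" "y 0 \<le> 1/2" "1/2 \<le> y 1" by (rule M_0plus_through_level)
  have zero: "(\<lambda>_. 0) \<in> M_0plus h"
    using ints by (simp add: M_0plus_iff constant_minimal_iff)
  have "\<not> (\<forall>i. y i \<le> 0)" using y(3) by (metis half_gt_zero_iff not_le order_less_le_trans zero_less_one)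
  then have nonneg: "0 \<le> y i" for i
    using M_0plus_side_of_minimum[OF y(1), of 0] ints by auto
  have pos: "0 < y i" for i
  proof (rule ccontr)
    assume "\<not> 0 < y i"
    then have "y i = 0" using nonneg[of i] by simp
    then have "(\<lambda>_. 0) = y"
      by (intro minimal_touch[OF M_minimal[OF zero] M_minimal[OF y(1)] nonneg]) simp
    then have "y 1 = 0" by (metis)
    then show False using y(3) by simp
  qed
  obtain \<alpha> \<beta> where \<alpha>: "\<alpha> \<in> minima" "\<And>i. \<alpha> \<le> y i" "(\<lambda>n. y (- int n)) \<longlonglongrightarrow> \<alpha>"
    using M_0plus_limits[OF y(1)] by metis
  have "\<alpha> \<in> \<int>" using \<alpha>(1) ints by simp
  moreover have "0 \<le> \<alpha>" by (rule LIMSEQ_le_const[OF \<alpha>(3)]) (use nonneg in auto)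
  moreover have "\<alpha> < 1" using \<alpha>(2)[of 0] y(2) by simp
  ultimately have "\<alpha> = 0" by (auto elim!: Ints_cases)
  then have "eventually (\<lambda>n. y (- int n) < \<xi>) sequentially"
    using order_tendstoD(2)[OF \<alpha>(3), of \<xi>] assms(2) by simp
  then obtain n where n: "y (- int n) < \<xi>" by (auto simp: eventually_sequentially)
  have "(\<lambda>i. y (i + - int n) + of_int 0) \<in> M_0plus h" by (rule M_translate[OF y(1)])
  then show ?thesis using that[of "\<lambda>i. y (i + - int n) + of_int 0"] n pos by simp
qed

text \<open>
  By \<open>M_0plus_heteroclinic_below\<close> the lower end of the gap is not a constant configuration, so its shift
  by one index is strictly above it.
\<close>

lemma M_0plus_gap_next:
  assumes ints: "minima = \<int>" and \<xi>: "0 < \<xi>" "\<xi> < 1" and g: "gap_configs (M_0plus h) \<xi> xm xp"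
  shows "xp i \<le> xm (i + 1)"
proof -
  interpret ordered_family V L "M_0plus h" by (rule M_0plus_ordered_family)
  have x: "xm \<in> M_0plus h" "xm 0 < \<xi>" "\<xi> < xp 0" using g by (simp_all add: gap_configs_def)
  obtain y where y: "y \<in> M_0plus h" "0 < y 0" "y 0 < \<xi>"
    by (rule M_0plus_heteroclinic_below[OF ints \<xi>])
  have "y 0 \<le> xm 0" using gap_avoids[OF g y(1)] y(3) x(3) by linarith
  then have pos: "0 < xm 0" using y(2) by simp
  have "xm 0 \<noteq> xm 1"
  proof
    assume eq: "xm 0 = xm 1"
    have "xm = (\<lambda>i. xm (i + 1) + of_int 0)"
      by (rule M_eq[OF x(1) M_translate[OF x(1)]]) (simp add: eq)
    then have "xm i = xm (i + 1) + of_int 0" for i by (rule fun_cong)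
    then have "xm (i + 1) = xm i" for i by simp
    then have "xm i = xm 0" for i by (rule constant_config)
    then have "xm = (\<lambda>_. xm 0)" by (rule ext)
    then have "minimal (\<lambda>_. xm 0)" using M_minimal[OF x(1)] by simp
    then have "xm 0 \<in> \<int>" using ints by (simp add: constant_minimal_iff)
    then show False using pos x(2) \<xi>(2) by (auto elim!: Ints_cases)
  qed
  moreover have "xm 0 \<le> xm (0 + 1)" using x(1) unfolding M_0plus_iff by blast
  ultimately show ?thesis using gap_below_translate[OF g, of 1 0 i] by simp
qed

theorem M_0plus_barrier_data:
  assumes ints: "minima = \<int>" and \<xi>: "0 < \<xi>" "\<xi> < 1"
  shows "\<exists>xm xp x. xm \<in> M_0plus h \<and> xp \<in> M_0plus h \<and>
    barrier_data \<xi> (peierls_barrier h (M_0plus h) \<xi>) xm xp x"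
proof -
  interpret ordered_family V L "M_0plus h" by (rule M_0plus_ordered_family)
  show ?thesis
  proof (rule barrier_data_exists)
    fix xm xp assume g: "gap_configs (M_0plus h) \<xi> xm xp"
    have x: "xm \<in> M_0plus h" "xp \<in> M_0plus h" using g by (simp_all add: gap_configs_def)
    have step: "xm i \<le> xm (i + 1)" for i using x(1) by (simp add: M_0plus_iff)
    show next_gap: "xp i \<le> xm (i + 1)" for i by (rule M_0plus_gap_next[OF ints \<xi> g])
    have width: "xm 0 \<le> xm i + 1" "xp i \<le> xp 0 + 1" for i
      using x by (simp_all add: M_0plus_iff)
    have ord: "xp i \<le> xm j" if "i < j" for i j
      using next_gap[of i] config_mono[of xm "i + 1" j, OF step] that by simp
    have "(\<Sum>i\<in>F. xp i - xm i) \<le> (xp 0 + 1) - (xm 0 - 1)" if "finite F" for F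
    proof (rule ordered_intervals_sum_le[OF that, where key = real_of_int])
      show "xp i \<le> xm j" if "real_of_int i < real_of_int j" for i j using ord that by simp
      show "xm 0 - 1 \<le> xm i" for i using width(1)[of i] by simp
      show "xp i \<le> xp 0 + 1" for i by (rule width(2))
      show "xm 0 - 1 \<le> xp 0 + 1" using gap_le[OF g, of 0] by simp
    qed (simp add: inj_on_def)
    then show "\<exists>C. \<forall>F. finite F \<longrightarrow> (\<Sum>i\<in>F. xp i - xm i) \<le> C" by blast
  qed
qed

end

section \<open>Passage from one integer to the next\<close>

text \<open>
  Maximum principle: the comparison sequence is a supersolution because \<open>r + 1 / r \<le> 2 + \<mu>\<close>, it
  dominates \<open>e\<close> at both ends, and the difference cannot have a positive interior maximum.
\<close>

lemma discrete_convex_decay: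
  fixes e :: "int \<Rightarrow> real" and r \<mu> :: real
  assumes r: "0 < r" "r + 1 / r \<le> 2 + \<mu>" and "0 < \<mu>"
    and bound: "\<And>i. p \<le> i \<Longrightarrow> i \<le> q \<Longrightarrow> e i \<le> A" and "0 \<le> A"
    and convex: "\<And>i. p < i \<Longrightarrow> i < q \<Longrightarrow> (2 + \<mu>) * e i \<le> e (i - 1) + e (i + 1)"
    and i: "p \<le> i" "i \<le> q"
  shows "e i \<le> A * (r powi (p - i) + r powi (i - q))"
proof -
  define b where "b = (\<lambda>i. A * (r powi (p - i) + r powi (i - q)))"
  define f where "f = (\<lambda>i. e i - b i)"
  have "finite (f ` {p..q})" "f ` {p..q} \<noteq> {}" using i by auto
  then have "Max (f ` {p..q}) \<in> f ` {p..q}" by (rule Max_in)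
  then obtain c where c: "c \<in> {p..q}" "f c = Max (f ` {p..q})" by auto
  have fmax: "f j \<le> f c" if "p \<le> j" "j \<le> q" for j
    using that c(2) by (simp add: Max_ge)
  have b_nonneg: "0 \<le> b j" for j using r(1) \<open>0 \<le> A\<close> by (simp add: b_def)
  have b_end: "A \<le> b p" "A \<le> b q"
    using r(1) \<open>0 \<le> A\<close> by (simp_all add: b_def distrib_left)
  have "f c \<le> 0"
  proof (rule ccontr)
    assume "\<not> f c \<le> 0"
    then have pos: "0 < f c" by simp
    have "c \<noteq> p" "c \<noteq> q"
      using pos b_end bound[of c] c(1) by (auto simp: f_def)
    then have cpq: "p < c" "c < q" using c(1) by auto
    have rec: "r powi (m + 1) + r powi (m - 1) = (r + 1 / r) * r powi m" for m
    proof -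
      have "r powi (m + 1) = r powi m * r" "r powi (m - 1) = r powi m / r"
        using r(1) power_int_add[of r m 1] power_int_diff[of r m 1] by simp_all
      then show ?thesis by (simp only:) (simp add: distrib_right)
    qed
    have "b (c - 1) + b (c + 1) = A * ((r powi (p - c + 1) + r powi (p - c - 1)) + (r powi (c - q + 1) + r powi (c - q - 1)))"
      by (simp add: b_def algebra_simps)
    also have "\<dots> = (r + 1 / r) * b c"
      unfolding rec by (simp add: b_def algebra_simps)
    also have "\<dots> \<le> (2 + \<mu>) * b c" using r(2) b_nonneg by (intro mult_right_mono)
    finally have "(2 + \<mu>) * f c \<le> f (c - 1) + f (c + 1)"
      using convex[OF cpq] by (simp add: f_def algebra_simps)
    also have "\<dots> \<le> f c + f c" using cpq by (intro add_mono fmax) auto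
    finally have "\<mu> * f c \<le> 0" by (simp add: algebra_simps)
    then show False using pos \<open>0 < \<mu>\<close> by (simp add: mult_le_0_iff)
  qed
  then show ?thesis using fmax[OF i] by (simp add: f_def b_def)
qed

definition dwell_bound :: "int \<Rightarrow> config \<Rightarrow> bool" where
  "dwell_bound N1 x \<longleftrightarrow>
     (\<forall>i j (m::int). i \<le> j \<longrightarrow> of_int m + 1/4 \<le> x i \<longrightarrow> x j \<le> of_int m + 3/4 \<longrightarrow> j - i \<le> N1)"

text \<open>
  Before index \<open>- N1\<close> the configuration is below 1/4, because it would otherwise dwell too long before
  index 0; and it cannot be below -1/4 at a time less than about \<open>T\<close> before 0, because advancing by 1
  takes \<open>T\<close> steps. The second half is the same statement around 1.
\<close>

lemma passage_windows:
  fixes x :: config and T N1 i :: int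
  assumes step: "\<And>i. x i \<le> x (i + 1)" and T: "\<And>i. x (i + T) \<le> x i + 1"
    and dwell: "dwell_bound N1 x"
    and N1: "0 \<le> N1" and \<xi>: "x 0 \<le> \<xi>" "\<xi> \<le> x 1" "1/4 \<le> \<xi>" "\<xi> \<le> 3/4"
  shows "- T + N1 + 2 \<le> i \<Longrightarrow> i \<le> - N1 - 1 \<Longrightarrow> \<bar>x i\<bar> \<le> 1/4"
    and "N1 + 2 \<le> i \<Longrightarrow> i \<le> T - N1 - 1 \<Longrightarrow> \<bar>x i - 1\<bar> \<le> 1/4"
proof -
  note mono = config_mono[of x, OF step]
  note stay = dwell[unfolded dwell_bound_def, rule_format]
  show "\<bar>x i\<bar> \<le> 1/4" if i: "- T + N1 + 2 \<le> i" "i \<le> - N1 - 1"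
  proof -
    have "x i < 1/4" using stay[of i 0 0] i \<xi> N1 by force
    moreover have "- 1/4 \<le> x i"
    proof (rule ccontr)
      assume neg: "\<not> - 1/4 \<le> x i"
      have "x (i - N1 - 1) < - 3/4" using stay[of "i - N1 - 1" i "- 1"] neg N1 by force
      then have "x (i - N1 - 1 + T) < x 1" using T[of "i - N1 - 1"] \<xi> by simp
      moreover have "x 1 \<le> x (i - N1 - 1 + T)" using i by (intro mono) simp
      ultimately show False by simp
    qed
    ultimately show ?thesis by (simp add: abs_le_iff)
  qed
  show "\<bar>x i - 1\<bar> \<le> 1/4" if i: "N1 + 2 \<le> i" "i \<le> T - N1 - 1"
  proof -
    have "3/4 < x i" using stay[of 1 i 0] i \<xi> N1 by force
    moreover have "x i \<le> 5/4"
    proof (rule ccontr)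
      assume neg: "\<not> x i \<le> 5/4"
      have "7/4 < x (i + N1 + 1)" using stay[of i "i + N1 + 1" 1] neg N1 by force
      then have "x 0 < x (i + N1 + 1 - T)" using T[of "i + N1 + 1 - T"] \<xi> by simp
      moreover have "x (i + N1 + 1 - T) \<le> x 0" using i by (intro mono) simp
      ultimately show False by simp
    qed
    ultimately show ?thesis unfolding abs_le_iff by linarith
  qed
qed

context twist_potential
begin

lemma action_le_length:
  assumes "i \<le> j" and "\<And>l. i \<le> l \<Longrightarrow> l < j \<Longrightarrow> h (z l) (z (l + 1)) \<le> c"
  shows "action z i j \<le> of_int (j - i) * c"
proof -
  have "action z i j \<le> real (card {i..<j}) * c"
    unfolding action_def by (rule sum_bounded_above) (use assms(2) in auto)
  then show ?thesis using assms(1) by simp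
qed

lemma action_ge_length:
  assumes "i \<le> j" and "\<And>l. i \<le> l \<Longrightarrow> l < j \<Longrightarrow> c \<le> h (z l) (z (l + 1))"
  shows "of_int (j - i) * c \<le> action z i j"
proof -
  have "real (card {i..<j}) * c \<le> action z i j"
    unfolding action_def by (rule sum_bounded_below) (use assms(2) in auto)
  then show ?thesis using assms(1) by simp
qed

text \<open>
  The competitor walks to 0 in \<open>N\<close> equal steps, stays there for free, and walks to the other end in \<open>N\<close>
  equal steps.
\<close>

lemma minimal_action_through_0:
  assumes x: "minimal x" and V0: "V 0 = 0" and VW: "\<And>t. V t \<le> W"
    and N: "0 < N" "2 * N \<le> q - p" and ends: "\<bar>x p\<bar> \<le> 1" "\<bar>x q\<bar> \<le> 1"
  shows "action x p q \<le> 1 / of_int N + 2 * of_int N * W"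
proof -
  define z where "z = (\<lambda>l::int. if l \<le> p + N then x p * (1 - of_int (l - p) / of_int N)
      else if l \<le> q - N then 0 else x q * (1 - of_int (q - l) / of_int N))"
  have mid: "z l = 0" if "p + N \<le> l" "l \<le> q - N" for l
    using that N by (cases "l = p + N") (simp_all add: z_def)
  have right: "z l = x q * (1 - of_int (q - l) / of_int N)" if "q - N \<le> l" for l
  proof (cases "l = q - N")
    case True
    then show ?thesis using mid[of l] N by simp
  next
    case False
    then show ?thesis using that N by (simp add: z_def)
  qed
  have bond: "h (z l) (z (l + 1)) \<le> 1 / (2 * (of_int N)\<^sup>2) + W" if "\<bar>z l - z (l + 1)\<bar> \<le> 1 / of_int N" for l
  proof -
    have "(z l - z (l + 1))\<^sup>2 \<le> (1 / of_int N)\<^sup>2"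
      using power_mono[OF that, of 2] by simp
    then show ?thesis using VW[of "z (l + 1)"] by (simp add: h_def power_divide)
  qed
  have "action z p (p + N) \<le> of_int (p + N - p) * (1 / (2 * (of_int N)\<^sup>2) + W)"
  proof (rule action_le_length)
    fix l assume "p \<le> l" "l < p + N"
    then have "z l - z (l + 1) = x p / of_int N"
      using N by (simp add: z_def field_simps)
    then have "\<bar>z l - z (l + 1)\<bar> \<le> 1 / of_int N"
      using ends(1) N by (simp add: divide_right_mono)
    then show "h (z l) (z (l + 1)) \<le> 1 / (2 * (of_int N)\<^sup>2) + W" by (rule bond)
  qed (use N in simp)
  moreover have "action z (q - N) q \<le> of_int (q - (q - N)) * (1 / (2 * (of_int N)\<^sup>2) + W)"
  proof (rule action_le_length)
    fix l assume "q - N \<le> l" "l < q"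
    then have "z l - z (l + 1) = - (x q / of_int N)"
      using N right[of l] right[of "l + 1"] by (simp add: field_simps)
    then have "\<bar>z l - z (l + 1)\<bar> \<le> 1 / of_int N"
      using ends(2) N by (simp add: divide_right_mono)
    then show "h (z l) (z (l + 1)) \<le> 1 / (2 * (of_int N)\<^sup>2) + W" by (rule bond)
  qed (use N in simp)
  moreover have "action z (p + N) (q - N) \<le> of_int (q - N - (p + N)) * 0"
    by (rule action_le_length) (use N mid V0 in \<open>auto simp: h_def\<close>)
  moreover have "action z p q = action z p (p + N) + action z (p + N) (q - N) + action z (q - N) q"
    using N action_split[of p "p + N" q z] action_split[of "p + N" "q - N" q z] by simp
  moreover have "action x p q \<le> action z p q"
    by (rule minimalD[OF x]) (use N right[of q] in \<open>auto simp: z_def\<close>)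
  moreover have "of_int N * (1 / (2 * (of_int N)\<^sup>2) + W) + of_int N * (1 / (2 * (of_int N)\<^sup>2) + W) = 1 / of_int N + 2 * of_int N * W"
    using N by (simp add: power2_eq_square field_simps)
  ultimately show ?thesis by simp
qed

text \<open>
  Each step in the middle half of a period costs at least \<open>\<kappa>\<close>, and the total is at most the cost of a
  detour through the nearest integer on the left.
\<close>

lemma minimal_dwell_bound:
  assumes x: "minimal x" and step: "\<And>i. x i \<le> x (i + 1)" and V0: "V 0 = 0" and VW: "\<And>t. V t \<le> W"
    and \<kappa>: "\<And>t. 1/4 \<le> t \<Longrightarrow> t \<le> 3/4 \<Longrightarrow> \<kappa> \<le> V t" "0 < \<kappa>"
    and N: "0 < N" and N1: "2 * of_int N \<le> (of_int N1 :: real)" "1 / of_int N + 2 * of_int N * W \<le> of_int N1 * \<kappa>"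
  shows "dwell_bound N1 x"
  unfolding dwell_bound_def
proof (intro allI impI)
  fix i j m :: int
  assume ij: "i \<le> j" "of_int m + 1/4 \<le> x i" "x j \<le> of_int m + 3/4"
  show "j - i \<le> N1"
proof (cases "2 * N \<le> j - i")
  case True
  define y where "y = (\<lambda>l. x (l + 0) + of_int (- m))"
  have y: "minimal y" unfolding y_def by (rule minimal_translate[OF x])
  have ystep: "y l \<le> y (l + 1)" for l using step[of l] by (simp add: y_def)
  have in_range: "1/4 \<le> y l" "y l \<le> 3/4" if "i \<le> l" "l \<le> j" for l
    using config_mono[of y, OF ystep that(1)] config_mono[of y, OF ystep that(2)] ij by (simp_all add: y_def)
  have "of_int (j - i) * \<kappa> \<le> action y i j"
  proof (rule action_ge_length[OF ij(1)])
    fix l assume "i \<le> l" "l < j"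
    then have "\<kappa> \<le> V (y (l + 1))" by (intro \<kappa>(1) in_range) auto
    then show "\<kappa> \<le> h (y l) (y (l + 1))" by (simp add: h_def add_increasing)
  qed
  also have "\<dots> \<le> 1 / of_int N + 2 * of_int N * W"
    using in_range[of i] in_range[of j] ij(1)
    by (intro minimal_action_through_0[OF y V0 VW N True]) auto
  also have "\<dots> \<le> of_int N1 * \<kappa>" by (rule N1(2))
  finally have "real_of_int (j - i) \<le> of_int N1" using \<kappa>(2) by simp
  then show ?thesis by simp
next
  case False
  then have "real_of_int (j - i) \<le> of_int N1" using N1(1) by linarith
  then show ?thesis by simp
qed
qed

lemma EL_decay:
  assumes x: "EL x" and r: "0 < r" "r + 1 / r \<le> 2 + \<mu>" and "0 < \<mu>"
    and V': "\<And>t. \<bar>t\<bar> \<le> 1/4 \<Longrightarrow> (2 + \<mu>) * \<bar>t\<bar> \<le> \<bar>2 * t + deriv V t\<bar>"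
    and win: "\<And>l. p \<le> l \<Longrightarrow> l \<le> q \<Longrightarrow> \<bar>x l\<bar> \<le> 1/4"
    and "1 \<le> r" "p + D \<le> i" "i + D \<le> q" "0 \<le> D"
  shows "\<bar>x i\<bar> \<le> r powi (- D) / 2"
proof -
  have i: "p \<le> i" "i \<le> q" using assms(8-10) by auto
  have "\<bar>x i\<bar> \<le> 1/4 * (r powi (p - i) + r powi (i - q))"
  proof (rule discrete_convex_decay[where e = "\<lambda>l. \<bar>x l\<bar>" and p = p and q = q, OF r \<open>0 < \<mu>\<close> win _ _ i])
    fix l assume l: "p < l" "l < q"
    have "(2 + \<mu>) * \<bar>x l\<bar> \<le> \<bar>2 * x l + deriv V (x l)\<bar>" using l by (intro V' win) auto
    also have "\<dots> = \<bar>x (l - 1) + x (l + 1)\<bar>" using x by (simp add: EL_def)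
    also have "\<dots> \<le> \<bar>x (l - 1)\<bar> + \<bar>x (l + 1)\<bar>" by (rule abs_triangle_ineq)
    finally show "(2 + \<mu>) * \<bar>x l\<bar> \<le> \<bar>x (l - 1)\<bar> + \<bar>x (l + 1)\<bar>" .
  qed auto
  also have "\<dots> \<le> 1/4 * (r powi (- D) + r powi (- D))"
    using assms by (intro mult_left_mono add_mono power_int_increasing) auto
  finally show ?thesis by simp
qed

lemma passage_close:
  assumes x: "minimal x" and step: "\<And>i. x i \<le> x (i + 1)" and T: "\<And>i. x (i + T) \<le> x i + 1"
    and dwell: "dwell_bound N1 x"
    and N1: "0 \<le> N1" and \<xi>: "x 0 \<le> \<xi>" "\<xi> \<le> x 1" "1/4 \<le> \<xi>" "\<xi> \<le> 3/4"
    and r: "1 \<le> r" "r + 1 / r \<le> 2 + \<mu>" and \<mu>: "0 < \<mu>"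
    and V': "\<And>t. \<bar>t\<bar> \<le> 1/4 \<Longrightarrow> (2 + \<mu>) * \<bar>t\<bar> \<le> \<bar>2 * t + deriv V t\<bar>"
    and H: "2 * H \<le> T" and D: "D = H - N1 - 2" "0 \<le> D" and \<epsilon>: "\<epsilon> = min (1/4) (r powi (- D) / 2)"
  shows "i \<in> {- H, - H + 1} \<Longrightarrow> \<bar>x i\<bar> \<le> \<epsilon>" and "i \<in> {H, H + 1} \<Longrightarrow> \<bar>x i - 1\<bar> \<le> \<epsilon>"
proof -
  note win = passage_windows[OF step T dwell N1 \<xi>]
  show "\<bar>x i\<bar> \<le> \<epsilon>" if "i \<in> {- H, - H + 1}"
  proof -
    have i: "- T + N1 + 2 + D \<le> i" "i + D \<le> - N1 - 1" using that H D by auto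
    have "\<bar>x i\<bar> \<le> 1/4" using i D(2) by (intro win(1)) auto
    moreover have "\<bar>x i\<bar> \<le> r powi (- D) / 2"
      by (rule EL_decay[OF minimal_imp_EL[OF x] _ r(2) \<mu> V' win(1) r(1) i D(2)]) (use r in auto)
    ultimately show ?thesis unfolding \<epsilon> by simp
  qed
  show "\<bar>x i - 1\<bar> \<le> \<epsilon>" if "i \<in> {H, H + 1}"
  proof -
    have i: "N1 + 2 + D \<le> i" "i + D \<le> T - N1 - 1" using that H D by auto
    \<comment> \<open>The stay near 1 is a stay near 0 of the configuration lowered by 1.\<close>
    define y where "y = (\<lambda>l. x (l + 0) + of_int (- 1))"
    have y: "minimal y" unfolding y_def by (rule minimal_translate[OF x])
    have win_y: "\<bar>y l\<bar> \<le> 1/4" if "N1 + 2 \<le> l" "l \<le> T - N1 - 1" for l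
      using win(2)[OF that] by (simp add: y_def)
    have "\<bar>y i\<bar> \<le> 1/4" using i D(2) by (intro win_y) auto
    moreover have "\<bar>y i\<bar> \<le> r powi (- D) / 2"
      by (rule EL_decay[OF minimal_imp_EL[OF y] _ r(2) \<mu> V' win_y r(1) i D(2)]) (use r in auto)
    ultimately show ?thesis unfolding \<epsilon> by (simp add: y_def)
  qed
qed

text \<open>
  At the middle indices \<open>- H\<close> and \<open>H\<close> of the stays near 0 and 1, the decay is available for \<open>xm\<close> at two
  consecutive indices; as \<open>xp\<close> lies between \<open>xm\<close> and its shift, it is controlled as well.
\<close>

lemma barrier_data_close:
  assumes d: "barrier_data \<xi> P xm xp x" and T: "\<And>i. xm (i + T) \<le> xm i + 1"
    and dwell: "dwell_bound N1 xm"
    and N1: "0 \<le> N1" and \<xi>: "1/4 \<le> \<xi>" "\<xi> \<le> 3/4"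
    and r: "1 \<le> r" "r + 1 / r \<le> 2 + \<mu>" and \<mu>: "0 < \<mu>"
    and V': "\<And>t. \<bar>t\<bar> \<le> 1/4 \<Longrightarrow> (2 + \<mu>) * \<bar>t\<bar> \<le> \<bar>2 * t + deriv V t\<bar>"
    and H: "2 * H \<le> T" and D: "D = H - N1 - 2" "0 \<le> D" and \<epsilon>: "\<epsilon> = min (1/4) (r powi (- D) / 2)"
  shows "u \<in> {xm, xp} \<Longrightarrow> \<bar>u (- H)\<bar> \<le> \<epsilon>" and "u \<in> {xm, xp} \<Longrightarrow> \<bar>u H - 1\<bar> \<le> \<epsilon>"
proof -
  have min: "minimal xm" and step: "xm i \<le> xm (i + 1)" and next_gap: "xp i \<le> xm (i + 1)"
    and between: "xm i \<le> x i" "x i \<le> xp i" and x0: "x 0 = \<xi>" for i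
    using d by (simp_all add: barrier_data_def unit_steps_def)
  have \<xi>': "xm 0 \<le> \<xi>" "\<xi> \<le> xm 1"
    using between[of 0] next_gap[of 0] x0 by simp_all
  note close = passage_close[OF min step T dwell N1 \<xi>' \<xi> r \<mu> V' H D \<epsilon>]
  have xp: "xm i \<le> xp i" for i using between[of i] by simp
  show "\<bar>u (- H)\<bar> \<le> \<epsilon>" if "u \<in> {xm, xp}"
    using that close(1)[of "- H"] close(1)[of "- H + 1"] xp[of "- H"] next_gap[of "- H"] by auto
  show "\<bar>u H - 1\<bar> \<le> \<epsilon>" if "u \<in> {xm, xp}"
    using that close(2)[of H] close(2)[of "H + 1"] xp[of H] next_gap[of H] by auto
qed

theorem barriers_close:
  assumes irr: "\<omega> \<notin> \<rat>" "0 < \<omega>" "\<omega> < 1" and T: "of_int T * \<omega> < 1"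
    and ints: "minima = \<int>"
    and dwell: "\<And>x. minimal x \<Longrightarrow> (\<And>i. x i \<le> x (i + 1)) \<Longrightarrow> dwell_bound N1 x"
    and N1: "0 \<le> N1" and \<xi>: "1/4 \<le> \<xi>" "\<xi> \<le> 3/4"
    and r: "1 \<le> r" "r + 1 / r \<le> 2 + \<mu>" and \<mu>: "0 < \<mu>"
    and V': "\<And>t. \<bar>t\<bar> \<le> 1/4 \<Longrightarrow> (2 + \<mu>) * \<bar>t\<bar> \<le> \<bar>2 * t + deriv V t\<bar>"
    and V7: "\<And>t. \<bar>t\<bar> \<le> 1/4 \<Longrightarrow> V t \<le> 7 * \<bar>t\<bar>"
    and H: "2 * H \<le> T" and D: "D = H - N1 - 2" "0 \<le> D"
  shows "\<bar>P_irr h \<omega> \<xi> - P_0plus h \<xi>\<bar> \<le> 20 * r powi (- D)"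
proof -
  define \<epsilon> where "\<epsilon> = min (1/4) (r powi (- D) / 2)"
  have \<epsilon>: "0 \<le> \<epsilon>" "\<epsilon> \<le> 1/4" "\<epsilon> \<le> r powi (- D) / 2" using r(1) by (auto simp: \<epsilon>_def)
  have \<xi>': "0 < \<xi>" "\<xi> < 1" using \<xi> by simp_all
  obtain xm xp x where x: "xm \<in> Birkhoff \<omega>" "barrier_data \<xi> (peierls_barrier h (Birkhoff \<omega>) \<xi>) xm xp x"
    using Birkhoff_barrier_data[OF irr, of \<xi>] by (elim exE conjE)
  obtain ym yp y where y: "ym \<in> M_0plus h" "barrier_data \<xi> (peierls_barrier h (M_0plus h) \<xi>) ym yp y"
    using M_0plus_barrier_data[OF ints \<xi>'] by (elim exE conjE)
  have Tx: "xm (i + T) \<le> xm i + 1" for i using BirkhoffD(2)[OF x(1), of T 1 i] T by simp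
  have Ty: "ym (i + T) \<le> ym i + 1" for i using y(1) by (simp add: M_0plus_iff)
  have min_y: "minimal ym" and step_y: "ym i \<le> ym (i + 1)" for i using y(1) by (simp_all add: M_0plus_iff)
  note close_x = barrier_data_close[OF x(2) Tx dwell[OF BirkhoffD(1)[OF x(1)] Birkhoff_step(1)[OF x(1) irr(2,3)]] N1 \<xi> r \<mu> V' H D \<epsilon>_def]
  note close_y = barrier_data_close[OF y(2) Ty dwell[OF min_y step_y] N1 \<xi> r \<mu> V' H D \<epsilon>_def]
  have V_small: "V t \<le> 7 * \<epsilon>" if "\<bar>t - 0\<bar> \<le> \<epsilon> \<or> \<bar>t - 1\<bar> \<le> \<epsilon>" for t
    using that
  proof
    assume "\<bar>t - 0\<bar> \<le> \<epsilon>"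
    then show ?thesis using V7[of t] \<epsilon> by simp
  next
    assume "\<bar>t - 1\<bar> \<le> \<epsilon>"
    then have "V (t - 1) \<le> 7 * \<epsilon>" using V7[of "t - 1"] \<epsilon> by simp
    then show ?thesis using V_periodic[of "t - 1"] by simp
  qed
  have "0 \<le> H" using D N1 by simp
  have "\<bar>peierls_barrier h (Birkhoff \<omega>) \<xi> - peierls_barrier h (M_0plus h) \<xi>\<bar> \<le> 3 * (4 * \<epsilon> * (1 + 2 * \<epsilon>) + 7 * \<epsilon>)"
  proof (rule barrier_comparison[OF x(2) y(2), where a = "- H" and b = H and c = 0 and d = 1])
    show "\<bar>u (- H) - 0\<bar> \<le> \<epsilon>" if "u \<in> {xm, xp, ym, yp}" for u
      using that close_x(1)[of u] close_y(1)[of u] by auto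
    show "\<bar>u H - 1\<bar> \<le> \<epsilon>" if "u \<in> {xm, xp, ym, yp}" for u
      using that close_x(2)[of u] close_y(2)[of u] by auto
  qed (use \<open>0 \<le> H\<close> V_small in auto)
  also have "\<dots> \<le> 3 * (4 * \<epsilon> * (1 + 2 * (1/4)) + 7 * \<epsilon>)"
    using \<epsilon> by (intro mult_left_mono add_right_mono) auto
  also have "\<dots> \<le> 20 * r powi (- D)" using \<epsilon> by simp
  finally show ?thesis by (simp add: P_irr_def P_0plus_def M_irr_eq_Birkhoff)
qed

end

section \<open>Exponential closeness of the barriers\<close>

lemma periodic_C1_lipschitz:
  fixes f f' :: "real \<Rightarrow> real"
  assumes deriv: "\<And>x. (f has_real_derivative f' x) (at x)" and cont: "continuous_on UNIV f'"
    and per: "\<And>x. f (x + 1) = f x"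
  obtains L where "\<And>x y. \<bar>f x - f y\<bar> \<le> L * \<bar>x - y\<bar>"
proof -
  have per': "f' (x + 1) = f' x" for x
  proof (rule DERIV_unique)
    have "((\<lambda>x. f (x + 1)) has_real_derivative f' (x + 1)) (at x)"
      using deriv[of "x + 1"] by (simp only: DERIV_shift)
    then show "(f has_real_derivative f' (x + 1)) (at x)" by (simp only: per)
  qed (rule deriv)
  have "compact (f' ` {0..1})"
    by (intro compact_continuous_image continuous_on_subset[OF cont]) auto
  then obtain L where L: "\<And>x. x \<in> {0..1} \<Longrightarrow> \<bar>f' x\<bar> \<le> L"
    using compact_imp_bounded bounded_iff by (metis imageI real_norm_def)
  have nat: "f' (x + real n) = f' x" for x n
  proof (induction n)
    case (Suc n)
    have "x + real (Suc n) = (x + real n) + 1" by simp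
    then have "f' (x + real (Suc n)) = f' (x + real n)" using per'[of "x + real n"] by metis
    then show ?case using Suc by simp
  qed simp
  have "f' x = f' (frac x)" for x
  proof (cases "0 \<le> \<lfloor>x\<rfloor>")
    case True
    then show ?thesis using nat[of "frac x" "nat \<lfloor>x\<rfloor>"] by (simp add: frac_def)
  next
    case False
    then show ?thesis using nat[of x "nat (- \<lfloor>x\<rfloor>)"] by (simp add: frac_def)
  qed
  moreover have "frac x \<in> {0..1}" for x :: real using frac_ge_0[of x] frac_lt_1[of x] by simp
  ultimately have bound: "\<bar>f' x\<bar> \<le> L" for x using L by metis
  have incr: "\<bar>f y - f x\<bar> \<le> L * (y - x)" if lt: "x < y" for x y
  proof -
    obtain z where "f y - f x = (y - x) * f' z"
      using MVT2[OF lt deriv] by blast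
    then have "\<bar>f y - f x\<bar> = \<bar>f' z\<bar> * (y - x)" using lt by (simp add: abs_mult)
    also have "\<dots> \<le> L * (y - x)" using lt bound by (intro mult_right_mono) auto
    finally show ?thesis .
  qed
  have "\<bar>f x - f y\<bar> \<le> L * \<bar>x - y\<bar>" for x y
  proof (cases x y rule: linorder_cases)
    case less
    then show ?thesis using incr[of x y] by (simp add: abs_minus_commute)
  next
    case greater
    then show ?thesis using incr[of y x] by simp
  qed simp
  then show ?thesis by (rule that)
qed

lemma of_class_C_derivative:
  assumes "of_class_C k f" "0 < k"
  shows "(f has_real_derivative deriv f x) (at x)" and "continuous_on UNIV (deriv f)"
proof -
  have diff: "(deriv ^^ j) f differentiable (at x)" if "j < k" for j x
    using assms(1) that by (simp add: of_class_C_def)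
  show "(f has_real_derivative deriv f x) (at x)"
    using diff[of 0 x] assms(2) by (simp add: DERIV_deriv_iff_real_differentiable)
  show "continuous_on UNIV (deriv f)"
  proof (cases "k = 1")
    case True
    then show ?thesis using assms(1) by (simp add: of_class_C_def)
  next
    case False
    then have "deriv f differentiable (at x)" for x using diff[of 1 x] assms(2) by simp
    then show ?thesis
      by (intro continuous_at_imp_continuous_on ballI differentiable_imp_continuous_within)
  qed
qed

lemma sin_ge_third:
  fixes y :: real
  assumes "0 \<le> y" "y \<le> 2" shows "y / 3 \<le> sin y"
proof -
  have "\<bar>sin y - (\<Sum>m<3. sin_coeff m * y ^ m)\<bar> \<le> inverse (fact 3) * \<bar>y\<bar> ^ 3"
    by (rule Maclaurin_sin_bound)
  moreover have "(\<Sum>m<3. sin_coeff m * y ^ m) = y" by (simp add: numeral_3_eq_3 sin_coeff_def)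
  moreover have "inverse (fact 3) * \<bar>y\<bar> ^ 3 = y ^ 3 / 6" using assms by (simp add: fact_numeral)
  moreover have "y ^ 3 \<le> 4 * y"
  proof -
    have "y * y \<le> 2 * 2" using assms by (intro mult_mono) auto
    then have "y * (y * y) \<le> y * 4" using assms by (intro mult_left_mono) auto
    then show ?thesis by (simp add: power3_eq_cube mult.assoc mult.commute)
  qed
  ultimately have "\<bar>sin y - y\<bar> \<le> y ^ 3 / 6" "y ^ 3 \<le> 4 * y" by simp_all
  then show ?thesis by linarith
qed

lemma one_minus_cos_le: "1 - cos y \<le> \<bar>y\<bar>" for y :: real
proof -
  have "cos y = cos (2 * (y / 2))" by simp
  also have "\<dots> = 1 - 2 * (sin (y / 2))\<^sup>2" by (rule cos_double_sin)
  finally have "1 - cos y = 2 * (\<bar>sin (y / 2)\<bar> * \<bar>sin (y / 2)\<bar>)"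
    by (simp add: power2_eq_square)
  also have "\<dots> \<le> 2 * (\<bar>sin (y / 2)\<bar> * 1)" by (intro mult_left_mono) auto
  also have "\<dots> \<le> 2 * \<bar>y / 2\<bar>" using abs_sin_x_le_abs_x[of "y / 2"] by simp
  finally show ?thesis by simp
qed

text \<open>
  Here \<open>\<theta>\<^sup>2\<close> is \<open>n powr (- a)\<close> and \<open>E\<close> is \<open>n powr \<delta>\<close>. The bound on the bump by a multiple of \<open>\<theta>\<^sup>2\<close> is what
  makes a walk of \<open>1 / \<theta>\<close> steps cost only \<open>O(\<theta>)\<close>.
\<close>

lemma barriers_exponentially_close:
  fixes \<theta> E W \<omega> \<xi> :: real and w V :: "real \<Rightarrow> real"
  assumes V: "\<And>x. V x = \<theta>\<^sup>2 * (1 - cos (2 * pi * x)) + w x" and tw: "twist_potential V L"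
    and w: "\<And>x. 0 \<le> w x" "\<And>x. w x \<le> W * \<theta>\<^sup>2" "\<And>x. \<bar>x\<bar> \<le> 3/8 \<Longrightarrow> w x = 0"
    and \<theta>: "0 < \<theta>" "\<theta> \<le> 1/9" and E: "2 * (13 + 4 * W) + 2 \<le> E" and W: "0 \<le> W"
    and \<omega>: "\<omega> \<notin> \<rat>" "0 < \<omega>" "\<omega> < \<theta> / E" and \<xi>: "1/4 \<le> \<xi>" "\<xi> \<le> 3/4"
  shows "\<bar>P_irr (twist_potential.h V) \<omega> \<xi> - P_0plus (twist_potential.h V) \<xi>\<bar>
    \<le> 20 * exp (2 * (13 + 4 * W) + 1) * exp (- E)"
proof -
  interpret twist_potential V L by (rule tw)
  \<comment> \<open>With this constant \<open>N1\<close> dominates \<open>2 * N\<close> and the ratio of \<open>1 / N + 2 * N * ((2 + W) * \<theta>\<^sup>2)\<close> to \<open>\<theta>\<^sup>2\<close>.\<close>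
  define C1 where "C1 = 13 + 4 * W"
  define N where "N = \<lceil>1 / \<theta>\<rceil>"
  define N1 where "N1 = \<lceil>C1 / \<theta>\<rceil>"
  define T where "T = \<lfloor>E / \<theta>\<rfloor>"
  define H where "H = T div 2"
  define D where "D = H - N1 - 2"
  \<comment> \<open>The linearized rate: for \<open>\<bar>t\<bar> \<le> 1/4\<close> the force is at least \<open>9 * \<theta>\<^sup>2 * \<bar>t\<bar>\<close>, since \<open>\<pi>\<close> lies between 3 and 4.\<close>
  define r where "r = 1 + 3 * \<theta>"
  have "0 < E" using E W by simp
  have N: "1 / \<theta> \<le> of_int N" "of_int N \<le> 2 / \<theta>"
  proof -
    show "1 / \<theta> \<le> of_int N" by (simp add: N_def)
    have "of_int N \<le> 1 / \<theta> + 1" unfolding N_def by linarith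
    moreover have "1 \<le> 1 / \<theta>" using \<theta> by simp
    ultimately show "of_int N \<le> 2 / \<theta>" by (simp add: add_divide_distrib)
  qed
  have "0 < 1 / \<theta>" using \<theta> by simp
  then have Npos: "0 < N" using N(1) by linarith
  have V0: "V 0 = 0" using w(3)[of 0] by (simp add: V)
  have VW: "V t \<le> (2 + W) * \<theta>\<^sup>2" for t
  proof -
    have "\<theta>\<^sup>2 * (1 - cos (2 * pi * t)) \<le> \<theta>\<^sup>2 * 2"
      by (intro mult_left_mono) (use cos_ge_minus_one[of "2 * pi * t"] in linarith, simp)
    then show ?thesis using w(2)[of t] by (simp add: V algebra_simps)
  qed
  have low: "\<theta>\<^sup>2 \<le> V t" if "1/4 \<le> t" "t \<le> 3/4" for t
  proof -
    have "- (pi / 2) \<le> 2 * pi * t - pi" "2 * pi * t - pi \<le> pi / 2"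
      using that pi_gt_zero mult_left_mono[OF that(1), of "2 * pi"] mult_left_mono[OF that(2), of "2 * pi"]
      by (simp_all add: field_simps)
    then have "0 \<le> cos (2 * pi * t - pi)" by (rule cos_ge_zero)
    then have "\<theta>\<^sup>2 * 1 \<le> \<theta>\<^sup>2 * (1 - cos (2 * pi * t))"
      by (intro mult_left_mono) (simp_all add: cos_diff)
    then show ?thesis using w(1)[of t] by (simp add: V)
  qed
  have C1: "0 \<le> C1" using W by (simp add: C1_def)
  have N1: "C1 / \<theta> \<le> of_int N1" "of_int N1 \<le> C1 / \<theta> + 1"
    unfolding N1_def by linarith+
  have N1_nonneg: "0 \<le> N1"
  proof -
    have "0 \<le> C1 / \<theta>" using C1 \<theta> by simp
    then show ?thesis using N1(1) by linarith
  qed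
  have dwell: "dwell_bound N1 x" if "minimal x" "\<And>i. x i \<le> x (i + 1)" for x
  proof (rule minimal_dwell_bound[OF that V0 VW low _ Npos])
    have "2 * of_int N \<le> 4 / \<theta>" using N(2) by simp
    also have "\<dots> \<le> C1 / \<theta>" using \<theta> W by (intro divide_right_mono) (auto simp: C1_def)
    finally show "2 * of_int N \<le> (of_int N1 :: real)" using N1(1) by linarith
    have "1 / of_int N \<le> \<theta>"
      using N(1) \<theta> Npos by (simp add: field_simps)
    moreover have "2 * of_int N * ((2 + W) * \<theta>\<^sup>2) \<le> 2 * (2 / \<theta>) * ((2 + W) * \<theta>\<^sup>2)"
      using N(2) W by (intro mult_right_mono mult_left_mono) auto
    moreover have "2 * (2 / \<theta>) * ((2 + W) * \<theta>\<^sup>2) = 4 * (2 + W) * \<theta>"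
      using \<theta> by (simp add: power2_eq_square)
    moreover have "\<theta> + 4 * (2 + W) * \<theta> \<le> C1 * \<theta>"
      using \<theta> by (simp add: C1_def algebra_simps)
    moreover have "C1 * \<theta> \<le> of_int N1 * \<theta>\<^sup>2"
    proof -
      have "C1 / \<theta> * \<theta>\<^sup>2 \<le> of_int N1 * \<theta>\<^sup>2" using N1(1) by (intro mult_right_mono) auto
      then show ?thesis using \<theta> by (simp add: power2_eq_square)
    qed
    ultimately show "1 / of_int N + 2 * of_int N * ((2 + W) * \<theta>\<^sup>2) \<le> of_int N1 * \<theta>\<^sup>2"
      by linarith
  qed (use \<theta> in simp_all)
  have V': "(2 + 9 * \<theta>\<^sup>2) * \<bar>t\<bar> \<le> \<bar>2 * t + deriv V t\<bar>" if t: "\<bar>t\<bar> \<le> 1/4" for t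
  proof -
    have "((\<lambda>x. \<theta>\<^sup>2 * (1 - cos (2 * pi * x))) has_real_derivative \<theta>\<^sup>2 * (2 * pi * sin (2 * pi * t))) (at t)"
      by (auto intro!: derivative_eq_intros)
    moreover have "t \<in> {- (3/8)<..<3/8}" using t by auto
    ultimately have "(V has_real_derivative \<theta>\<^sup>2 * (2 * pi * sin (2 * pi * t))) (at t)"
      by (rule has_field_derivative_transform_within_open[OF _ open_greaterThanLessThan])
         (use w(3) in \<open>auto simp: V\<close>)
    then have d: "deriv V t = \<theta>\<^sup>2 * (2 * pi * sin (2 * pi * t))" by (rule DERIV_imp_deriv)
    have key: "9 * s \<le> 2 * pi * sin (2 * pi * s)" if "0 \<le> s" "s \<le> 1/4" for s
    proof -
      have y: "0 \<le> 2 * pi * s" "2 * pi * s \<le> 2"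
      proof -
        have "2 * pi * s \<le> 2 * 4 * (1/4)" using that pi_less_4 by (intro mult_mono) auto
        then show "2 * pi * s \<le> 2" by simp
      qed (use that in simp)
      have "3 * (3 * s) \<le> pi * (pi * s)" using that pi_gt3 by (intro mult_mono) auto
      moreover have "0 \<le> pi * (pi * s)" using that by simp
      ultimately have "9 * s \<le> 2 * pi * ((2 * pi * s) / 3)" by simp
      also have "\<dots> \<le> 2 * pi * sin (2 * pi * s)"
        by (intro mult_left_mono sin_ge_third y) simp
      finally show ?thesis .
    qed
    show ?thesis
    proof (cases "0 \<le> t")
      case True
      have "\<theta>\<^sup>2 * (9 * t) \<le> deriv V t" unfolding d using key[of t] True t by (intro mult_left_mono) auto
      then show ?thesis using True by (simp add: algebra_simps)
    next
      case False
      have "\<theta>\<^sup>2 * (9 * (- t)) \<le> \<theta>\<^sup>2 * (2 * pi * sin (2 * pi * (- t)))"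
        using key[of "- t"] False t by (intro mult_left_mono) auto
      then have "\<theta>\<^sup>2 * (9 * (- t)) \<le> - deriv V t" unfolding d by simp
      then show ?thesis using False by (simp add: algebra_simps)
    qed
  qed
  have V7: "V t \<le> 7 * \<bar>t\<bar>" if "\<bar>t\<bar> \<le> 1/4" for t
  proof -
    have "V t = \<theta>\<^sup>2 * (1 - cos (2 * pi * t))" using w(3)[of t] that by (simp add: V)
    also have "\<dots> \<le> (1/9)\<^sup>2 * (2 * 4 * \<bar>t\<bar>)"
    proof (rule mult_mono)
      show "\<theta>\<^sup>2 \<le> (1/9)\<^sup>2" using \<theta> by (intro power_mono) auto
      have "1 - cos (2 * pi * t) \<le> \<bar>2 * pi * t\<bar>" by (rule one_minus_cos_le)
      also have "\<dots> = 2 * pi * \<bar>t\<bar>" by (simp add: abs_mult)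
      also have "\<dots> \<le> 2 * 4 * \<bar>t\<bar>" using pi_less_4 by (intro mult_right_mono) auto
      finally show "1 - cos (2 * pi * t) \<le> 2 * 4 * \<bar>t\<bar>" .
    qed auto
    also have "\<dots> \<le> 7 * \<bar>t\<bar>" by (simp add: power2_eq_square)
    finally show ?thesis .
  qed
  have ints: "minima = \<int>"
  proof (intro set_eqI iffI)
    fix z assume "z \<in> minima"
    then have "V z \<le> 0" using V0 unfolding minima_def by (metis mem_Collect_eq)
    moreover have "0 \<le> \<theta>\<^sup>2 * (1 - cos (2 * pi * z))" by simp
    ultimately have "\<theta>\<^sup>2 * (1 - cos (2 * pi * z)) = 0" using w(1)[of z] unfolding V by linarith
    then have "cos (2 * pi * z) = 1" using \<theta> by simp
    then obtain m :: int where "2 * pi * z = of_int m * 2 * pi" unfolding cos_one_2pi_int by blast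
    then have "z = of_int m" by simp
    then show "z \<in> \<int>" by simp
  next
    fix z :: real assume "z \<in> \<int>"
    then obtain m where "z = 0 + of_int m" by (auto elim!: Ints_cases)
    then have "V z = 0" using V_periodic_int[of 0 m] V0 by simp
    then show "z \<in> minima" using V_nonneg by (simp add: minima_def)
  qed
  have "\<theta> / E \<le> 1"
    using E W \<theta> \<open>0 < E\<close> by simp
  then have \<omega>1: "\<omega> < 1" using \<omega>(3) by simp
  have T: "of_int T * \<omega> < 1"
  proof -
    have "0 \<le> E / \<theta>" using \<theta> \<open>0 < E\<close> by simp
    have "of_int T * \<omega> \<le> E / \<theta> * \<omega>" using \<omega>(2) by (intro mult_right_mono) (auto simp: T_def)
    also have "\<dots> < E / \<theta> * (\<theta> / E)" using \<omega>(3) \<theta> \<open>0 < E\<close> by (intro mult_strict_left_mono) auto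
    also have "\<dots> = 1" using \<theta> \<open>0 < E\<close> by simp
    finally show ?thesis .
  qed
  have H: "2 * H \<le> T" by (simp add: H_def)
  have D_ge: "(E / 2 - C1) / \<theta> - 4 \<le> of_int D"
  proof -
    have "T \<le> 2 * H + 1" by (simp add: H_def)
    then have "real_of_int T \<le> 2 * of_int H + 1" by linarith
    moreover have "E / \<theta> < of_int T + 1" by (simp add: T_def)
    ultimately have "E / \<theta> \<le> 2 * of_int H + 2" by linarith
    moreover have "(E / 2 - C1) / \<theta> = (1/2) * (E / \<theta>) - C1 / \<theta>" by (simp add: diff_divide_distrib)
    moreover have "real_of_int D = of_int H - of_int N1 - 2" by (simp add: D_def)
    ultimately show ?thesis using N1(2) by linarith
  qed
  have "0 \<le> (E / 2 - C1) / \<theta> - 4"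
  proof -
    have "4 * \<theta> \<le> E / 2 - C1" using E \<theta> by (simp add: C1_def)
    then show ?thesis using \<theta> by (simp add: field_simps)
  qed
  then have D0: "0 \<le> D" using D_ge by linarith
  have r: "1 \<le> r" "r + 1 / r \<le> 2 + 9 * \<theta>\<^sup>2"
  proof -
    show "1 \<le> r" using \<theta> by (simp add: r_def)
    have "r + 1 / r - 2 = (r - 1)\<^sup>2 / r" using \<open>1 \<le> r\<close> by (simp add: power2_eq_square field_simps)
    also have "\<dots> \<le> (r - 1)\<^sup>2 / 1" using \<open>1 \<le> r\<close> by (intro divide_left_mono) auto
    also have "\<dots> = 9 * \<theta>\<^sup>2" by (simp add: r_def power2_eq_square)
    finally show "r + 1 / r \<le> 2 + 9 * \<theta>\<^sup>2" by simp
  qed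
  have "\<bar>P_irr h \<omega> \<xi> - P_0plus h \<xi>\<bar> \<le> 20 * r powi (- D)"
    by (rule barriers_close[OF \<omega>(1,2) \<omega>1 T ints dwell N1_nonneg \<xi> r _ V' V7 H D_def D0])
       (use \<theta> in simp_all)
  also have "r powi (- D) \<le> exp (2 * C1 + 1) * exp (- E)"
  proof -
    have ln: "2 * \<theta> \<le> ln r"
    proof -
      have "3 * \<theta> - (3 * \<theta>)\<^sup>2 \<le> ln (1 + 3 * \<theta>)"
        using \<theta> by (intro ln_one_plus_pos_lower_bound) auto
      moreover have "(3 * \<theta>)\<^sup>2 \<le> \<theta>"
      proof -
        have "9 * \<theta> * \<theta> \<le> 1 * \<theta>" using \<theta> by (intro mult_right_mono) auto
        then show ?thesis by (simp add: power2_eq_square)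
      qed
      ultimately show ?thesis by (simp add: r_def)
    qed
    have "((E / 2 - C1) / \<theta> - 4) * (2 * \<theta>) = E - 2 * C1 - 8 * \<theta>"
      using \<theta> by (simp add: field_simps)
    then have "E - (2 * C1 + 1) \<le> ((E / 2 - C1) / \<theta> - 4) * (2 * \<theta>)"
      using \<theta> by linarith
    also have "\<dots> \<le> of_int D * ln r"
      using D_ge D0 ln \<theta> by (intro mult_mono) auto
    finally have le: "- (of_int D * ln r) \<le> 2 * C1 + 1 + - E" by simp
    have "r powi (- D) = r powr (of_int (- D))"
      using r(1) by (intro powr_real_of_int'[symmetric]) auto
    also have "\<dots> = exp (- (of_int D * ln r))" using r(1) by (simp add: powr_def)
    also have "\<dots> \<le> exp (2 * C1 + 1 + - E)" using le by simp
    also have "\<dots> = exp (2 * C1 + 1) * exp (- E)" by (rule exp_add)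
    finally show ?thesis .
  qed
  finally show ?thesis by (simp add: C1_def mult.assoc)
qed

lemma h_fam_eq:
  assumes "twist_potential (\<lambda>x. u_pert a n x + v n x) L"
  shows "h_fam a v n = twist_potential.h (\<lambda>x. u_pert a n x + v n x)"
  by (intro ext) (simp add: h_fam_def h0_def twist_potential.h_def[OF assms])

lemma potential_twist:
  fixes f :: "real \<Rightarrow> real"
  assumes "0 < k" and C: "of_class_C k f" and nonneg: "\<And>x. 0 \<le> f x"
    and per: "\<And>x. f (x + 1) = f x"
  obtains L where "twist_potential (\<lambda>x. u_pert a n x + f x) L"
proof -
  define V where "V = (\<lambda>x. u_pert a n x + f x)"
  define V' where "V' = (\<lambda>x. 1 / real n powr a * (2 * pi * sin (2 * pi * x)) + deriv f x)"
  have u': "((\<lambda>x. c * (1 - cos (2 * pi * x))) has_real_derivative c * (2 * pi * sin (2 * pi * x))) (at x)" for c x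
    by (auto intro!: derivative_eq_intros)
  have V': "(V has_real_derivative V' x) (at x)" for x
    unfolding V_def V'_def u_pert_def
    by (intro DERIV_add u' of_class_C_derivative(1)[OF C \<open>0 < k\<close>])
  have V_per: "V (x + 1) = V x" for x
    by (simp add: V_def u_pert_def per distrib_left cos_add)
  have "continuous_on UNIV V'"
    unfolding V'_def by (intro continuous_intros of_class_C_derivative(2)[OF C \<open>0 < k\<close>])
  from periodic_C1_lipschitz[OF V' this V_per] obtain L where "\<And>x y. \<bar>V x - V y\<bar> \<le> L * \<bar>x - y\<bar>"
    by metis
  moreover have "V differentiable at x" for x using V'[of x] real_differentiable_def by blast
  moreover have "0 \<le> V x" for x using nonneg[of x] by (simp add: V_def u_pert_def)
  ultimately have "twist_potential V L" using V_per by (simp add: twist_potential_def)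
  then show ?thesis using that by (simp add: V_def)
qed

lemma barrier_difference_bounded:
  assumes "twist_potential V L"
  obtains B where "\<And>\<omega> \<xi>. \<omega> \<notin> \<rat> \<Longrightarrow> 0 < \<omega> \<Longrightarrow> \<omega> < 1 \<Longrightarrow>
    \<bar>P_irr (twist_potential.h V) \<omega> \<xi> - P_0plus (twist_potential.h V) \<xi>\<bar> \<le> B"
proof -
  interpret twist_potential V L by (rule assms)
  define c where "c = \<bar>THE p::real. False\<bar>"
  have "\<bar>P_irr h \<omega> \<xi> - P_0plus h \<xi>\<bar> \<le> 2 * (4 + L + c)"
    if "\<omega> \<notin> \<rat>" "0 < \<omega>" "\<omega> < 1" for \<omega> \<xi>
  proof -
    have "\<bar>peierls_barrier h (Birkhoff \<omega>) \<xi>\<bar> \<le> 4 + L + c" "\<bar>peierls_barrier h (M_0plus h) \<xi>\<bar> \<le> 4 + L + c"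
      using ordered_family.peierls_barrier_bounded[OF Birkhoff_ordered_family[OF that], of \<xi>]
        ordered_family.peierls_barrier_bounded[OF M_0plus_ordered_family, of \<xi>]
      by (simp_all add: c_def)
    then show ?thesis
      using abs_triangle_ineq4[of "peierls_barrier h (Birkhoff \<omega>) \<xi>" "peierls_barrier h (M_0plus h) \<xi>"]
      by (simp add: P_irr_def P_0plus_def M_irr_eq_Birkhoff)
  qed
  then show ?thesis by (rule that)
qed

lemma max_le_C_norm:
  assumes "\<And>x. \<bar>f x\<bar> \<le> B" shows "\<bar>f x\<bar> \<le> C_norm k f"
proof -
  have "\<bar>f x\<bar> \<le> (SUP x. \<bar>f x\<bar>)"
    by (rule cSUP_upper) (use assms in \<open>auto intro!: bdd_aboveI[of _ B]\<close>)
  also have "\<dots> = (\<lambda>j. SUP x. \<bar>(deriv ^^ j) f x\<bar>) 0" by simp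
  also have "\<dots> \<le> C_norm k f" unfolding C_norm_def by (intro Max_ge finite_imageI imageI) auto
  finally show ?thesis .
qed

lemma bump_vanishes_near_integers:
  fixes v :: "real \<Rightarrow> real"
  assumes supp: "supp v \<inter> {0..1} \<subseteq> {1/2 - \<kappa> .. 1/2 + \<kappa>}" and "\<kappa> < 1/8"
    and per: "\<And>x. v (x + 1) = v x" and x: "\<bar>x\<bar> \<le> 3/8"
  shows "v x = 0"
proof -
  have zero: "v y = 0" if "0 \<le> y" "y \<le> 1" "y \<le> 3/8 \<or> 5/8 \<le> y" for y
  proof (rule ccontr)
    assume "v y \<noteq> 0"
    then have "y \<in> supp v" unfolding supp_def by (intro subsetD[OF closure_subset]) simp
    then have "y \<in> {1/2 - \<kappa> .. 1/2 + \<kappa>}" using supp that by auto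
    then show False using that(3) \<open>\<kappa> < 1/8\<close> by auto
  qed
  show ?thesis
  proof (cases "0 \<le> x")
    case True
    then show ?thesis using x by (intro zero) auto
  next
    case False
    then have "v (x + 1) = 0" using x by (intro zero) auto
    then show ?thesis by (simp add: per)
  qed
qed

text \<open>
  For large \<open>n\<close> the previous estimates apply, with the bump bounded by its $C^k$ norm, which is
  \<open>O(n powr (- a))\<close> because \<open>s' > a\<close>. The constant is enlarged to absorb the remaining values of \<open>n\<close>.
\<close>

theorem lemma5p1:
  fixes a s s' \<delta> :: real and k :: nat and v :: "nat \<Rightarrow> real \<Rightarrow> real"
  assumes "a > 0" and "k > 0" and "s > 0" and "s' > 0" and "s' > a"
    and v_nonneg: "\<And>n x. n \<ge> 1 \<Longrightarrow> v n x \<ge> 0"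
    and v_Ck: "\<And>n. n \<ge> 1 \<Longrightarrow> of_class_C k (v n)"
    and v_periodic: "\<And>n x. n \<ge> 1 \<Longrightarrow> v n (x + 1) = v n x"
    and v_supp: "\<And>n. n \<ge> 1 \<Longrightarrow>
      supp (v n) \<inter> {0..1} \<subseteq> {1/2 - 1 / real n powr a .. 1/2 + 1 / real n powr a}"
    and v_max: "\<And>n. n \<ge> 1 \<Longrightarrow>
      (\<exists>x. v n x = real n powr (-s)) \<and> (\<forall>x. v n x \<le> real n powr (-s))"
    and v_norm: "(\<lambda>n. C_norm k (v n)) \<in> O(\<lambda>n. real n powr (-s'))"
    and "\<delta> > 0"
  shows "\<exists>C>0. \<forall>n\<ge>1. \<forall>\<omega>. \<omega> \<notin> \<rat> \<and> 0 < \<omega> \<and> \<omega> < real n powr (- a / 2 - \<delta>) \<longrightarrow>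
           (\<forall>\<xi>\<in>{1/2 - 1 / real n powr a .. 1/2 + 1 / real n powr a}.
              \<bar>P_irr (h_fam a v n) \<omega> \<xi> - P_0plus (h_fam a v n) \<xi>\<bar>
                \<le> C * exp (- (real n powr \<delta>)))"
proof -
  define Df where "Df = (\<lambda>n \<omega> \<xi>. \<bar>P_irr (h_fam a v n) \<omega> \<xi> - P_0plus (h_fam a v n) \<xi>\<bar>)"
  have freq: "\<omega> < 1" if "n \<ge> 1" "\<omega> < real n powr (- a / 2 - \<delta>)" for n \<omega>
  proof -
    have "real n powr (- a / 2 - \<delta>) \<le> real n powr 0"
      using that(1) \<open>a > 0\<close> \<open>\<delta> > 0\<close> by (intro powr_mono) auto
    then show ?thesis using that by simp
  qed
  have "\<exists>B. \<forall>\<omega> \<xi>. \<omega> \<notin> \<rat> \<longrightarrow> 0 < \<omega> \<longrightarrow> \<omega> < 1 \<longrightarrow> Df n \<omega> \<xi> \<le> B" if n: "n \<ge> 1" for n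
  proof -
    obtain L where tw: "twist_potential (\<lambda>x. u_pert a n x + v n x) L"
      by (rule potential_twist[where f = "v n" and a = a and n = n, OF \<open>k > 0\<close> v_Ck[OF n] v_nonneg[OF n] v_periodic[OF n]])
    show ?thesis
      unfolding Df_def h_fam_eq[where a = a and n = n and v = v, OF tw] by (rule barrier_difference_bounded[OF tw]) blast
  qed
  then obtain B where B: "\<And>n \<omega> \<xi>. n \<ge> 1 \<Longrightarrow> \<omega> \<notin> \<rat> \<Longrightarrow> 0 < \<omega> \<Longrightarrow> \<omega> < 1 \<Longrightarrow> Df n \<omega> \<xi> \<le> B n"
    by metis
  obtain W where W: "0 < W"
    and norm: "eventually (\<lambda>n. norm (C_norm k (v n)) \<le> W * norm (real n powr (-s'))) sequentially"
    using landau_o.bigE[OF v_norm] by metis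
  define K where "K = 20 * exp (2 * (13 + 4 * W) + 1)"
  have "((\<lambda>n. real n powr (- a / 2)) \<longlongrightarrow> 0) sequentially"
    using \<open>a > 0\<close> by (intro tendsto_neg_powr filterlim_real_sequentially) auto
  then have "eventually (\<lambda>n. real n powr (- a / 2) < 1/9) sequentially"
    by (rule order_tendstoD) simp
  moreover have "eventually (\<lambda>n. 2 * (13 + 4 * W) + 2 \<le> real n powr \<delta>) sequentially"
  proof -
    define Z where "Z = 2 * (13 + 4 * W) + 2"
    have "eventually (\<lambda>n. Z powr (1 / \<delta>) \<le> real n) sequentially"
      using filterlim_real_sequentially by (simp add: filterlim_at_top)
    then have "eventually (\<lambda>n. Z \<le> real n powr \<delta>) sequentially"
    proof eventually_elim
      case (elim n)
      have "(Z powr (1 / \<delta>)) powr \<delta> \<le> real n powr \<delta>"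
        using elim \<open>\<delta> > 0\<close> by (intro powr_mono2) auto
      then show ?case using W \<open>\<delta> > 0\<close> by (simp add: powr_powr Z_def)
    qed
    then show ?thesis by (simp add: Z_def)
  qed
  ultimately have "eventually (\<lambda>n. \<forall>\<omega> \<xi>. \<omega> \<notin> \<rat> \<longrightarrow> 0 < \<omega> \<longrightarrow> \<omega> < real n powr (- a / 2 - \<delta>) \<longrightarrow>
      \<xi> \<in> {1/2 - 1 / real n powr a .. 1/2 + 1 / real n powr a} \<longrightarrow>
      Df n \<omega> \<xi> \<le> K * exp (- (real n powr \<delta>))) sequentially"
    using norm eventually_ge_at_top[of 1]
  proof eventually_elim
    case (elim n)
    note n = \<open>1 \<le> n\<close>
    define \<theta> where "\<theta> = real n powr (- a / 2)"
    have \<theta>: "0 < \<theta>" "\<theta> \<le> 1/9" using elim(1) n by (simp_all add: \<theta>_def)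
    have \<theta>2: "\<theta>\<^sup>2 = 1 / real n powr a"
    proof -
      have "\<theta>\<^sup>2 = real n powr (- a / 2 + - a / 2)"
        unfolding power2_eq_square \<theta>_def by (rule powr_add[symmetric])
      then show ?thesis by (simp add: powr_minus_divide)
    qed
    have \<theta>2_small: "\<theta>\<^sup>2 < 1/8"
    proof -
      have "\<theta>\<^sup>2 \<le> (1/9)\<^sup>2" using \<theta> by (intro power_mono) auto
      then show ?thesis by (simp add: power2_eq_square)
    qed
    obtain L where tw: "twist_potential (\<lambda>x. u_pert a n x + v n x) L"
      by (rule potential_twist[where f = "v n" and a = a and n = n, OF \<open>k > 0\<close> v_Ck[OF n] v_nonneg[OF n] v_periodic[OF n]])
    have v_le: "v n x \<le> W * \<theta>\<^sup>2" for x
    proof -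
      have "\<bar>v n y\<bar> \<le> real n powr (-s)" for y
        using v_max[OF n] v_nonneg[OF n, of y] by simp
      then have "\<bar>v n x\<bar> \<le> C_norm k (v n)" by (rule max_le_C_norm)
      also have "\<dots> \<le> W * real n powr (-s')" using elim(3) by simp
      also have "\<dots> \<le> W * real n powr (- a)"
        using W n \<open>s' > a\<close> by (intro mult_left_mono powr_mono) auto
      finally show ?thesis using n by (simp add: \<theta>2 powr_minus_divide)
    qed
    have vanish: "v n x = 0" if "\<bar>x\<bar> \<le> 3/8" for x
    proof (rule bump_vanishes_near_integers[where v = "v n", OF _ \<theta>2_small])
      show "supp (v n) \<inter> {0..1} \<subseteq> {1/2 - \<theta>\<^sup>2 .. 1/2 + \<theta>\<^sup>2}"
        unfolding \<theta>2 by (rule v_supp[OF n])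
    qed (use v_periodic[OF n] that in simp_all)
    show ?case
    proof (intro allI impI)
      fix \<omega> \<xi>
      assume \<omega>: "\<omega> \<notin> \<rat>" "0 < \<omega>" "\<omega> < real n powr (- a / 2 - \<delta>)"
        and \<xi>: "\<xi> \<in> {1/2 - 1 / real n powr a .. 1/2 + 1 / real n powr a}"
      have "\<omega> < \<theta> / real n powr \<delta>" using \<omega>(3) by (simp add: \<theta>_def powr_diff)
      moreover have "1/4 \<le> \<xi>" "\<xi> \<le> 3/4" using \<xi> \<theta>2_small unfolding \<theta>2[symmetric] by auto
      ultimately show "Df n \<omega> \<xi> \<le> K * exp (- (real n powr \<delta>))"
        unfolding Df_def h_fam_eq[where a = a and n = n and v = v, OF tw] K_def
        by (intro barriers_exponentially_close[where w = "v n" and \<theta> = \<theta>, OF _ tw v_nonneg[OF n] v_le vanish \<theta> elim(2) _ \<omega>(1,2)])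
           (use W in \<open>simp_all add: u_pert_def \<theta>2\<close>)
    qed
  qed
  then obtain N where N: "\<And>n \<omega> \<xi>. n \<ge> N \<Longrightarrow> \<omega> \<notin> \<rat> \<Longrightarrow> 0 < \<omega> \<Longrightarrow> \<omega> < real n powr (- a / 2 - \<delta>) \<Longrightarrow>
      \<xi> \<in> {1/2 - 1 / real n powr a .. 1/2 + 1 / real n powr a} \<Longrightarrow>
      Df n \<omega> \<xi> \<le> K * exp (- (real n powr \<delta>))"
    unfolding eventually_sequentially by blast
  define C where "C = K + (\<Sum>n<N. \<bar>B n\<bar> * exp (real n powr \<delta>))"
  have K: "0 < K" by (simp add: K_def)
  have sum_nonneg: "0 \<le> (\<Sum>n<N. \<bar>B n\<bar> * exp (real n powr \<delta>))" by (intro sum_nonneg) simp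
  have "Df n \<omega> \<xi> \<le> C * exp (- (real n powr \<delta>))"
    if n: "n \<ge> 1" and \<omega>: "\<omega> \<notin> \<rat>" "0 < \<omega>" "\<omega> < real n powr (- a / 2 - \<delta>)"
      and \<xi>: "\<xi> \<in> {1/2 - 1 / real n powr a .. 1/2 + 1 / real n powr a}" for n \<omega> \<xi>
  proof (cases "N \<le> n")
    case True
    have "Df n \<omega> \<xi> \<le> K * exp (- (real n powr \<delta>))" by (rule N[OF True \<omega> \<xi>])
    also have "\<dots> \<le> C * exp (- (real n powr \<delta>))"
      unfolding C_def using sum_nonneg by (intro mult_right_mono) auto
    finally show ?thesis .
  next
    case False
    have "\<bar>B n\<bar> * exp (real n powr \<delta>) \<le> (\<Sum>n<N. \<bar>B n\<bar> * exp (real n powr \<delta>))"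
      by (rule member_le_sum) (use False in auto)
    then have "\<bar>B n\<bar> * exp (real n powr \<delta>) \<le> C" using K by (simp add: C_def)
    then have "\<bar>B n\<bar> * exp (real n powr \<delta>) * exp (- (real n powr \<delta>)) \<le> C * exp (- (real n powr \<delta>))"
      by (intro mult_right_mono) auto
    moreover have "Df n \<omega> \<xi> \<le> B n" by (rule B[OF n \<omega>(1,2) freq[OF n \<omega>(3)]])
    ultimately show ?thesis by (simp add: mult.assoc exp_minus_inverse)
  qed
  moreover have "0 < C" using K sum_nonneg by (simp add: C_def)
  ultimately show ?thesis unfolding Df_def by blast
qed

end
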